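(* Let $(G,K,\Gamma_K)$ be transitive, unimodular and infinitely accessible, and consider the diffusion-limited annihilating-coalescing system (DLACS) on $G$ with jump rates $\lambda_A>0$, $\lambda_B\ge0$, caps $M,N\in[0,\infty]$, and initial density $p\in[0,1]$ of $A$-particles. Let $W_T=W_T(\mathbf 0)$ and $V_T=V_T(\mathbf 0)$ be the weighted and unweighted occupation times of the root by $A$-particles up to time $T$. Then for all $T\ge0$ $$\mathbb E[W_T]=\int_0^T\mathbb P(\tau(\mathfrak a_{\mathbf 0})>t)\,dt\ \ge\ \mathbb P(\mathfrak a_{\mathbf 0}\not\longleftrightarrow\mathfrak b)\,T.$$ And, if $M<\infty$, then $$\mathbb E[V_T]\ \ge\ \frac{\mathbb P(\mathfrak a_{\mathbf 0}\not\longleftrightarrow\mathfrak b)}{2M}\,T.$$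
   Context: Graph. $G=(\mathcal V,\mathcal E)$ is a simple, locally finite, connected graph with root $\mathbf 0$, and $K\colon\mathcal V\times\mathcal V\to[0,1]$ is a Markov transition kernel with $K(u,v)=0$ if $(u,v)\notin\mathcal E$ and $\sum_{v\in N(u)}K(u,v)=1$, where $N(u)$ is the set of neighbors of $u$. $\mathrm{Aut}_K(G)$ is the group of automorphisms $\varphi$ of $G$ with $K(u,v)=K(\varphi(u),\varphi(v))$ for all $u,v$; $\Gamma_K\le \mathrm{Aut}_K(G)$ is a subgroup, and $\Gamma_K(u,v)=\{\varphi\in\Gamma_K:\varphi(u)=v\}$. The triple $(G,K,\Gamma_K)$ is: transitive if $\Gamma_K(u,v)\neq\varnothing$ for all $u,v\in\mathcal V$; unimodular if $|\Gamma_K(u,u)v|=|\Gamma_K(v,v)u|<\infty$ for all $u,v\in\mathcal V$; infinitely accessible if there are $\varphi\in\Gamma_K$ and $u\in\mathcal V$ such that $\{\varphi^n(u):n\ge0\}$ is infinite and $u$ is accessible from $\varphi(u)$, where $u$ is accessible from $v$ if there is a sequence $v=x_0,\dots,x_n=u$ of adjacent vertices with $\prod_{i=0}^{n-1}K(x_i,x_{i+1})>0$. DLACS. Independently at each site $x\in\mathcal V$, there is initially one $A_1$-particle with probability $p$ and otherwise one $B_1$-particle. Each particle has an independent discrete-time random walk path with kernel $K$ from its starting site, and an independent Uniform$(0,1)$ bravery. $A$-particles (of any size) jump along their paths at the times of independent rate $\lambda_A>0$ exponential clocks, $B$-particles at the times of rate $\lambda_B\ge0$ clocks. When particles meet they react: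 $A_i+B_j\to\varnothing$ for all $i,j\ge1$; $A_i+A_j\to A_{i+j}$ if $\max(i,j)\le M$, and otherwise no interaction; $B_i+B_j\to B_{i+j}$ if $\max(i,j)\le N$, and otherwise no interaction. If several particles are at a site, reactions occur pairwise giving priority to the highest-bravery particles until no further reaction is possible at that instant. A coalesced particle inherits the path and bravery of the braver of the two coalescing particles. The index $i$ is the size; an $A_i$-particle (resp. $B_i$-particle) is regarded as a cluster of $i$ of the original $A$-particles (resp. $B$-particles). Notation. For $i\ge1$, $\xi^i_t(x)$ is the number of $A_i$-particles at $x$ at time $t$. $W_T(x)=\int_0^T\sum_{i\ge1}i\,\xi^i_t(x)\,dt$ and $V_T(x)=\int_0^T\sum_{i\ge1}\xi^i_t(x)\,dt$. For a vertex $u$, $\mathfrak a_u$ denotes both the event that $u$ initially contains an $A_1$-particle and that particle itself; $\mathfrak b_u$ is the same for $B_1$-particles. $\tau(\mathfrak a_{\mathbf 0})$ is the lifespan of the $A$-particle started at $\mathbf 0$: the time at which it (and its coalesced cluster) mutually annihilates with a $B$-particle; $\tau(\mathfrak a_{\mathbf 0})=0$ if $\mathbf 0$ initially contains a $B$-particle, and $\tau(\mathfrak a_{\mathbf 0})=\infty$ if the $A$-particle at $\mathbf 0$ is never destroyed. A particle that coalesces with another $A$-particle and begins following a different path is regarded as surviving. $\{\mathfrak a_{\mathbf 0}\longleftrightarrow\mathfrak b\}$ is the event that there exists $v$ such that $\mathfrak a_{\mathbf 0}$ mutually annihilates with $\mathfrak b_v$, and $\{\mathfrak a_{\mathbf 0}\not\longleftrightarrow\mathfrak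 b\}$ denotes the complement of this event.
   Formalization: The event that a_0 does not annihilate with b is taken within the event that the root initially holds an A-particle (the full complement makes the claim false, e.g. at p=0); for M=0, where the bound divides by 2M=0, the last inequality says nothing. *)

theory Defs
  imports
    "HOL-Probability.Probability"
    "HOL-Algebra.Group"
    "HOL-Library.While_Combinator"
    "HOL-Library.Extended_Nat"
begin

section \<open>Graphs with a transition kernel and a group of symmetries\<close>

text \<open>The vertex set is the whole (nonempty, otherwise arbitrary) type \<open>'v\<close>.\<close>

definition simple_lf_connected_graph :: "('v \<Rightarrow> 'v \<Rightarrow> bool) \<Rightarrow> bool" where
  "simple_lf_connected_graph adj \<longleftrightarrow>
     (\<forall>u v. adj u v \<longrightarrow> adj v u) \<and> (\<forall>u. \<not> adj u u) \<and>
     (\<forall>u. finite {v. adj u v}) \<and> (\<forall>u v. adj\<^sup>*\<^sup>* u v)"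

definition transition_kernel :: "('v \<Rightarrow> 'v \<Rightarrow> bool) \<Rightarrow> ('v \<Rightarrow> 'v \<Rightarrow> real) \<Rightarrow> bool" where
  "transition_kernel adj K \<longleftrightarrow>
     (\<forall>u v. 0 \<le> K u v \<and> K u v \<le> 1) \<and> (\<forall>u v. \<not> adj u v \<longrightarrow> K u v = 0) \<and>
     (\<forall>u. (\<Sum>v | adj u v. K u v) = 1)"

definition Aut_K :: "('v \<Rightarrow> 'v \<Rightarrow> bool) \<Rightarrow> ('v \<Rightarrow> 'v \<Rightarrow> real) \<Rightarrow> ('v \<Rightarrow> 'v) monoid" where
  "Aut_K adj K =
     \<lparr> carrier = {\<phi>. bij \<phi> \<and> (\<forall>u v. adj (\<phi> u) (\<phi> v) \<longleftrightarrow> adj u v) \<and> (\<forall>u v. K u v = K (\<phi> u) (\<phi> v))},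
       monoid.mult = (\<circ>), one = id \<rparr>"

definition maps_to :: "('v \<Rightarrow> 'v) set \<Rightarrow> 'v \<Rightarrow> 'v \<Rightarrow> ('v \<Rightarrow> 'v) set" where
  "maps_to \<Gamma> u v = {\<phi> \<in> \<Gamma>. \<phi> u = v}"

definition transitive_on :: "('v \<Rightarrow> 'v) set \<Rightarrow> bool" where
  "transitive_on \<Gamma> \<longleftrightarrow> (\<forall>u v. maps_to \<Gamma> u v \<noteq> {})"

definition unimodular_on :: "('v \<Rightarrow> 'v) set \<Rightarrow> bool" where
  "unimodular_on \<Gamma> \<longleftrightarrow>
     (\<forall>u v. finite ((\<lambda>\<phi>. \<phi> v) ` maps_to \<Gamma> u u) \<and> finite ((\<lambda>\<phi>. \<phi> u) ` maps_to \<Gamma> v v) \<and>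
            card ((\<lambda>\<phi>. \<phi> v) ` maps_to \<Gamma> u u) = card ((\<lambda>\<phi>. \<phi> u) ` maps_to \<Gamma> v v))"

text \<open>\<open>accessible adj K u v\<close>: the vertex \<open>u\<close> is accessible from \<open>v\<close>.\<close>

definition accessible :: "('v \<Rightarrow> 'v \<Rightarrow> bool) \<Rightarrow> ('v \<Rightarrow> 'v \<Rightarrow> real) \<Rightarrow> 'v \<Rightarrow> 'v \<Rightarrow> bool" where
  "accessible adj K u v \<longleftrightarrow>
     (\<exists>n (x :: nat \<Rightarrow> 'v). x 0 = v \<and> x n = u \<and> (\<forall>i<n. adj (x i) (x (Suc i))) \<and>
                        (\<Prod>i<n. K (x i) (x (Suc i))) > 0)"

definition infinitely_accessible ::
    "('v \<Rightarrow> 'v \<Rightarrow> bool) \<Rightarrow> ('v \<Rightarrow> 'v \<Rightarrow> real) \<Rightarrow> ('v \<Rightarrow> 'v) set \<Rightarrow> bool" where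
  "infinitely_accessible adj K \<Gamma> \<longleftrightarrow>
     (\<exists>\<phi>\<in>\<Gamma>. \<exists>u. infinite (range (\<lambda>n. (\<phi> ^^ n) u)) \<and> accessible adj K u (\<phi> u))"


section \<open>Randomness attached to a site\<close>

datatype species = TypeA | TypeB

text \<open>
  A particle consists of its species, its discrete walk path, its waiting times and its
  bravery. Waiting times are stored as Exp(1) variables; dividing them by the jump rate of the
  species gives the exponential clock of that rate, and rate 0 means that the particle never jumps.
\<close>

type_synonym 'v particle = "species \<times> (nat \<Rightarrow> 'v) \<times> (nat \<Rightarrow> real) \<times> real"

definition spec :: "'v particle \<Rightarrow> species" where "spec q = fst q"
definition walk :: "'v particle \<Rightarrow> nat \<Rightarrow> 'v" where "walk q = fst (snd q)"
definition wait :: "'v particle \<Rightarrow> nat \<Rightarrow> real" where "wait q = fst (snd (snd q))"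
definition bravery :: "'v particle \<Rightarrow> real" where "bravery q = snd (snd (snd q))"

definition path_space :: "(nat \<Rightarrow> 'v) measure" where
  "path_space = PiM UNIV (\<lambda>_. count_space UNIV)"

definition particle_space :: "'v particle measure" where
  "particle_space =
     count_space UNIV \<Otimes>\<^sub>M path_space \<Otimes>\<^sub>M PiM UNIV (\<lambda>_. borel) \<Otimes>\<^sub>M borel"

definition species_law :: "real \<Rightarrow> species measure" where
  "species_law p = measure_pmf (map_pmf (\<lambda>b. if b then TypeA else TypeB) (bernoulli_pmf p))"

text \<open>\<open>walk_law K x \<mu>\<close>: \<open>\<mu>\<close> is the law of the Markov chain with kernel \<open>K\<close> started at \<open>x\<close>.\<close>

definition walk_law :: "('v \<Rightarrow> 'v \<Rightarrow> real) \<Rightarrow> 'v \<Rightarrow> (nat \<Rightarrow> 'v) measure \<Rightarrow> bool" where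
  "walk_law K x \<mu> \<longleftrightarrow> prob_space \<mu> \<and> sets \<mu> = sets path_space \<and>
     (\<forall>n y. measure \<mu> {s \<in> space \<mu>. \<forall>i\<le>n. s i = y i} =
            (if y 0 = x then \<Prod>i<n. K (y i) (y (Suc i)) else 0))"

definition wait_law :: "(nat \<Rightarrow> real) measure" where
  "wait_law = PiM UNIV (\<lambda>_. density lborel (\<lambda>s. ennreal (exponential_density 1 s)))"

definition bravery_law :: "real measure" where
  "bravery_law = uniform_measure lborel {0<..<1}"

text \<open>
  \<open>\<eta> x\<close> is the particle initially at site \<open>x\<close>. Sites are independent of each other, and the
  product law of \<open>\<eta> x\<close> makes its four components independent.
\<close>

definition dlacs_randomness ::
    "('v \<Rightarrow> 'v \<Rightarrow> real) \<Rightarrow> real \<Rightarrow> 'w measure \<Rightarrow> ('v \<Rightarrow> 'w \<Rightarrow> 'v particle) \<Rightarrow> bool" where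
  "dlacs_randomness K p P \<eta> \<longleftrightarrow> prob_space P \<and>
     prob_space.indep_vars P (\<lambda>_. particle_space) \<eta> UNIV \<and>
     (\<forall>x. \<exists>\<mu>. walk_law K x \<mu> \<and>
        distr P particle_space (\<eta> x) = species_law p \<Otimes>\<^sub>M \<mu> \<Otimes>\<^sub>M wait_law \<Otimes>\<^sub>M bravery_law)"


section \<open>Dynamics with finitely many particles\<close>

text \<open>
  From here on, \<open>e x\<close> is the realised particle started at site \<open>x\<close>, and particles are named by
  their starting sites. The functions \<open>rate\<close> and \<open>cap\<close> give the jump rate and the size cap of
  each species. \<open>position rate e v t\<close> is where \<open>v\<close> is at time \<open>t\<close> when following its own path.
\<close>

definition ring :: "'v particle \<Rightarrow> nat \<Rightarrow> real" where
  "ring q n = (\<Sum>k\<le>n. wait q k)"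

definition position :: "(species \<Rightarrow> real) \<Rightarrow> ('v \<Rightarrow> 'v particle) \<Rightarrow> 'v \<Rightarrow> real \<Rightarrow> 'v" where
  "position rate e v t = walk (e v) (card {n. ring (e v) n \<le> rate (spec (e v)) * t})"

definition jump_times ::
    "(species \<Rightarrow> real) \<Rightarrow> ('v \<Rightarrow> 'v particle) \<Rightarrow> 'v set \<Rightarrow> real \<Rightarrow> real set" where
  "jump_times rate e F t =
     {s. 0 \<le> s \<and> s \<le> t \<and> (\<exists>v\<in>F. \<exists>n. ring (e v) n = rate (spec (e v)) * s)}"

text \<open>
  A state \<open>(\<rho>, R)\<close> records for every original particle \<open>v\<close> the particle \<open>l\<close> whose path and
  bravery the cluster of \<open>v\<close> has inherited (\<open>\<rho> v = Some l\<close>), or that \<open>v\<close> is not present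
  (\<open>\<rho> v = None\<close>); \<open>R\<close> is the set of pairs of original particles whose clusters have mutually
  annihilated. A cluster is named by the particle \<open>l\<close> it follows.
\<close>

type_synonym 'v state = "('v \<Rightarrow> 'v option) \<times> ('v \<times> 'v) set"

definition cluster :: "'v state \<Rightarrow> 'v \<Rightarrow> 'v set" where
  "cluster \<sigma> l = {v. fst \<sigma> v = Some l}"

definition can_react ::
    "(species \<Rightarrow> enat) \<Rightarrow> ('v \<Rightarrow> 'v particle) \<Rightarrow> ('v \<Rightarrow> 'v) \<Rightarrow> 'v state \<Rightarrow> 'v \<Rightarrow> 'v \<Rightarrow> bool" where
  "can_react cap e pos \<sigma> l m \<longleftrightarrow>
     l \<noteq> m \<and> cluster \<sigma> l \<noteq> {} \<and> cluster \<sigma> m \<noteq> {} \<and> pos l = pos m \<and>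
     (spec (e l) = spec (e m) \<longrightarrow>
        enat (max (card (cluster \<sigma> l)) (card (cluster \<sigma> m))) \<le> cap (spec (e l)))"

definition react :: "('v \<Rightarrow> 'v particle) \<Rightarrow> 'v \<Rightarrow> 'v \<Rightarrow> 'v state \<Rightarrow> 'v state" where
  "react e l m \<sigma> =
     (if spec (e l) = spec (e m)
      then (\<lambda>v. if fst \<sigma> v = Some m then Some l else fst \<sigma> v, snd \<sigma>)
      else (\<lambda>v. if v \<in> cluster \<sigma> l \<union> cluster \<sigma> m then None else fst \<sigma> v,
            snd \<sigma> \<union> cluster \<sigma> l \<times> cluster \<sigma> m \<union> cluster \<sigma> m \<times> cluster \<sigma> l))"

text \<open>
  The bravest cluster that can react does so first, with its bravest possible partner. The partner
  can itself react, hence is at most as brave, and a coalesced cluster follows the former.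
\<close>

definition first_reaction ::
    "(species \<Rightarrow> enat) \<Rightarrow> ('v \<Rightarrow> 'v particle) \<Rightarrow> ('v \<Rightarrow> 'v) \<Rightarrow> 'v state \<Rightarrow> 'v state" where
  "first_reaction cap e pos \<sigma> =
     (let l = arg_max_on (\<lambda>v. bravery (e v)) {l. \<exists>m. can_react cap e pos \<sigma> l m};
          m = arg_max_on (\<lambda>v. bravery (e v)) {m. can_react cap e pos \<sigma> l m}
      in react e l m \<sigma>)"

definition resolve ::
    "(species \<Rightarrow> enat) \<Rightarrow> ('v \<Rightarrow> 'v particle) \<Rightarrow> ('v \<Rightarrow> 'v) \<Rightarrow> 'v state \<Rightarrow> 'v state" where
  "resolve cap e pos = while (\<lambda>\<sigma>. \<exists>l m. can_react cap e pos \<sigma> l m) (first_reaction cap e pos)"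

text \<open>
  The system in which only the particles of the finite set \<open>F\<close> are present, at time \<open>t\<close>: all
  reactions are carried out at each jump time, in chronological order. On the null event that the
  clocks ring infinitely often before \<open>t\<close>, the state is set to a constant that is maximal in both
  components (nobody present, all pairs annihilated), so that it stays monotone in \<open>t\<close> there.
\<close>

definition finite_system ::
    "(species \<Rightarrow> real) \<Rightarrow> (species \<Rightarrow> enat) \<Rightarrow> ('v \<Rightarrow> 'v particle) \<Rightarrow> 'v set \<Rightarrow> real \<Rightarrow> 'v state" where
  "finite_system rate cap e F t =
     (if finite (jump_times rate e F t)
      then fold (\<lambda>s. resolve cap e (\<lambda>v. position rate e v s))
             (sorted_list_of_set (jump_times rate e F t))
             (\<lambda>v. if v \<in> F then Some v else None, {})
      else (\<lambda>v. None, UNIV))"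


section \<open>The system on the whole graph\<close>

text \<open>
  The infinite system is the limit of the finite ones: a statement about finitely many particles up
  to time \<open>t\<close> holds in it if it holds in the system of particles from \<open>F\<close> for all sufficiently
  large finite \<open>F\<close>.
\<close>

definition follows ::
    "(species \<Rightarrow> real) \<Rightarrow> (species \<Rightarrow> enat) \<Rightarrow> ('v \<Rightarrow> 'v particle) \<Rightarrow> real \<Rightarrow> 'v \<Rightarrow> 'v \<Rightarrow> bool" where
  "follows rate cap e t v l \<longleftrightarrow>
     (\<forall>\<^sub>F F in finite_subsets_at_top UNIV. fst (finite_system rate cap e F t) v = Some l)"

definition destroyed ::
    "(species \<Rightarrow> real) \<Rightarrow> (species \<Rightarrow> enat) \<Rightarrow> ('v \<Rightarrow> 'v particle) \<Rightarrow> real \<Rightarrow> 'v \<Rightarrow> bool" where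
  "destroyed rate cap e t v \<longleftrightarrow>
     (\<forall>\<^sub>F F in finite_subsets_at_top UNIV. fst (finite_system rate cap e F t) v = None)"

definition annihilates ::
    "(species \<Rightarrow> real) \<Rightarrow> (species \<Rightarrow> enat) \<Rightarrow> ('v \<Rightarrow> 'v particle) \<Rightarrow> 'v \<Rightarrow> 'v \<Rightarrow> bool" where
  "annihilates rate cap e u v \<longleftrightarrow>
     (\<exists>t\<ge>0. \<forall>\<^sub>F F in finite_subsets_at_top UNIV. (u, v) \<in> snd (finite_system rate cap e F t))"

text \<open>\<open>xi rate cap e i t x\<close> is the number of \<open>A\<^sub>i\<close>-particles at \<open>x\<close> at time \<open>t\<close>, for \<open>i \<ge> 1\<close>.\<close>

definition xi ::
    "(species \<Rightarrow> real) \<Rightarrow> (species \<Rightarrow> enat) \<Rightarrow> ('v \<Rightarrow> 'v particle) \<Rightarrow> nat \<Rightarrow> real \<Rightarrow> 'v \<Rightarrow> nat" where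
  "xi rate cap e i t x =
     card {l. spec (e l) = TypeA \<and> position rate e l t = x \<and>
              card {v. follows rate cap e t v l} = i}"

definition weighted_occupation ::
    "(species \<Rightarrow> real) \<Rightarrow> (species \<Rightarrow> enat) \<Rightarrow> ('v \<Rightarrow> 'v particle) \<Rightarrow> real \<Rightarrow> 'v \<Rightarrow> ennreal" where
  "weighted_occupation rate cap e T x =
     (\<integral>\<^sup>+t\<in>{0..T}. (\<Sum>i. of_nat (Suc i) * of_nat (xi rate cap e (Suc i) t x)) \<partial>lborel)"

definition occupation ::
    "(species \<Rightarrow> real) \<Rightarrow> (species \<Rightarrow> enat) \<Rightarrow> ('v \<Rightarrow> 'v particle) \<Rightarrow> real \<Rightarrow> 'v \<Rightarrow> ennreal" where
  "occupation rate cap e T x =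
     (\<integral>\<^sup>+t\<in>{0..T}. (\<Sum>i. of_nat (xi rate cap e (Suc i) t x)) \<partial>lborel)"

definition lifespan ::
    "(species \<Rightarrow> real) \<Rightarrow> (species \<Rightarrow> enat) \<Rightarrow> ('v \<Rightarrow> 'v particle) \<Rightarrow> 'v \<Rightarrow> ennreal" where
  "lifespan rate cap e u =
     (if spec (e u) = TypeB then 0 else (INF t\<in>{t. 0 \<le> t \<and> destroyed rate cap e t u}. ennreal t))"

definition annihilated_by_b ::
    "(species \<Rightarrow> real) \<Rightarrow> (species \<Rightarrow> enat) \<Rightarrow> ('v \<Rightarrow> 'v particle) \<Rightarrow> 'v \<Rightarrow> bool" where
  "annihilated_by_b rate cap e u \<longleftrightarrow>
     spec (e u) = TypeA \<and> (\<exists>v. spec (e v) = TypeB \<and> annihilates rate cap e u v)"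

text \<open>
  The complement is taken within the event that \<open>u\<close> initially holds an \<open>A\<close>-particle: the particle
  exists and is never annihilated.
\<close>

definition not_annihilated_by_b ::
    "(species \<Rightarrow> real) \<Rightarrow> (species \<Rightarrow> enat) \<Rightarrow> ('v \<Rightarrow> 'v particle) \<Rightarrow> 'v \<Rightarrow> bool" where
  "not_annihilated_by_b rate cap e u \<longleftrightarrow> spec (e u) = TypeA \<and> \<not> annihilated_by_b rate cap e u"

end

theory Submission
  imports Defs
begin

text \<open>
  Existence of the infinite system. Let a particle that jumps during a time interval connect all the
  sites it visits. By mass transport, the expected number of chains of \<open>n\<close> distinct such particles
  leaving a site is at most the \<open>n\<close>-th power of \<open>E[(J + 1)\<^sup>2; J \<ge> 1]\<close>, where \<open>J\<close> counts the
  jumps of one particle, and this is small for short intervals. Hence only finitely many particles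
  influence a given one during a short interval, and the states of the finite systems become
  eventually constant; a bisection argument extends this to all times.

  Occupation times. Each living original particle transports unit mass to the current site of its
  cluster. The expected mass leaving the root is the probability that its particle is alive, the
  expected mass arriving is the expected weighted number of particles at the root.
\<close>

section \<open>Reactions at a fixed time\<close>

text \<open>Annihilation destroys monotonicity: adding a particle may remove a second one and
  thereby save a third. So enlarging \<open>F\<close> moves the finite systems in no fixed
  direction, and their limit has to come from locality instead. Chains must consist of distinct
  particles because only then is the probability of a chain the product of the probabilities of its
  links; a chain that uses a particle twice can be shortened, since a particle links any two sites
  of its range. The square arises because a chain can enter the range of a particle at any of up to
  \<open>J + 1\<close> sites and leave it at any of them. Stability is almost sure for each fixed
  time, with a null set depending on that time, so occupation times are reached by integrating
  fixed-time identities through Fubini. The set of partners of a particle is part of what becomes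
  constant, so that a destroyed particle has an actual opponent in the infinite system; this is what
  bounds survival from below by non-annihilation.\<close>

lemma arg_max_on_finite:
  fixes f :: "'a \<Rightarrow> real"
  assumes "finite S" "S \<noteq> {}"
  shows "arg_max_on f S \<in> S" "\<And>y. y \<in> S \<Longrightarrow> f y \<le> f (arg_max_on f S)"
proof -
  have "Max (f ` S) \<in> f ` S" using assms by simp
  then obtain x where x: "x \<in> S" "f x = Max (f ` S)" by auto
  have "is_arg_max f (\<lambda>x. x \<in> S) x"
    using x assms by (auto simp: is_arg_max_linorder)
  hence "is_arg_max f (\<lambda>x. x \<in> S) (arg_max_on f S)"
    unfolding arg_max_on_def arg_max_def by (rule someI)
  thus "arg_max_on f S \<in> S" "\<And>y. y \<in> S \<Longrightarrow> f y \<le> f (arg_max_on f S)"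
    by (auto simp: is_arg_max_linorder)
qed

lemma cluster_nonempty_iff: "cluster \<sigma> l \<noteq> {} \<longleftrightarrow> l \<in> ran (fst \<sigma>)"
  by (auto simp: cluster_def ran_def)

lemma can_reactD:
  assumes "can_react cap e pos \<sigma> l m"
  shows "l \<noteq> m" "l \<in> ran (fst \<sigma>)" "m \<in> ran (fst \<sigma>)" "pos l = pos m"
  using assms by (auto simp: can_react_def cluster_nonempty_iff)

text \<open>\<open>first_reaction\<close> picks its pair by choice operators; this is the property
  of the pair that they guarantee. Comparisons between systems argue from it, and distinct braveries
  make the pair unique.\<close>

definition is_first ::
    "(species \<Rightarrow> enat) \<Rightarrow> ('v \<Rightarrow> 'v particle) \<Rightarrow> ('v \<Rightarrow> 'v) \<Rightarrow> 'v state \<Rightarrow> 'v \<Rightarrow> 'v \<Rightarrow> bool" where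
  "is_first cap e pos \<sigma> l m \<longleftrightarrow> can_react cap e pos \<sigma> l m \<and>
     (\<forall>l' m'. can_react cap e pos \<sigma> l' m' \<longrightarrow> bravery (e l') \<le> bravery (e l)) \<and>
     (\<forall>m'. can_react cap e pos \<sigma> l m' \<longrightarrow> bravery (e m') \<le> bravery (e m))"

lemma first_reactionE:
  assumes fin: "finite (ran (fst \<sigma>))" and ex: "\<exists>l m. can_react cap e pos \<sigma> l m"
  obtains l m where "is_first cap e pos \<sigma> l m" "first_reaction cap e pos \<sigma> = react e l m \<sigma>"
proof -
  let ?S = "{l. \<exists>m. can_react cap e pos \<sigma> l m}"
  define l where "l = arg_max_on (\<lambda>v. bravery (e v)) ?S"
  let ?T = "{m. can_react cap e pos \<sigma> l m}"
  define m where "m = arg_max_on (\<lambda>v. bravery (e v)) ?T"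
  have S: "finite ?S" "?S \<noteq> {}"
    using ex by (auto intro: finite_subset[OF _ fin] dest: can_reactD)
  have l: "l \<in> ?S" "\<And>y. y \<in> ?S \<Longrightarrow> bravery (e y) \<le> bravery (e l)"
    unfolding l_def using arg_max_on_finite[OF S, where f="\<lambda>v. bravery (e v)"] by auto
  have T: "finite ?T" "?T \<noteq> {}"
    using l(1) by (auto intro: finite_subset[OF _ fin] dest: can_reactD)
  have m: "m \<in> ?T" "\<And>y. y \<in> ?T \<Longrightarrow> bravery (e y) \<le> bravery (e m)"
    unfolding m_def using arg_max_on_finite[OF T, where f="\<lambda>v. bravery (e v)"] by auto
  have "is_first cap e pos \<sigma> l m" using l m by (auto simp: is_first_def)
  moreover have "first_reaction cap e pos \<sigma> = react e l m \<sigma>"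
    by (simp add: first_reaction_def Let_def l_def m_def)
  ultimately show ?thesis using that by blast
qed

lemma is_first_unique:
  assumes "is_first cap e pos \<sigma> l m" "is_first cap e pos \<sigma> l' m'" "inj (\<lambda>v. bravery (e v))"
  shows "l = l'" "m = m'"
proof -
  have "bravery (e l) = bravery (e l')"
    using assms(1,2) unfolding is_first_def by (meson order_antisym)
  thus 1: "l = l'" using assms(3) by (auto dest: injD)
  have "bravery (e m) = bravery (e m')"
    using assms(1,2) 1 unfolding is_first_def by (meson order_antisym)
  thus "m = m'" using assms(3) by (auto dest: injD)
qed

text \<open>The leader \<open>m\<close> disappears either way, absorbed by \<open>l\<close> or
  annihilated with it. The resulting drop in the number of leaders is the termination measure for
  \<open>resolve\<close>.\<close>

lemma ran_react:
  assumes "can_react cap e pos \<sigma> l m"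
  shows "ran (fst (react e l m \<sigma>)) \<subseteq> ran (fst \<sigma>) - {m}"
  using can_reactD[OF assms]
  by (auto simp: react_def ran_def cluster_def split: if_splits)

lemma card_ran_react:
  assumes "can_react cap e pos \<sigma> l m" "finite (ran (fst \<sigma>))"
  shows "finite (ran (fst (react e l m \<sigma>)))"
    "card (ran (fst (react e l m \<sigma>))) < card (ran (fst \<sigma>))"
proof -
  show "finite (ran (fst (react e l m \<sigma>)))"
    using ran_react[OF assms(1)] assms(2) by (auto intro: finite_subset)
  have "ran (fst (react e l m \<sigma>)) \<subset> ran (fst \<sigma>)"
    using ran_react[OF assms(1)] can_reactD[OF assms(1)] by auto
  thus "card (ran (fst (react e l m \<sigma>))) < card (ran (fst \<sigma>))"
    using assms(2) by (rule psubset_card_mono[rotated])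
qed

lemma resolve_unfold:
  "resolve cap e pos \<sigma> =
     (if \<exists>l m. can_react cap e pos \<sigma> l m then resolve cap e pos (first_reaction cap e pos \<sigma>) else \<sigma>)"
  unfolding resolve_def by (subst while_unfold) simp

lemma resolve_idle: "(\<And>l m. \<not> can_react cap e pos \<sigma> l m) \<Longrightarrow> resolve cap e pos \<sigma> = \<sigma>"
  by (subst resolve_unfold) auto

text \<open>Every reaction removes a leader, so one induction on their number shows that the loop
  halts, that no reaction is possible afterwards, and that an invariant of single reactions
  survives.\<close>

lemma resolve_rule:
  assumes "finite (ran (fst \<sigma>))" "Q \<sigma>"
    and step: "\<And>\<sigma> l m. Q \<sigma> \<Longrightarrow> can_react cap e pos \<sigma> l m \<Longrightarrow> Q (react e l m \<sigma>)"
  shows "Q (resolve cap e pos \<sigma>) \<and> finite (ran (fst (resolve cap e pos \<sigma>))) \<and>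
    (\<forall>l m. \<not> can_react cap e pos (resolve cap e pos \<sigma>) l m)"
  using assms(1,2)
proof (induction "card (ran (fst \<sigma>))" arbitrary: \<sigma> rule: less_induct)
  case less
  show ?case
  proof (cases "\<exists>l m. can_react cap e pos \<sigma> l m")
    case False
    thus ?thesis using less.prems by (simp add: resolve_idle)
  next
    case True
    obtain l m where lm: "is_first cap e pos \<sigma> l m" "first_reaction cap e pos \<sigma> = react e l m \<sigma>"
      using first_reactionE[OF less.prems(1) True] .
    hence c: "can_react cap e pos \<sigma> l m" by (simp add: is_first_def)
    have "resolve cap e pos \<sigma> = resolve cap e pos (react e l m \<sigma>)"
      using True lm(2) by (subst resolve_unfold) simp
    thus ?thesis
      using less.hyps[OF card_ran_react(2)[OF c less.prems(1)] card_ran_react(1)[OF c less.prems(1)]]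
        step[OF less.prems(2) c] by simp
  qed
qed

text \<open>Two loops that stay in lockstep under \<open>R\<close>. The leaders of the left state
  serve as the induction measure for both, since \<open>cond\<close> makes the right loop stop at
  the same moment.\<close>

lemma resolve_simulation:
  assumes "finite (ran (fst \<sigma>))" "R \<sigma> \<sigma>'"
    and cond: "\<And>\<sigma> \<sigma>'. finite (ran (fst \<sigma>)) \<Longrightarrow> R \<sigma> \<sigma>' \<Longrightarrow> 
       (\<exists>l m. can_react cap e pos \<sigma> l m) \<longleftrightarrow> (\<exists>l m. can_react cap e' pos' \<sigma>' l m)"
    and step: "\<And>\<sigma> \<sigma>'. finite (ran (fst \<sigma>)) \<Longrightarrow> R \<sigma> \<sigma>' \<Longrightarrow> \<exists>l m. can_react cap e pos \<sigma> l m \<Longrightarrow>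
       R (first_reaction cap e pos \<sigma>) (first_reaction cap e' pos' \<sigma>')"
  shows "R (resolve cap e pos \<sigma>) (resolve cap e' pos' \<sigma>')"
  using assms(1,2)
proof (induction "card (ran (fst \<sigma>))" arbitrary: \<sigma> \<sigma>' rule: less_induct)
  case less
  show ?case
  proof (cases "\<exists>l m. can_react cap e pos \<sigma> l m")
    case False
    hence "\<not> (\<exists>l m. can_react cap e' pos' \<sigma>' l m)" using cond less.prems by blast
    thus ?thesis using less.prems False by (simp add: resolve_idle)
  next
    case True
    hence T': "\<exists>l m. can_react cap e' pos' \<sigma>' l m" using cond less.prems by blast
    obtain l m where lm: "is_first cap e pos \<sigma> l m" "first_reaction cap e pos \<sigma> = react e l m \<sigma>"
      using first_reactionE[OF less.prems(1) True] .
    hence c: "can_react cap e pos \<sigma> l m" by (simp add: is_first_def)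
    have 1: "resolve cap e pos \<sigma> = resolve cap e pos (react e l m \<sigma>)"
      using True lm(2) by (subst resolve_unfold) simp
    have 2: "resolve cap e' pos' \<sigma>' = resolve cap e' pos' (first_reaction cap e' pos' \<sigma>')"
      using T' by (subst resolve_unfold) simp
    have "R (react e l m \<sigma>) (first_reaction cap e' pos' \<sigma>')"
      using step[OF less.prems True] lm by simp
    thus ?thesis unfolding 1 2 
      using less.hyps[OF card_ran_react(2)[OF c less.prems(1)] card_ran_react(1)[OF c less.prems(1)]]
      by simp
  qed
qed

section \<open>How the outcome of the reactions depends on the environment\<close>

definition supported :: "'v set \<Rightarrow> 'v state \<Rightarrow> bool" where
  "supported F \<sigma> \<longleftrightarrow> (\<forall>v l. fst \<sigma> v = Some l \<longrightarrow> v \<in> F \<and> l \<in> F) \<and> snd \<sigma> \<subseteq> F \<times> F"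

lemma supported_ran: "supported F \<sigma> \<Longrightarrow> ran (fst \<sigma>) \<subseteq> F"
  by (auto simp: supported_def ran_def)

lemma supported_react:
  assumes "supported F \<sigma>" "can_react cap e pos \<sigma> l m"
  shows "supported F (react e l m \<sigma>)"
  using assms supported_ran[OF assms(1)] can_reactD[OF assms(2)]
  by (auto simp: supported_def react_def cluster_def split: if_splits)

text \<open>All branching in \<open>resolve\<close> is decided by species, by the order of braveries
  and by coincidences of positions among the particles of \<open>F\<close>. Hence the outcome
  depends on finitely many yes-no questions, which is the source of its measurability.\<close>

lemma resolve_cong:
  assumes F: "finite F" "supported F \<sigma>"
    and sp: "\<And>v. v \<in> F \<Longrightarrow> spec (e v) = spec (e' v)"
    and br: "\<And>u v. u \<in> F \<Longrightarrow> v \<in> F \<Longrightarrow> bravery (e u) < bravery (e v) \<longleftrightarrow> bravery (e' u) < bravery (e' v)"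
    and ps: "\<And>u v. u \<in> F \<Longrightarrow> v \<in> F \<Longrightarrow> pos u = pos v \<longleftrightarrow> pos' u = pos' v"
  shows "resolve cap e pos \<sigma> = resolve cap e' pos' \<sigma> \<and> supported F (resolve cap e pos \<sigma>)"
proof -
  let ?R = "\<lambda>\<sigma> \<sigma>'. \<sigma>' = \<sigma> \<and> supported F \<sigma>"
  have react_iff: "can_react cap e pos \<sigma> l m \<longleftrightarrow> can_react cap e' pos' \<sigma> l m" if "supported F \<sigma>" for \<sigma> l m
  proof (cases "l \<in> F \<and> m \<in> F")
    case True thus ?thesis using sp ps by (auto simp: can_react_def)
  next
    case False thus ?thesis using supported_ran[OF that] by (auto dest: can_reactD)
  qed
  \<comment> \<open>\<open>arg_max_on\<close> is a choice from a predicate. Both environments give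
    the same predicate, hence the same choice, even if braveries tie.\<close>
  have amax: "arg_max_on (\<lambda>v. bravery (e v)) S = arg_max_on (\<lambda>v. bravery (e' v)) S" if "S \<subseteq> F" for S
  proof -
    have "(x \<in> S \<and> \<not> (\<exists>y. y \<in> S \<and> bravery (e x) < bravery (e y))) \<longleftrightarrow>
          (x \<in> S \<and> \<not> (\<exists>y. y \<in> S \<and> bravery (e' x) < bravery (e' y)))" for x
      using br that by (meson subsetD)
    thus ?thesis unfolding arg_max_on_def arg_max_def is_arg_max_def by simp
  qed
  have fst_eq: "first_reaction cap e pos \<sigma> = first_reaction cap e' pos' \<sigma> \<and> supported F (first_reaction cap e pos \<sigma>)"
    if s: "supported F \<sigma>" and ex: "\<exists>l m. can_react cap e pos \<sigma> l m" for \<sigma>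
  proof -
    have ran: "finite (ran (fst \<sigma>))" "ran (fst \<sigma>) \<subseteq> F" 
      using supported_ran[OF s] F(1) by (auto intro: finite_subset)
    let ?S = "{l. \<exists>m. can_react cap e pos \<sigma> l m}"
    have S: "?S \<subseteq> F" using ran(2) by (auto dest: can_reactD)
    have T: "{m. can_react cap e pos \<sigma> l m} \<subseteq> F" for l using ran(2) by (auto dest: can_reactD)
    obtain l m where lm: "is_first cap e pos \<sigma> l m" "first_reaction cap e pos \<sigma> = react e l m \<sigma>"
      using first_reactionE[OF ran(1) ex] .
    hence lm': "can_react cap e pos \<sigma> l m" by (simp add: is_first_def)
    let ?l = "arg_max_on (\<lambda>v. bravery (e v)) ?S" 
    let ?m = "arg_max_on (\<lambda>v. bravery (e v)) {m. can_react cap e pos \<sigma> ?l m}"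
    have fin: "finite ?S" "?S \<noteq> {}" using lm' S F(1) by (auto intro: finite_subset)
    have l: "?l \<in> ?S" using arg_max_on_finite(1)[OF fin] .
    hence "{m. can_react cap e pos \<sigma> ?l m} \<noteq> {}" by auto
    hence m: "?m \<in> {m. can_react cap e pos \<sigma> ?l m}" 
      using finite_subset[OF T F(1)] by (intro arg_max_on_finite(1))
    have lF: "?l \<in> F" "?m \<in> F" using l m S T by auto
    have "first_reaction cap e pos \<sigma> = react e ?l ?m \<sigma>" by (simp only: first_reaction_def Let_def)
    also have "\<dots> = react e' ?l ?m \<sigma>" using sp[OF lF(1)] sp[OF lF(2)] by (simp add: react_def)
    also have "\<dots> = first_reaction cap e' pos' \<sigma>"
      by (simp only: first_reaction_def Let_def react_iff[OF s, symmetric] amax[OF S, symmetric] amax[OF T, symmetric])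
    finally show ?thesis using lm(2) supported_react[OF s lm'] by simp
  qed
  have "?R (resolve cap e pos \<sigma>) (resolve cap e' pos' \<sigma>)"
  proof (rule resolve_simulation[where R = ?R])
    show "finite (ran (fst \<sigma>))" using supported_ran[OF F(2)] F(1) by (auto intro: finite_subset)
    show "?R (first_reaction cap e pos \<sigma>) (first_reaction cap e' pos' \<sigma>')"
      if "?R \<sigma> \<sigma>'" "\<exists>l m. can_react cap e pos \<sigma> l m" for \<sigma> \<sigma>'
      using fst_eq[of \<sigma>] that by metis
  qed (use F react_iff in auto)
  thus ?thesis by simp
qed

text \<open>Nothing in the dynamics refers to the names of particles except the choice operators,
  and injective bravery leaves them no freedom. The first components can be compared alone because
  the recorded pairs never influence a reaction.\<close>

lemma resolve_relabel:
  assumes "finite (ran (fst \<sigma>))" and \<phi>: "bij \<phi>"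
    and sim: "\<And>v. fst \<sigma>' (\<phi> v) = map_option \<phi> (fst \<sigma> v)"
    and sp: "\<And>v. spec (e' (\<phi> v)) = spec (e v)"
    and br: "\<And>v. bravery (e' (\<phi> v)) = bravery (e v)"
    and inj: "inj (\<lambda>v. bravery (e v))"
    and ps: "\<And>v. pos' (\<phi> v) = \<phi> (pos v)"
  shows "fst (resolve cap e' pos' \<sigma>') (\<phi> v) = map_option \<phi> (fst (resolve cap e pos \<sigma>) v)"
proof -
  let ?R = "\<lambda>\<sigma> \<sigma>'. \<forall>v. fst \<sigma>' (\<phi> v) = map_option \<phi> (fst \<sigma> v)"
  have inj\<phi>: "\<phi> x = \<phi> y \<longleftrightarrow> x = y" for x y using \<phi> by (auto simp: bij_def inj_def)
  have surj: "\<exists>x. y = \<phi> x" for y using \<phi> by (metis bij_pointE)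
  have inj': "inj (\<lambda>v. bravery (e' v))"
  proof (rule injI)
    fix x y assume "bravery (e' x) = bravery (e' y)"
    moreover obtain x' y' where "x = \<phi> x'" "y = \<phi> y'" using surj by blast
    ultimately show "x = y" using br inj by (auto dest: injD)
  qed
  have cl: "cluster \<sigma>' (\<phi> l) = \<phi> ` cluster \<sigma> l" if R: "?R \<sigma> \<sigma>'" for \<sigma> \<sigma>' l
  proof -
    have "v \<in> cluster \<sigma>' (\<phi> l) \<longleftrightarrow> v \<in> \<phi> ` cluster \<sigma> l" for v
    proof -
      obtain w where "v = \<phi> w" using surj by blast
      thus ?thesis using R inj\<phi> by (auto simp: cluster_def)
    qed
    thus ?thesis by blast
  qed
  have card_eq: "card (\<phi> ` A) = card A" for A using \<phi> by (intro card_image) (auto simp: bij_def inj_def inj_on_def)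
  have react_iff: "can_react cap e' pos' \<sigma>' (\<phi> l) (\<phi> m) \<longleftrightarrow> can_react cap e pos \<sigma> l m" if R: "?R \<sigma> \<sigma>'" for \<sigma> \<sigma>' l m
    by (simp add: can_react_def cl[OF R] card_eq sp ps inj\<phi>)
  have step: "?R (first_reaction cap e pos \<sigma>) (first_reaction cap e' pos' \<sigma>')"
    if fin: "finite (ran (fst \<sigma>))" and R: "?R \<sigma> \<sigma>'" and ex: "\<exists>l m. can_react cap e pos \<sigma> l m" for \<sigma> \<sigma>'
  proof -
    obtain l m where lm: "is_first cap e pos \<sigma> l m" "first_reaction cap e pos \<sigma> = react e l m \<sigma>"
      using first_reactionE[OF fin ex] .
    have ran': "ran (fst \<sigma>') \<subseteq> \<phi> ` ran (fst \<sigma>)"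
    proof
      fix y assume "y \<in> ran (fst \<sigma>')"
      then obtain x where "fst \<sigma>' x = Some y" by (auto simp: ran_def)
      moreover obtain w where "x = \<phi> w" using surj by blast
      ultimately have "map_option \<phi> (fst \<sigma> w) = Some y" using R by metis
      thus "y \<in> \<phi> ` ran (fst \<sigma>)" by (auto simp: ran_def)
    qed
    hence fin': "finite (ran (fst \<sigma>'))" using fin by (auto intro: finite_subset)
    have ex': "\<exists>l m. can_react cap e' pos' \<sigma>' l m" using ex react_iff[OF R] by blast
    obtain l' m' where lm': "is_first cap e' pos' \<sigma>' l' m'" "first_reaction cap e' pos' \<sigma>' = react e' l' m' \<sigma>'"
      using first_reactionE[OF fin' ex'] .
    have "is_first cap e' pos' \<sigma>' (\<phi> l) (\<phi> m)"
      unfolding is_first_def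
    proof (intro conjI allI impI)
      show "can_react cap e' pos' \<sigma>' (\<phi> l) (\<phi> m)" using lm react_iff[OF R] by (simp add: is_first_def)
    next
      fix a b assume *: "can_react cap e' pos' \<sigma>' a b"
      moreover obtain a' b' where "a = \<phi> a'" "b = \<phi> b'" using surj by blast
      ultimately show "bravery (e' a) \<le> bravery (e' (\<phi> l))" 
        using lm react_iff[OF R] by (auto simp: is_first_def br)
    next
      fix b assume *: "can_react cap e' pos' \<sigma>' (\<phi> l) b"
      moreover obtain b' where "b = \<phi> b'" using surj by blast
      ultimately show "bravery (e' b) \<le> bravery (e' (\<phi> m))" 
        using lm react_iff[OF R] by (auto simp: is_first_def br)
    qed
    from is_first_unique[OF lm'(1) this inj'] have "l' = \<phi> l" "m' = \<phi> m" by auto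
    thus ?thesis using R unfolding lm(2) lm'(2)
      by (auto simp: react_def sp cl[OF R] inj\<phi> image_iff split: option.splits)
  qed
  have "?R (resolve cap e pos \<sigma>) (resolve cap e' pos' \<sigma>')"
  proof (rule resolve_simulation[where R = ?R])
    show "(\<exists>l m. can_react cap e pos \<sigma> l m) \<longleftrightarrow> (\<exists>l m. can_react cap e' pos' \<sigma>' l m)" if R: "?R \<sigma> \<sigma>'" for \<sigma> \<sigma>'
      using react_iff[OF R] surj by metis
  qed (use assms step in auto)
  thus ?thesis by blast
qed

text \<open>Two systems agree on a set \<open>L\<close> of leaders, where \<open>D\<close> contains all original particles that they
  lead, including those already destroyed. If \<open>L\<close> is closed under meeting, reactions outside \<open>L\<close>
  preserve agreement, and the next reaction inside \<open>L\<close> is the same in both systems.\<close>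

definition agree :: "'v set \<Rightarrow> 'v set \<Rightarrow> 'v state \<Rightarrow> 'v state \<Rightarrow> bool" where
  "agree D L \<sigma> \<sigma>' \<longleftrightarrow> (\<forall>l\<in>L. cluster \<sigma> l \<subseteq> D \<and> cluster \<sigma>' l \<subseteq> D) \<and>
     (\<forall>u\<in>D. fst \<sigma> u = fst \<sigma>' u \<and> fst \<sigma> u \<in> insert None (Some ` L) \<and> snd \<sigma> `` {u} = snd \<sigma>' `` {u})"

lemma agree_sym: "agree D L \<sigma> \<sigma>' \<Longrightarrow> agree D L \<sigma>' \<sigma>"
  unfolding agree_def by (metis (no_types, lifting))

lemma agree_cluster: "agree D L \<sigma> \<sigma>' \<Longrightarrow> l \<in> L \<Longrightarrow> cluster \<sigma> l = cluster \<sigma>' l"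
  unfolding agree_def cluster_def by fastforce

text \<open>On \<open>D\<close> the leaders lie in \<open>L\<close>, so clusters led from outside
  \<open>L\<close> do not meet \<open>D\<close>, and their reactions change neither leaders nor
  partners there.\<close>

lemma agree_react_outside:
  assumes "agree D L \<sigma> \<sigma>'" "l \<notin> L" "m \<notin> L"
  shows "agree D L (react e l m \<sigma>) \<sigma>'"
proof -
  have D: "u \<notin> cluster \<sigma> l" "u \<notin> cluster \<sigma> m" if "u \<in> D" for u
    using assms that by (auto simp: agree_def cluster_def)
  have 1: "fst (react e l m \<sigma>) u = fst \<sigma> u" "snd (react e l m \<sigma>) `` {u} = snd \<sigma> `` {u}" if "u \<in> D" for u
    using D[OF that] by (auto simp: react_def cluster_def)
  have 2: "cluster (react e l m \<sigma>) k \<subseteq> cluster \<sigma> k" if "k \<in> L" for k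
    using that assms by (auto simp: react_def cluster_def split: if_splits)
  have "cluster (react e l m \<sigma>) k \<subseteq> D" if "k \<in> L" for k
    using assms(1) 2[OF that] that unfolding agree_def by blast
  moreover have "fst (react e l m \<sigma>) u = fst \<sigma>' u" "fst (react e l m \<sigma>) u \<in> insert None (Some ` L)"
    "snd (react e l m \<sigma>) `` {u} = snd \<sigma>' `` {u}" if "u \<in> D" for u
    using assms(1) 1[OF that] that unfolding agree_def by metis+
  ultimately show ?thesis using assms(1) unfolding agree_def by blast
qed

lemma agree_react_inside:
  assumes a: "agree D L \<sigma> \<sigma>'" and "l \<in> L" "m \<in> L"
  shows "agree D L (react e l m \<sigma>) (react e l m \<sigma>')"
proof -
  have cl: "cluster \<sigma>' l = cluster \<sigma> l" "cluster \<sigma>' m = cluster \<sigma> m"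
    using agree_cluster[OF a] assms(2,3) by auto
  have eq: "fst \<sigma>' u = fst \<sigma> u" "snd \<sigma>' `` {u} = snd \<sigma> `` {u}" if "u \<in> D" for u
    using a that by (auto simp: agree_def)
  have rg: "fst \<sigma> u \<in> insert None (Some ` L)" if "u \<in> D" for u
    using a that unfolding agree_def by blast
  have sub: "cluster (react e l m \<tau>) k \<subseteq> cluster \<tau> k \<union> cluster \<tau> m" for \<tau> k
    by (auto simp: react_def cluster_def split: if_splits)
  have "cluster (react e l m \<sigma>) k \<subseteq> D" "cluster (react e l m \<sigma>') k \<subseteq> D" if "k \<in> L" for k
    using a that assms(3) sub[of \<sigma> k] sub[of \<sigma>' k] unfolding agree_def by blast+
  moreover have "fst (react e l m \<sigma>) u = fst (react e l m \<sigma>') u" if "u \<in> D" for u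
    using eq[OF that] cl by (auto simp: react_def)
  moreover have "fst (react e l m \<sigma>) u \<in> insert None (Some ` L)" if "u \<in> D" for u
    using rg[OF that] assms(2) by (auto simp: react_def)
  moreover have "snd (react e l m \<sigma>) `` {u} = snd (react e l m \<sigma>') `` {u}" if "u \<in> D" for u
    using eq(2)[OF that] cl by (auto simp: react_def)
  ultimately show ?thesis unfolding agree_def by blast
qed

text \<open>The two systems may interleave their reactions outside \<open>L\<close> differently, so
  they cannot be run in lockstep. A first reaction outside \<open>L\<close> in either system is
  carried out alone; if both first reactions are inside, they involve the same pair. The total
  number of leaders decreases in each case.\<close>

lemma agree_resolve:
  assumes "finite (ran (fst \<sigma>))" "finite (ran (fst \<sigma>'))" "agree D L \<sigma> \<sigma>'"
    and inj: "inj (\<lambda>v. bravery (e v))"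
    and closed: "\<And>l m. l \<in> L \<Longrightarrow> pos l = pos m \<Longrightarrow> m \<in> L"
  shows "agree D L (resolve cap e pos \<sigma>) (resolve cap e pos \<sigma>')"
  using assms(1-3)
proof (induction "card (ran (fst \<sigma>)) + card (ran (fst \<sigma>'))" arbitrary: \<sigma> \<sigma>' rule: less_induct)
  case (less \<sigma> \<sigma>')
  note IH = less.hyps
  have can_iff: "can_react cap e pos \<tau>' l m" if "agree D L \<tau> \<tau>'" "l \<in> L" "can_react cap e pos \<tau> l m" for \<tau> \<tau>' l m
    using that agree_cluster[OF that(1)] closed[of l m] by (auto simp: can_react_def)
  have unf: "resolve cap e pos \<tau> = resolve cap e pos (react e l m \<tau>)" "can_react cap e pos \<tau> l m"
    if "is_first cap e pos \<tau> l m" "first_reaction cap e pos \<tau> = react e l m \<tau>" for \<tau> l m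
    using that by (subst resolve_unfold, auto simp: is_first_def)
  have outl: "m \<notin> L" if "l \<notin> L" "can_react cap e pos \<tau> l m" for \<tau> l m
    using closed[of m l] that by (auto dest: can_reactD(4))
  have inl: "m \<in> L" if "l \<in> L" "can_react cap e pos \<tau> l m" for \<tau> l m
    using closed[of l m] that by (auto dest: can_reactD(4))
  consider (none) "\<nexists>l m. can_react cap e pos \<sigma> l m" "\<nexists>l m. can_react cap e pos \<sigma>' l m"
    | (one) l m where "is_first cap e pos \<sigma> l m" "first_reaction cap e pos \<sigma> = react e l m \<sigma>" "l \<notin> L"
    | (two) l m where "is_first cap e pos \<sigma>' l m" "first_reaction cap e pos \<sigma>' = react e l m \<sigma>'" "l \<notin> L"
    | (both) l m l' m' where "is_first cap e pos \<sigma> l m" "first_reaction cap e pos \<sigma> = react e l m \<sigma>" "l \<in> L"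
       "is_first cap e pos \<sigma>' l' m'" "first_reaction cap e pos \<sigma>' = react e l' m' \<sigma>'" "l' \<in> L"
  proof (cases "\<exists>l m. can_react cap e pos \<sigma> l m")
    case True
    obtain l m where lm: "is_first cap e pos \<sigma> l m" "first_reaction cap e pos \<sigma> = react e l m \<sigma>"
      using first_reactionE[OF less.prems(1) True] .
    show ?thesis
    proof (cases "l \<in> L")
      case True
      hence "\<exists>l m. can_react cap e pos \<sigma>' l m" 
        using can_iff[OF less.prems(3) True, of m] lm by (auto simp: is_first_def)
      from first_reactionE[OF less.prems(2) this] obtain l' m' where 
        "is_first cap e pos \<sigma>' l' m'" "first_reaction cap e pos \<sigma>' = react e l' m' \<sigma>'" .
      thus ?thesis using lm True both two by blast
    qed (use lm one in blast)
  next
    case False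
    show ?thesis
    proof (cases "\<exists>l m. can_react cap e pos \<sigma>' l m")
      case True
      from first_reactionE[OF less.prems(2) this] obtain l' m' where 
        lm: "is_first cap e pos \<sigma>' l' m'" "first_reaction cap e pos \<sigma>' = react e l' m' \<sigma>'" .
      have "l' \<notin> L"
        using can_iff[OF agree_sym[OF less.prems(3)], of l' m'] False lm by (auto simp: is_first_def)
      thus ?thesis using lm two by blast
    qed (use False none in blast)
  qed
  thus ?case
  proof cases
    case none
    thus ?thesis using less.prems by (simp add: resolve_idle)
  next
    case one
    note u = unf[OF one(1,2)]
    note c = card_ran_react[OF u(2) less.prems(1)]
    show ?thesis unfolding u(1)
      by (rule IH) (use c less.prems agree_react_outside[OF less.prems(3) one(3) outl[OF one(3) u(2)]] in auto)
  next
    case two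
    note u = unf[OF two(1,2)]
    note c = card_ran_react[OF u(2) less.prems(2)]
    show ?thesis unfolding u(1)
      by (rule IH) (use c less.prems 
        agree_sym[OF agree_react_outside[OF agree_sym[OF less.prems(3)] two(3) outl[OF two(3) u(2)]]] in auto)
  next
    case both
    note u = unf[OF both(1,2)]
    note u' = unf[OF both(4,5)]
    note c = card_ran_react[OF u(2) less.prems(1)]
    note c' = card_ran_react[OF u'(2) less.prems(2)]
    note ag = less.prems(3)
    \<comment> \<open>Each pair is able to react in both systems, so each of \<open>l\<close> and
      \<open>l'\<close> is at least as brave as the other.\<close>
    have "l' = l" 
    proof -
      have "can_react cap e pos \<sigma>' l m" using can_iff[OF ag both(3) u(2)] .
      moreover have "can_react cap e pos \<sigma> l' m'" using can_iff[OF agree_sym[OF ag] both(6) u'(2)] .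
      ultimately have "bravery (e l) = bravery (e l')" 
        using both(1,4) unfolding is_first_def by (meson order_antisym)
      thus ?thesis using inj by (auto dest: injD)
    qed
    have "m' = m"
    proof -
      have "can_react cap e pos \<sigma>' l m" using can_iff[OF ag both(3) u(2)] .
      moreover have "can_react cap e pos \<sigma> l m'" using can_iff[OF agree_sym[OF ag] both(6) u'(2)] \<open>l' = l\<close> by simp
      ultimately have "bravery (e m) = bravery (e m')" 
        using both(1,4) \<open>l' = l\<close> unfolding is_first_def by (meson order_antisym)
      thus ?thesis using inj by (auto dest: injD)
    qed
    have "agree D L (react e l m \<sigma>) (react e l m \<sigma>')"
      using agree_react_inside[OF ag both(3) inl[OF both(3) u(2)]] .
    thus ?thesis unfolding u(1) u'(1) \<open>l' = l\<close> \<open>m' = m\<close>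
      using c c' \<open>l' = l\<close> \<open>m' = m\<close> by (intro IH) auto
  qed
qed

section \<open>Time evolution of finite systems\<close>

abbreviation present :: "'v set \<Rightarrow> 'v state" where
  "present F \<equiv> (\<lambda>v. if v \<in> F then Some v else None, {})"

lemma sorted_list_of_set_Un:
  fixes A B :: "'a :: linorder set"
  assumes "finite A" "finite B" "\<And>a b. a \<in> A \<Longrightarrow> b \<in> B \<Longrightarrow> a < b"
  shows "sorted_list_of_set (A \<union> B) = sorted_list_of_set A @ sorted_list_of_set B"
proof -
  let ?L = "sorted_list_of_set A @ sorted_list_of_set B"
  have "sorted ?L" "distinct ?L" 
    using assms by (fastforce simp: sorted_append less_imp_le)+
  moreover have "set ?L = A \<union> B" using assms by simp
  ultimately show ?thesis using assms
    by (metis sorted_list_of_set.idem_if_sorted_distinct)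
qed

lemma jump_times_mono: "s \<le> t \<Longrightarrow> jump_times rate e F s \<subseteq> jump_times rate e F t"
  by (auto simp: jump_times_def)

lemma jump_times_restrict: "s \<le> t \<Longrightarrow> jump_times rate e F s = {r \<in> jump_times rate e F t. r \<le> s}"
  by (auto simp: jump_times_def)

text \<open>The flow property: the evolution up to \<open>b\<close> continues the one up to
  \<open>a\<close> over the jump times after \<open>a\<close>.\<close>

lemma finite_system_split:
  assumes "a \<le> b" "finite (jump_times rate e F b)"
  shows "finite_system rate cap e F b =
    fold (\<lambda>s. resolve cap e (\<lambda>v. position rate e v s))
      (sorted_list_of_set {s \<in> jump_times rate e F b. a < s}) (finite_system rate cap e F a)"
proof -
  have fa: "finite (jump_times rate e F a)"
    by (rule finite_subset[OF jump_times_mono assms(2)]) (use assms in simp)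
  have eq: "jump_times rate e F b = jump_times rate e F a \<union> {s \<in> jump_times rate e F b. a < s}"
    by (auto simp: jump_times_restrict[OF assms(1), of rate e F])
  have lt: "x < y" if "x \<in> jump_times rate e F a" "y \<in> {s \<in> jump_times rate e F b. a < s}" for x y
    using that by (auto simp: jump_times_def)
  have "sorted_list_of_set (jump_times rate e F a \<union> {s \<in> jump_times rate e F b. a < s}) =
     sorted_list_of_set (jump_times rate e F a) @ sorted_list_of_set {s \<in> jump_times rate e F b. a < s}"
    by (rule sorted_list_of_set_Un[OF fa _ lt]) (use assms(2) in auto)
  hence "sorted_list_of_set (jump_times rate e F b) =
     sorted_list_of_set (jump_times rate e F a) @ sorted_list_of_set {s \<in> jump_times rate e F b. a < s}"
    by (simp only: eq[symmetric])
  thus ?thesis using fa assms(2) by (simp add: finite_system_def)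
qed

lemma finite_system_eq:
  assumes "a \<le> b" "finite (jump_times rate e F b)" "\<And>s. s \<in> jump_times rate e F b \<Longrightarrow> s \<le> a"
  shows "finite_system rate cap e F b = finite_system rate cap e F a"
proof -
  have "{s \<in> jump_times rate e F b. a < s} = {}" using assms(3) by force
  thus ?thesis using finite_system_split[OF assms(1,2), of cap]
    by (simp only: sorted_list_of_set_empty) simp
qed

lemma fold_resolve_rule:
  assumes "finite (ran (fst \<sigma>))" "Q \<sigma>"
    and step: "\<And>s \<sigma> l m. Q \<sigma> \<Longrightarrow> can_react cap e (pos s) \<sigma> l m \<Longrightarrow> Q (react e l m \<sigma>)"
  shows "Q (fold (\<lambda>s. resolve cap e (pos s)) ss \<sigma>) \<and>
         finite (ran (fst (fold (\<lambda>s. resolve cap e (pos s)) ss \<sigma>)))"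
  using assms(1,2)
proof (induction ss arbitrary: \<sigma>)
  case (Cons s ss)
  have "Q (resolve cap e (pos s) \<sigma>) \<and> finite (ran (fst (resolve cap e (pos s) \<sigma>)))"
    using resolve_rule[of \<sigma> Q cap e "pos s"] Cons.prems step by blast
  thus ?case using Cons.IH by simp
qed simp

lemma finite_system_rule_from:
  assumes "finite F" "a \<le> b" "finite (jump_times rate e F b)" "Q (finite_system rate cap e F a)"
    and step: "\<And>s \<sigma> l m. Q \<sigma> \<Longrightarrow> can_react cap e (\<lambda>v. position rate e v s) \<sigma> l m \<Longrightarrow> Q (react e l m \<sigma>)"
  shows "Q (finite_system rate cap e F b)"
proof -
  have fa: "finite (jump_times rate e F a)"
    by (rule finite_subset[OF jump_times_mono assms(3)]) (use assms in simp)
  have "finite (ran (fst (present F)))"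
    by (rule finite_subset[OF _ assms(1)]) (auto simp: ran_def split: if_splits)
  hence "finite (ran (fst (finite_system rate cap e F a)))"
    using fa fold_resolve_rule[of "present F" "\<lambda>_. True" cap e "\<lambda>s v. position rate e v s"]
    by (simp add: finite_system_def)
  thus ?thesis
    unfolding finite_system_split[OF assms(2,3), of cap]
    using fold_resolve_rule[of _ Q cap e "\<lambda>s v. position rate e v s"] assms(4) step by blast
qed

lemma finite_system_rule:
  assumes "finite F" "finite (jump_times rate e F t)" "Q (present F)"
    and step: "\<And>s \<sigma> l m. Q \<sigma> \<Longrightarrow> can_react cap e (\<lambda>v. position rate e v s) \<sigma> l m \<Longrightarrow> Q (react e l m \<sigma>)"
  shows "Q (finite_system rate cap e F t)"
proof -
  have "finite (ran (fst (present F)))"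
    by (rule finite_subset[OF _ assms(1)]) (auto simp: ran_def split: if_splits)
  thus ?thesis
    using fold_resolve_rule[of _ Q cap e "\<lambda>s v. position rate e v s"] assms
    by (simp add: finite_system_def)
qed

lemma supported_finite_system:
  assumes "finite F" "finite (jump_times rate e F t)"
  shows "supported F (finite_system rate cap e F t)"
  using assms by (rule finite_system_rule) (auto simp: supported_def[of F "present F"] intro: supported_react)

text \<open>This holds in every environment: if the clocks ring infinitely often before
  \<open>t\<close>, the default state has nobody present. Hence \<open>destroyed\<close> is monotone
  in time without an exceptional null set.\<close>

lemma finite_system_dead_mono:
  assumes "finite F" "s \<le> t" "fst (finite_system rate cap e F s) v = None"
  shows "fst (finite_system rate cap e F t) v = None"
proof (cases "finite (jump_times rate e F t)")
  case True
  show ?thesis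
    using assms(1,2) True assms(3)
    by (rule finite_system_rule_from[where Q = "\<lambda>\<sigma>. fst \<sigma> v = None"]) (auto simp: react_def)
qed (simp add: finite_system_def)

text \<open>A particle that is not present belongs to no cluster, so no later reaction can record a
  new pair for it.\<close>

lemma finite_system_dead_pairs:
  assumes "finite F" "s \<le> t" "finite (jump_times rate e F t)" 
    "fst (finite_system rate cap e F s) v = None" "snd (finite_system rate cap e F s) `` {v} = R"
  shows "fst (finite_system rate cap e F t) v = None \<and> snd (finite_system rate cap e F t) `` {v} = R"
proof -
  let ?Q = "\<lambda>\<sigma>. fst \<sigma> v = None \<and> snd \<sigma> `` {v} = R"
  have "?Q (react e l m \<sigma>)" if "?Q \<sigma>" for l m \<sigma>
  proof -
    have "v \<notin> cluster \<sigma> l" "v \<notin> cluster \<sigma> m" using that by (auto simp: cluster_def)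
    hence "snd (react e l m \<sigma>) `` {v} = snd \<sigma> `` {v}" by (auto simp: react_def)
    thus ?thesis using that by (simp add: react_def)
  qed
  thus ?thesis using finite_system_rule_from[OF assms(1,2,3), of ?Q] assms(4,5) by blast
qed

lemma finite_system_species:
  assumes "finite F" "finite (jump_times rate e F t)" "fst (finite_system rate cap e F t) v = Some l"
  shows "spec (e v) = spec (e l)"
proof -
  have "\<forall>v l. fst (finite_system rate cap e F t) v = Some l \<longrightarrow> spec (e v) = spec (e l)"
    using assms(1,2) by (rule finite_system_rule) (auto simp: react_def split: if_splits)
  thus ?thesis using assms(3) by blast
qed

text \<open>A particle leaves only in a reaction of two nonempty clusters of different species, and
  is then paired with all members of the other one. The invariant also carries that each cluster has
  a single species, which passes the difference from the leaders to the paired particles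
  themselves.\<close>

lemma finite_system_partner:
  assumes "finite F" "finite (jump_times rate e F t)" 
  shows "\<forall>v\<in>F. fst (finite_system rate cap e F t) v = None \<longrightarrow> 
     (\<exists>w. (v, w) \<in> snd (finite_system rate cap e F t) \<and> spec (e w) \<noteq> spec (e v))"
proof -
  let ?Q = "\<lambda>\<sigma>. (\<forall>v l. fst \<sigma> v = Some l \<longrightarrow> spec (e v) = spec (e l)) \<and>
     (\<forall>v\<in>F. fst \<sigma> v = None \<longrightarrow> (\<exists>w. (v, w) \<in> snd \<sigma> \<and> spec (e w) \<noteq> spec (e v)))"
  have "?Q (finite_system rate cap e F t)"
    using assms
  proof (rule finite_system_rule)
    fix s \<sigma> l m assume Q: "?Q \<sigma>" and c: "can_react cap e (\<lambda>v. position rate e v s) \<sigma> l m"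
    obtain a b where ab: "fst \<sigma> a = Some l" "fst \<sigma> b = Some m"
      using can_reactD(2,3)[OF c] by (auto simp: ran_def)
    have "\<exists>w. (v, w) \<in> snd (react e l m \<sigma>) \<and> spec (e w) \<noteq> spec (e v)"
      if v: "v \<in> F" "fst (react e l m \<sigma>) v = None" for v
    proof (cases "fst \<sigma> v")
      case None
      then obtain w where "(v, w) \<in> snd \<sigma>" "spec (e w) \<noteq> spec (e v)" using Q v by blast
      thus ?thesis by (auto simp: react_def)
    next
      case (Some k)
      hence *: "spec (e l) \<noteq> spec (e m)" "k = l \<or> k = m"
        using v(2) by (auto simp: react_def cluster_def split: if_splits)
      have sp: "spec (e a) = spec (e l)" "spec (e b) = spec (e m)" "spec (e v) = spec (e k)"
        using Q ab Some by auto
      show ?thesis using * ab sp Some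
        by (cases "k = l") (force simp: react_def cluster_def)+
    qed
    moreover have "\<forall>v k. fst (react e l m \<sigma>) v = Some k \<longrightarrow> spec (e v) = spec (e k)"
      using Q by (auto simp: react_def split: if_splits)
    ultimately show "?Q (react e l m \<sigma>)" by blast
  qed auto
  thus ?thesis by blast
qed

text \<open>Two clusters merge only if both sizes are at most \<open>M\<close>; this is the origin
  of the factor 2 in the final bound. Finite domains are part of the invariant because
  \<open>card_mono\<close> needs finite clusters.\<close>

lemma finite_system_cluster_bound:
  assumes F: "finite F" "finite (jump_times rate e F t)" and "cap TypeA = enat M" "1 \<le> M" "spec (e l) = TypeA"
  shows "card (cluster (finite_system rate cap e F t) l) \<le> 2 * M"
proof -
  let ?Q = "\<lambda>\<sigma>. finite (dom (fst \<sigma>)) \<and> (\<forall>l. spec (e l) = TypeA \<longrightarrow> card (cluster \<sigma> l) \<le> 2 * M)"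
  have "?Q (finite_system rate cap e F t)"
    using F
  proof (rule finite_system_rule)
    have "cluster (present F) l \<subseteq> {l}" for l by (auto simp: cluster_def split: if_splits)
    hence "card (cluster (present F) l) \<le> 1" for l
      using card_mono[of "{l}" "cluster (present F) l"] by simp
    moreover have "dom (fst (present F)) = F" by (auto split: if_splits)
    moreover have "1 \<le> 2 * M" using assms(4) by simp
    ultimately show "?Q (present F)" using F(1) order_trans by (metis (lifting))
  next
    fix s \<sigma> l m assume Q: "?Q \<sigma>" and c: "can_react cap e (\<lambda>v. position rate e v s) \<sigma> l m"
    have dom: "dom (fst (react e l m \<sigma>)) \<subseteq> dom (fst \<sigma>)" by (auto simp: react_def split: if_splits)
    have fc: "finite (cluster \<sigma> k)" for k 
      using Q by (auto simp: cluster_def dom_def intro: finite_subset[rotated])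
    have "card (cluster (react e l m \<sigma>) k) \<le> 2 * M" if k: "spec (e k) = TypeA" for k
    proof (cases "spec (e l) = spec (e m) \<and> k = l")
      case True
      have "cluster (react e l m \<sigma>) k \<subseteq> cluster \<sigma> l \<union> cluster \<sigma> m"
        using True by (auto simp: react_def cluster_def split: if_splits)
      hence "card (cluster (react e l m \<sigma>) k) \<le> card (cluster \<sigma> l \<union> cluster \<sigma> m)"
        using fc by (intro card_mono) auto
      also have "\<dots> \<le> card (cluster \<sigma> l) + card (cluster \<sigma> m)" by (rule card_Un_le)
      also have "\<dots> \<le> M + M"
        using c True k assms(3) by (intro add_mono) (auto simp: can_react_def)
      finally show ?thesis by simp
    next
      case False
      have "cluster (react e l m \<sigma>) k \<subseteq> cluster \<sigma> k"
        using False by (auto simp: react_def cluster_def split: if_splits)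
      hence "card (cluster (react e l m \<sigma>) k) \<le> card (cluster \<sigma> k)"
        using fc by (intro card_mono) auto
      thus ?thesis using Q k by (meson order_trans)
    qed
    thus "?Q (react e l m \<sigma>)" using Q dom by (auto intro: finite_subset)
  qed
  thus ?thesis using assms(5) by blast
qed

section \<open>Regular environments\<close>

text \<open>Collects the properties that \<open>AE_regular\<close> shows to hold almost surely, so
  that the dynamics can be studied in a single fixed environment. Distinct braveries make the choice
  in \<open>first_reaction\<close> unique, and finitely many rings below each level exclude the
  default state of \<open>finite_system\<close>.\<close>

definition regular :: "('v \<Rightarrow> 'v particle) \<Rightarrow> bool" where
  "regular e \<longleftrightarrow> inj (\<lambda>v. bravery (e v)) \<and>
     (\<forall>v. walk (e v) 0 = v \<and> (\<forall>n. 0 < wait (e v) n) \<and> (\<forall>c. finite {n. ring (e v) n \<le> c}))"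

definition jumps :: "(species \<Rightarrow> real) \<Rightarrow> 'v particle \<Rightarrow> real \<Rightarrow> nat" where
  "jumps rate q t = card {n. ring q n \<le> rate (spec q) * t}"

lemma position_jumps: "position rate e v t = walk (e v) (jumps rate (e v) t)"
  by (simp add: position_def jumps_def)

lemma ring_pos: "(\<And>n. 0 < wait q n) \<Longrightarrow> 0 < ring q n"
  by (auto simp: ring_def intro!: sum_pos)

locale regular_env =
  fixes rate :: "species \<Rightarrow> real" and cap :: "species \<Rightarrow> enat" and e :: "'v \<Rightarrow> 'v particle"
  assumes rate_nonneg: "\<And>s. 0 \<le> rate s"
    and reg: "regular e"
begin

abbreviation "sys \<equiv> finite_system rate cap e"
abbreviation "pos t \<equiv> (\<lambda>v. position rate e v t)"
abbreviation "jtimes \<equiv> jump_times rate e"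

lemma rpos: "0 < ring (e v) n"
  using reg by (intro ring_pos) (auto simp: regular_def)

lemma jumps_mono: "s \<le> t \<Longrightarrow> jumps rate (e v) s \<le> jumps rate (e v) t"
proof -
  assume "s \<le> t"
  hence "rate (spec (e v)) * s \<le> rate (spec (e v)) * t" using rate_nonneg by (rule mult_left_mono)
  thus ?thesis unfolding jumps_def using reg by (intro card_mono) (auto simp: regular_def)
qed

lemma finite_jtimes: assumes "finite F" shows "finite (jtimes F t)"
proof -
  have "jtimes F t \<subseteq> (\<Union>v\<in>F. (\<lambda>n. ring (e v) n / rate (spec (e v))) ` {n. ring (e v) n \<le> rate (spec (e v)) * t})"
  proof
    fix s assume "s \<in> jtimes F t"
    then obtain v n where v: "0 \<le> s" "s \<le> t" "v \<in> F" "ring (e v) n = rate (spec (e v)) * s"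
      by (auto simp: jump_times_def)
    have "rate (spec (e v)) \<noteq> 0" using v rpos[of v n] by auto
    moreover have "ring (e v) n \<le> rate (spec (e v)) * t"
      using v rate_nonneg[of "spec (e v)"] by (simp add: mult_left_mono)
    ultimately show "s \<in> (\<Union>v\<in>F. (\<lambda>n. ring (e v) n / rate (spec (e v))) ` {n. ring (e v) n \<le> rate (spec (e v)) * t})"
      using v by (auto intro!: bexI[of _ v] image_eqI[of _ _ n])
  qed
  moreover have "finite \<dots>" using assms reg by (auto simp: regular_def)
  ultimately show ?thesis by (rule finite_subset)
qed

lemma ring_jtimes:
  assumes "v \<in> F" "ring (e v) n \<le> rate (spec (e v)) * t"
  shows "ring (e v) n / rate (spec (e v)) \<in> jtimes F t" "0 < rate (spec (e v))"
proof -
  have "0 < rate (spec (e v)) * t" using assms(2) rpos[of v n] by linarith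
  thus r: "0 < rate (spec (e v))"
    using rate_nonneg[of "spec (e v)"] by (metis less_eq_real_def mult_zero_left)
  show "ring (e v) n / rate (spec (e v)) \<in> jtimes F t"
    unfolding jump_times_def using r assms rpos[of v n] 
    by (auto simp: field_simps intro!: bexI[of _ v] exI[of _ n])
qed

lemma jumps_eq:
  assumes "v \<in> F" "r \<le> t" "\<And>s. s \<in> jtimes F t \<Longrightarrow> s \<le> r"
  shows "jumps rate (e v) t = jumps rate (e v) r"
proof -
  have "ring (e v) n \<le> rate (spec (e v)) * t \<longleftrightarrow> ring (e v) n \<le> rate (spec (e v)) * r" for n
  proof
    assume *: "ring (e v) n \<le> rate (spec (e v)) * t"
    show "ring (e v) n \<le> rate (spec (e v)) * r"
      using assms(3)[OF ring_jtimes(1)[OF assms(1) *]] ring_jtimes(2)[OF assms(1) *]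
      by (simp add: field_simps)
  next
    assume "ring (e v) n \<le> rate (spec (e v)) * r"
    thus "ring (e v) n \<le> rate (spec (e v)) * t"
      using mult_left_mono[OF assms(2) rate_nonneg[of "spec (e v)"]] by linarith
  qed
  thus ?thesis by (simp add: jumps_def)
qed

lemma supported_sys: "finite F \<Longrightarrow> supported F (sys F t)"
  by (intro supported_finite_system finite_jtimes)

lemma finite_ran_sys: "finite F \<Longrightarrow> finite (ran (fst (sys F t)))"
  by (rule finite_subset[OF supported_ran[OF supported_sys]])

text \<open>The last jump time up to \<open>s\<close> left a resolved state and nobody in
  \<open>F\<close> has moved since; without any jump, the particles still sit at their distinct
  initial sites. It follows that inserting \<open>resolve\<close> at a time when nobody in
  \<open>F\<close> jumps changes nothing.\<close>

lemma sys_resolved: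
  assumes F: "finite F"
  shows "\<not> can_react cap e (pos s) (sys F s) l m"
proof
  assume c: "can_react cap e (pos s) (sys F s) l m"
  have lm: "l \<in> F" "m \<in> F" using can_reactD[OF c] supported_ran[OF supported_sys[OF F]] by auto
  show False
  proof (cases "jtimes F s = {}")
    case True
    have "pos s v = v" if v: "v \<in> F" for v
    proof -
      have "\<not> ring (e v) n \<le> rate (spec (e v)) * s" for n
        using ring_jtimes(1)[OF v, of n s] True by blast
      hence "jumps rate (e v) s = 0" by (simp add: jumps_def)
      thus ?thesis using reg by (simp add: position_jumps regular_def)
    qed
    thus False using can_reactD[OF c] lm by simp
  next
    case False
    define r where "r = Max (jtimes F s)"
    note fin = finite_jtimes[OF F]
    have r: "r \<in> jtimes F s" "\<And>q. q \<in> jtimes F s \<Longrightarrow> q \<le> r"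
      unfolding r_def using fin[of s] False by (auto intro: Max_in)
    have rs: "r \<le> s" using r by (auto simp: jump_times_def)
    have split: "jtimes F s = (jtimes F s - {r}) \<union> {r}" using r by auto
    have "sorted_list_of_set (jtimes F s) = sorted_list_of_set (jtimes F s - {r}) @ [r]"
    proof -
      have "sorted_list_of_set ((jtimes F s - {r}) \<union> {r}) = sorted_list_of_set (jtimes F s - {r}) @ sorted_list_of_set {r}"
        using fin[of s] r by (intro sorted_list_of_set_Un) (auto simp: order_less_le)
      thus ?thesis using split by simp
    qed
    hence eq: "sys F s = resolve cap e (pos r)
        (fold (\<lambda>s. resolve cap e (pos s)) (sorted_list_of_set (jtimes F s - {r})) (present F))"
      using fin by (simp add: finite_system_def)
    have "finite (ran (fst (present F)))"
      by (rule finite_subset[OF _ F]) (auto simp: ran_def split: if_splits)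
    hence "finite (ran (fst (fold (\<lambda>s. resolve cap e (pos s)) (sorted_list_of_set (jtimes F s - {r})) (present F))))"
      using fold_resolve_rule[of "present F" "\<lambda>_. True" cap e pos] by simp
    hence "\<not> can_react cap e (pos r) (sys F s) l m"
      unfolding eq using resolve_rule[where Q = "\<lambda>_. True"] by blast
    moreover have "pos r v = pos s v" if "v \<in> F" for v
      using jumps_eq[OF that rs r(2)] by (simp add: position_jumps)
    ultimately show False using c lm by (simp add: can_react_def)
  qed
qed

text \<open>The time \<open>b\<close> need not be a jump time of \<open>F\<close>. This lets systems
  with different particle sets advance along one common grid of times.\<close>

lemma sys_step:
  assumes F: "finite F" and "a < b" "\<And>s. s \<in> jtimes F b \<Longrightarrow> a < s \<Longrightarrow> s = b"
  shows "sys F b = resolve cap e (pos b) (sys F a)"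
proof (cases "b \<in> jtimes F b")
  case True
  hence "{s \<in> jtimes F b. a < s} = {b}" using assms by auto
  thus ?thesis using finite_system_split[of a b rate e F cap] finite_jtimes[OF F] assms by simp
next
  case False
  have "sys F b = sys F a"
    using assms False finite_jtimes[OF F] by (intro finite_system_eq) force+
  moreover have "resolve cap e (pos b) (sys F b) = sys F b"
    using sys_resolved[OF F] by (intro resolve_idle)
  ultimately show ?thesis by simp
qed

text \<open>Both systems advance along the jump times of \<open>F \<union> F'\<close>, by induction
  on the number of these after \<open>a\<close>. At each of them \<open>agree_resolve\<close>
  applies because \<open>L\<close> is closed under meeting.\<close>

lemma sys_agree:
  assumes F: "finite F" "finite F'" and "a \<le> b" and "agree D L (sys F a) (sys F' a)"
    and closed: "\<And>l m s. a < s \<Longrightarrow> s \<le> b \<Longrightarrow> l \<in> L \<Longrightarrow> pos s l = pos s m \<Longrightarrow> m \<in> L"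
  shows "agree D L (sys F b) (sys F' b)"
proof -
  define J where "J s = {r \<in> jtimes (F \<union> F') s. a < r}" for s
  have fJ: "finite (J s)" for s unfolding J_def using finite_jtimes[of "F \<union> F'"] F by simp
  have sub: "jtimes F s \<subseteq> jtimes (F \<union> F') s" "jtimes F' s \<subseteq> jtimes (F \<union> F') s" for s
    by (auto simp: jump_times_def)
  have "agree D L (sys F s) (sys F' s)" if "a \<le> s" "s \<le> b" for s
    using that
  proof (induction "card (J s)" arbitrary: s rule: less_induct)
    case (less s)
    show ?case
    proof (cases "J s = {}")
      case True
      have "sys F s = sys F a" "sys F' s = sys F' a"
        using True less.prems finite_jtimes F sub[of s] by (auto intro!: finite_system_eq simp: J_def not_less[symmetric])
      thus ?thesis using assms(4) by simp
    next
      case False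
      define r where "r = Max (J s)"
      have r: "r \<in> J s" "\<And>q. q \<in> J s \<Longrightarrow> q \<le> r"
        unfolding r_def using fJ False by (auto intro: Max_in)
      have ar: "a < r" "r \<le> s" using r by (auto simp: J_def jump_times_def)
      \<comment> \<open>\<open>q = Max Q\<close> is the grid time preceding the last one
        \<open>r\<close>, or \<open>a\<close> if there is none.\<close>
      define Q where "Q = insert a (J s - {r})"
      define q where "q = Max Q"
      have fQ: "finite Q" "Q \<noteq> {}" using fJ by (auto simp: Q_def)
      have q: "q \<in> Q" "\<And>x. x \<in> Q \<Longrightarrow> x \<le> q"
        unfolding q_def using fQ by (auto intro: Max_in)
      have qr: "a \<le> q" "q < r"
      proof -
        show "a \<le> q" using q(2) by (simp add: Q_def)
        show "q < r" using q(1) r ar by (auto simp: Q_def order_less_le)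
      qed
      have Jq: "J q \<subseteq> J s - {r}"
        using qr ar by (auto simp: J_def jump_times_def)
      hence "card (J q) < card (J s)" using r(1) fJ by (metis psubset_card_mono Diff_subset subset_trans psubsetI DiffD2 insertI1 subsetD)
      hence IH: "agree D L (sys F q) (sys F' q)"
        using less.hyps[of q] qr ar less.prems by simp
      have J': "x = r" if "x \<in> jtimes (F \<union> F') s" "q < x" for x
      proof (rule ccontr)
        assume "x \<noteq> r"
        hence "x \<in> Q" using that qr by (auto simp: Q_def J_def)
        thus False using q(2) that(2) by force
      qed
      have m: "jtimes (F \<union> F') r \<subseteq> jtimes (F \<union> F') s" using ar by (intro jump_times_mono)
      have "sys F r = resolve cap e (pos r) (sys F q)" "sys F' r = resolve cap e (pos r) (sys F' q)"
        using F qr J' m sub[of r] by (auto intro!: sys_step)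
      moreover have "agree D L (resolve cap e (pos r) (sys F q)) (resolve cap e (pos r) (sys F' q))"
      proof (rule agree_resolve)
        show "inj (\<lambda>v. bravery (e v))" using reg by (simp add: regular_def)
        show "m \<in> L" if "l \<in> L" "pos r l = pos r m" for l m
          using closed[of r l m] that ar less.prems by simp
      qed (use F IH finite_ran_sys in auto)
      moreover have "sys F s = sys F r" "sys F' s = sys F' r"
      proof -
        have "x \<le> r" if "x \<in> jtimes (F \<union> F') s" for x
          using J'[OF that] qr by (cases "q < x") auto
        thus "sys F s = sys F r" "sys F' s = sys F' r"
          using ar sub[of s] finite_jtimes F by (auto intro!: finite_system_eq)
      qed
      ultimately show ?thesis by simp
    qed
  qed
  thus ?thesis using assms(3) by simp
qed

section \<open>Eventual constancy of the finite systems over a time interval\<close>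

definition touch :: "real \<Rightarrow> real \<Rightarrow> 'v \<Rightarrow> 'v \<Rightarrow> bool" where
  "touch a b u w \<longleftrightarrow> (\<exists>s. a < s \<and> s \<le> b \<and> pos s u = pos s w)"

text \<open>The property that is propagated in time. The second clause makes the next step possible:
  if clusters are eventually constant and finite, then the particles led from a finite set of
  leaders form a finite set.\<close>

definition stable :: "real \<Rightarrow> bool" where
  "stable s \<longleftrightarrow>
     (\<forall>v. \<exists>c R. \<forall>\<^sub>F F in finite_subsets_at_top UNIV. fst (sys F s) v = c \<and> snd (sys F s) `` {v} = R) \<and>
     (\<forall>l. \<exists>C. finite C \<and> (\<forall>\<^sub>F F in finite_subsets_at_top UNIV. cluster (sys F s) l = C))"

lemma eventually_finite_sets: "eventually finite (finite_subsets_at_top (UNIV :: 'v set))"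
  by (auto simp: eventually_finite_subsets_at_top)

lemma stable_0: "stable 0"
proof -
  have J: "jtimes F 0 = {}" for F 
  proof -
    have "ring (e v) n \<noteq> 0" for v n using rpos[of v n] by simp
    thus ?thesis by (auto simp: jump_times_def)
  qed
  have s: "sys F 0 = present F" for F by (simp add: finite_system_def J)
  have ev: "\<forall>\<^sub>F F in finite_subsets_at_top UNIV. v \<in> F" for v :: 'v
    by (auto simp: eventually_finite_subsets_at_top intro!: exI[of _ "{v}"])
  have "\<forall>\<^sub>F F in finite_subsets_at_top UNIV. fst (sys F 0) v = Some v \<and> snd (sys F 0) `` {v} = {}" for v
    using ev[of v] by eventually_elim (simp add: s)
  moreover have "\<forall>\<^sub>F F in finite_subsets_at_top UNIV. cluster (sys F 0) l = {l}" for l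
    using ev[of l] by eventually_elim (auto simp: s cluster_def split: if_splits)
  ultimately show ?thesis unfolding stable_def by (meson finite.intros)
qed

text \<open>The component \<open>L\<close> of \<open>l\<close> under touching is finite and closed
  under meeting, and only finitely many particles \<open>D\<close> are led from it at time
  \<open>a\<close>. So finitely many eventual statements at time \<open>a\<close> hold together from
  some \<open>F0\<close> on, and \<open>sys_agree\<close> carries the agreement with the system of
  \<open>F0\<close> to time \<open>b\<close>.\<close>

lemma stable_step:
  assumes st: "stable a" and ab: "a \<le> b" and fin: "\<And>l. finite {w. (touch a b)\<^sup>*\<^sup>* l w}"
  shows "stable b"
proof -
  have key: "\<exists>D L F0. l \<in> L \<and> finite D \<and> finite F0 \<and> 
      (\<forall>F. finite F \<longrightarrow> F0 \<subseteq> F \<longrightarrow> agree D L (sys F b) (sys F0 b) \<and> cluster (sys F a) l \<subseteq> D \<and> cluster (sys F0 a) l \<subseteq> D)" for l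
  proof -
    define L where "L = {w. (touch a b)\<^sup>*\<^sup>* l w}"
    have fL: "finite L" unfolding L_def by (rule fin)
    have "\<forall>l. \<exists>C. finite C \<and> (\<forall>\<^sub>F F in finite_subsets_at_top UNIV. cluster (sys F a) l = C)"
      using st by (simp add: stable_def)
    from choice[OF this] obtain C where C: "\<And>l. finite (C l)"
      "\<And>l. \<forall>\<^sub>F F in finite_subsets_at_top UNIV. cluster (sys F a) l = C l" by blast
    have "\<forall>v. \<exists>cR. \<forall>\<^sub>F F in finite_subsets_at_top UNIV. fst (sys F a) v = fst cR \<and> snd (sys F a) `` {v} = snd cR"
      using st by (simp add: stable_def)
    from choice[OF this] obtain cR' where cR': 
      "\<And>v. \<forall>\<^sub>F F in finite_subsets_at_top UNIV. fst (sys F a) v = fst (cR' v) \<and> snd (sys F a) `` {v} = snd (cR' v)" by blast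
    define c R where "c v = fst (cR' v)" and "R v = snd (cR' v)" for v
    have cR: "\<forall>\<^sub>F F in finite_subsets_at_top UNIV. fst (sys F a) v = c v \<and> snd (sys F a) `` {v} = R v" for v
      unfolding c_def R_def by (rule cR')
    define D where "D = (\<Union>l\<in>L. C l)"
    have fD: "finite D" using fL C by (auto simp: D_def)
    have "\<forall>\<^sub>F F in finite_subsets_at_top UNIV. (\<forall>l\<in>L. cluster (sys F a) l = C l) \<and>
        (\<forall>v\<in>D. fst (sys F a) v = c v \<and> snd (sys F a) `` {v} = R v)"
      using fL fD C(2) cR by (intro eventually_conj) (auto simp: eventually_ball_finite_distrib)
    then obtain F0 where F0: "finite F0" "\<And>F. finite F \<Longrightarrow> F0 \<subseteq> F \<Longrightarrow> (\<forall>l\<in>L. cluster (sys F a) l = C l) \<and>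
        (\<forall>v\<in>D. fst (sys F a) v = c v \<and> snd (sys F a) `` {v} = R v)"
      unfolding eventually_finite_subsets_at_top by auto
    have "agree D L (sys F b) (sys F0 b) \<and> cluster (sys F a) l \<subseteq> D" if F: "finite F" "F0 \<subseteq> F" for F
    proof -
      have *: "c v \<in> insert None (Some ` L)" if "v \<in> D" for v
      proof -
        obtain l where "l \<in> L" "v \<in> C l" using \<open>v \<in> D\<close> by (auto simp: D_def)
        hence "fst (sys F0 a) v = Some l" using F0(2)[OF F0(1)] by (auto simp: cluster_def)
        thus ?thesis using F0(2)[OF F0(1)] that \<open>l \<in> L\<close> by auto
      qed
      have "agree D L (sys F a) (sys F0 a)"
        unfolding agree_def using F0(2)[OF F] F0(2)[OF F0(1)] * by (auto simp: D_def)
      moreover have "m \<in> L" if "a < s" "s \<le> b" "l' \<in> L" "pos s l' = pos s m" for l' m s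
        using that unfolding L_def touch_def by (auto intro: rtranclp.rtrancl_into_rtrancl)
      ultimately have "agree D L (sys F b) (sys F0 b)"
        by (intro sys_agree[OF F(1) F0(1) ab]) auto
      moreover have "l \<in> L" by (simp add: L_def)
      ultimately show ?thesis using F0(2)[OF F] by (auto simp: D_def)
    qed
    moreover have "l \<in> L" by (simp add: L_def)
    ultimately show ?thesis using fD F0(1) by (meson order_refl)
  qed
  show ?thesis unfolding stable_def
  proof (intro conjI allI)
    fix v
    obtain c R where cR: "\<forall>\<^sub>F F in finite_subsets_at_top UNIV. fst (sys F a) v = c \<and> snd (sys F a) `` {v} = R"
      using st unfolding stable_def by blast
    show "\<exists>c R. \<forall>\<^sub>F F in finite_subsets_at_top UNIV. fst (sys F b) v = c \<and> snd (sys F b) `` {v} = R"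
    proof (cases c)
      \<comment> \<open>A particle already absent at time \<open>a\<close> lies in no cluster, so
        \<open>D\<close> need not contain it; its set of partners is frozen instead.\<close>
      case None
      have "\<forall>\<^sub>F F in finite_subsets_at_top UNIV. fst (sys F b) v = None \<and> snd (sys F b) `` {v} = R"
        using cR eventually_finite_sets
      proof eventually_elim
        case (elim F)
        thus ?case using None ab finite_jtimes by (intro finite_system_dead_pairs) auto
      qed
      thus ?thesis by blast
    next
      case (Some l)
      from key[of l] obtain D L F0 where **: "l \<in> L" "finite D" and *: "finite F0"
        "\<forall>F. finite F \<longrightarrow> F0 \<subseteq> F \<longrightarrow> agree D L (sys F b) (sys F0 b) \<and> cluster (sys F a) l \<subseteq> D \<and> cluster (sys F0 a) l \<subseteq> D"
        by (elim exE conjE) (rule that)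
      have "\<forall>\<^sub>F F in finite_subsets_at_top UNIV. finite F \<and> F0 \<subseteq> F"
        using *(1) by (auto simp: eventually_finite_subsets_at_top)
      hence "\<forall>\<^sub>F F in finite_subsets_at_top UNIV. fst (sys F b) v = fst (sys F0 b) v \<and> 
             snd (sys F b) `` {v} = snd (sys F0 b) `` {v}"
        using cR
      proof eventually_elim
        case (elim F)
        hence "v \<in> cluster (sys F a) l" using Some by (auto simp: cluster_def)
        hence "v \<in> D" using *(2)[rule_format, of F] elim by auto
        thus ?case using *(2)[rule_format, of F] elim by (auto simp: agree_def)
      qed
      thus ?thesis by blast
    qed
  next
    fix l
    from key[of l] obtain D L F0 where **: "l \<in> L" "finite D" "finite F0"
      "\<forall>F. finite F \<longrightarrow> F0 \<subseteq> F \<longrightarrow> agree D L (sys F b) (sys F0 b) \<and> cluster (sys F a) l \<subseteq> D \<and> cluster (sys F0 a) l \<subseteq> D"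
      by (elim exE conjE) (rule that)
    have *: "l \<in> L" "finite D" "finite F0" "\<And>F. finite F \<Longrightarrow> F0 \<subseteq> F \<Longrightarrow> agree D L (sys F b) (sys F0 b)"
      using ** by auto
    have "\<forall>\<^sub>F F in finite_subsets_at_top UNIV. finite F \<and> F0 \<subseteq> F"
      using *(3) by (auto simp: eventually_finite_subsets_at_top)
    hence "\<forall>\<^sub>F F in finite_subsets_at_top UNIV. cluster (sys F b) l = cluster (sys F0 b) l"
    proof eventually_elim
      case (elim F)
      thus ?case using agree_cluster[OF *(4) *(1)] by blast
    qed
    moreover have "finite (cluster (sys F0 b) l)"
      using *(4)[OF *(3)] *(1,2) by (auto simp: agree_def intro: finite_subset)
    ultimately show "\<exists>C. finite C \<and> (\<forall>\<^sub>F F in finite_subsets_at_top UNIV. cluster (sys F b) l = C)" by blast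
  qed
qed

end

section \<open>Symmetries\<close>

abbreviation inverse_map :: "('a \<Rightarrow> 'b) \<Rightarrow> 'b \<Rightarrow> 'a" where
  "inverse_map \<equiv> inv_into UNIV"

definition relabel_particle :: "('v \<Rightarrow> 'v) \<Rightarrow> 'v particle \<Rightarrow> 'v particle" where
  "relabel_particle \<phi> q = (spec q, \<phi> \<circ> walk q, wait q, bravery q)"

definition relabel :: "('v \<Rightarrow> 'v) \<Rightarrow> ('v \<Rightarrow> 'v particle) \<Rightarrow> 'v \<Rightarrow> 'v particle" where
  "relabel \<phi> e x = relabel_particle \<phi> (e (inverse_map \<phi> x))"

lemma relabel_particle_simps [simp]:
  "spec (relabel_particle \<phi> q) = spec q" "walk (relabel_particle \<phi> q) n = \<phi> (walk q n)"
  "wait (relabel_particle \<phi> q) = wait q" "bravery (relabel_particle \<phi> q) = bravery q"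
  "ring (relabel_particle \<phi> q) = ring q"
  by (auto simp: relabel_particle_def spec_def walk_def wait_def bravery_def ring_def fun_eq_iff)

lemma relabel_apply: "bij \<phi> \<Longrightarrow> relabel \<phi> e (\<phi> v) = relabel_particle \<phi> (e v)"
  by (simp add: relabel_def bij_is_inj)

lemma position_relabel: "bij \<phi> \<Longrightarrow> position rate (relabel \<phi> e) (\<phi> v) t = \<phi> (position rate e v t)"
  by (simp add: position_def relabel_apply)

lemma jump_times_relabel: "bij \<phi> \<Longrightarrow> jump_times rate (relabel \<phi> e) (\<phi> ` F) t = jump_times rate e F t"
  by (simp add: jump_times_def relabel_apply)

lemma finite_system_relabel:
  assumes \<phi>: "bij \<phi>" and F: "finite F" and inj: "inj (\<lambda>v. bravery (e v))"
  shows "fst (finite_system rate cap (relabel \<phi> e) (\<phi> ` F) t) (\<phi> v) = map_option \<phi> (fst (finite_system rate cap e F t) v)"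
proof (cases "finite (jump_times rate e F t)")
  case True
  have inj\<phi>: "inj \<phi>" using \<phi> by (rule bij_is_inj)
  let ?f = "fold (\<lambda>s. resolve cap e (\<lambda>v. position rate e v s))"
  let ?g = "fold (\<lambda>s. resolve cap (relabel \<phi> e) (\<lambda>v. position rate (relabel \<phi> e) v s))"
  have gen: "\<forall>v. fst (?g ss \<sigma>') (\<phi> v) = map_option \<phi> (fst (?f ss \<sigma>) v)"
    if "\<forall>v. fst \<sigma>' (\<phi> v) = map_option \<phi> (fst \<sigma> v)" "finite (ran (fst \<sigma>))" for ss \<sigma> \<sigma>'
    using that
  proof (induction ss arbitrary: \<sigma> \<sigma>')
    case (Cons s ss)
    let ?r = "resolve cap e (\<lambda>v. position rate e v s) \<sigma>"
    have "\<forall>v. fst (resolve cap (relabel \<phi> e) (\<lambda>v. position rate (relabel \<phi> e) v s) \<sigma>') (\<phi> v) = map_option \<phi> (fst ?r v)"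
      using Cons.prems by (intro allI resolve_relabel[OF _ \<phi>]) (auto simp: relabel_apply[OF \<phi>] inj position_relabel[OF \<phi>])
    moreover have "finite (ran (fst ?r))"
      using resolve_rule[of \<sigma> "\<lambda>_. True"] Cons.prems by blast
    ultimately show ?case using Cons.IH by simp
  qed simp
  have "finite (ran (fst (present F)))"
    by (rule finite_subset[OF _ F]) (auto simp: ran_def split: if_splits)
  moreover have "\<forall>v. fst (present (\<phi> ` F)) (\<phi> v) = map_option \<phi> (fst (present F) v)"
    using inj\<phi> by (auto simp: inj_image_mem_iff)
  ultimately show ?thesis using gen True jump_times_relabel[OF \<phi>, of rate e F t]
    by (simp add: finite_system_def)
next
  case False
  thus ?thesis using jump_times_relabel[OF \<phi>, of rate e F t] by (simp add: finite_system_def)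
qed

text \<open>Taking images under \<open>\<phi>\<close> is an order automorphism of the finite
  subsets, so it preserves the filter.\<close>

lemma eventually_image_finite_subsets:
  assumes "bij (\<phi> :: 'v \<Rightarrow> 'v)"
  shows "(\<forall>\<^sub>F F in finite_subsets_at_top UNIV. P (\<phi> ` F)) \<longleftrightarrow> (\<forall>\<^sub>F F in finite_subsets_at_top UNIV. P F)"
proof -
  have inv: "\<phi> ` inverse_map \<phi> ` F = F" "inverse_map \<phi> ` \<phi> ` F = F" for F
    using assms by (simp_all add: bij_is_surj bij_is_inj image_f_inv_f)
  show ?thesis
    unfolding eventually_finite_subsets_at_top
  proof safe
    fix X assume X: "finite X" "\<forall>Y. finite Y \<and> X \<subseteq> Y \<and> Y \<subseteq> UNIV \<longrightarrow> P (\<phi> ` Y)"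
    show "\<exists>X. finite X \<and> X \<subseteq> UNIV \<and> (\<forall>Y. finite Y \<and> X \<subseteq> Y \<and> Y \<subseteq> UNIV \<longrightarrow> P Y)"
    proof (intro exI[of _ "\<phi> ` X"] conjI allI impI)
      fix Y assume Y: "finite Y \<and> \<phi> ` X \<subseteq> Y \<and> Y \<subseteq> UNIV"
      hence "X \<subseteq> inverse_map \<phi> ` Y" using inv(2)[of X] by blast
      hence "P (\<phi> ` inverse_map \<phi> ` Y)" using X(2) Y by blast
      thus "P Y" by (simp add: inv)
    qed (use X in auto)
  next
    fix X assume X: "finite X" "\<forall>Y. finite Y \<and> X \<subseteq> Y \<and> Y \<subseteq> UNIV \<longrightarrow> P Y"
    show "\<exists>X. finite X \<and> X \<subseteq> UNIV \<and> (\<forall>Y. finite Y \<and> X \<subseteq> Y \<and> Y \<subseteq> UNIV \<longrightarrow> P (\<phi> ` Y))"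
    proof (intro exI[of _ "inverse_map \<phi> ` X"] conjI allI impI)
      fix Y assume Y: "finite Y \<and> inverse_map \<phi> ` X \<subseteq> Y \<and> Y \<subseteq> UNIV"
      hence "X \<subseteq> \<phi> ` Y" using inv(1)[of X] by blast
      thus "P (\<phi> ` Y)" using X(2) Y by blast
    qed (use X in auto)
  qed
qed

lemma follows_relabel:
  assumes \<phi>: "bij \<phi>" and inj: "inj (\<lambda>v. bravery (e v))"
  shows "follows rate cap (relabel \<phi> e) t (\<phi> v) (\<phi> l) \<longleftrightarrow> follows rate cap e t v l"
proof -
  have fin: "\<forall>\<^sub>F F in finite_subsets_at_top (UNIV :: 'a set). finite F"
    by (auto simp: eventually_finite_subsets_at_top)
  have "follows rate cap (relabel \<phi> e) t (\<phi> v) (\<phi> l) \<longleftrightarrow> 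
    (\<forall>\<^sub>F F in finite_subsets_at_top UNIV. fst (finite_system rate cap (relabel \<phi> e) (\<phi> ` F) t) (\<phi> v) = Some (\<phi> l))"
    unfolding follows_def by (rule eventually_image_finite_subsets[OF \<phi>, symmetric])
  also have "\<dots> \<longleftrightarrow> follows rate cap e t v l"
    unfolding follows_def
  proof (rule eventually_cong[OF fin])
    fix F :: "'a set" assume "finite F"
    thus "fst (finite_system rate cap (relabel \<phi> e) (\<phi> ` F) t) (\<phi> v) = Some (\<phi> l) \<longleftrightarrow>
          fst (finite_system rate cap e F t) v = Some l"
      using finite_system_relabel[OF \<phi> _ inj] bij_is_inj[OF \<phi>] by (auto simp: inj_eq)
  qed
  finally show ?thesis .
qed

section \<open>Mass transport\<close>

text \<open>Local finiteness makes the set of sites reachable in \<open>n\<close> steps finite, and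
  by connectedness these sets exhaust the graph. Countability is what keeps sums and quantifiers
  over sites measurable.\<close>

lemma countable_graph:
  assumes "simple_lf_connected_graph (adj :: 'v \<Rightarrow> 'v \<Rightarrow> bool)"
  shows "countable (UNIV :: 'v set)"
proof -
  fix o0 :: 'v
  define S where "S n = {v. (adj ^^ n) o0 v}" for n
  have fin: "finite (S n)" for n
  proof (induction n)
    case 0 thus ?case by (simp add: S_def)
  next
    case (Suc n)
    have "S (Suc n) = (\<Union>u\<in>S n. {v. adj u v})" by (auto simp: S_def)
    thus ?case using Suc assms by (simp add: simple_lf_connected_graph_def)
  qed
  have "UNIV = (\<Union>n. S n)"
    using assms by (auto simp: simple_lf_connected_graph_def S_def rtranclp_power)
  thus ?thesis using fin by (metis countable_UN countable_finite countableI_type)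
qed

lemma Aut_K_D:
  assumes "subgroup \<Gamma> (Aut_K adj K)" "\<phi> \<in> \<Gamma>"
  shows "bij \<phi>" "K u v = K (\<phi> u) (\<phi> v)"
  using subgroup.subset[OF assms(1)] assms(2) by (auto simp: Aut_K_def)

text \<open>The substance is in the last claim: the inverse supplied by the group structure is the
  inverse map.\<close>

lemma Aut_K_closed:
  assumes "subgroup \<Gamma> (Aut_K adj K)"
  shows "id \<in> \<Gamma>" "\<phi> \<in> \<Gamma> \<Longrightarrow> \<psi> \<in> \<Gamma> \<Longrightarrow> \<phi> \<circ> \<psi> \<in> \<Gamma>" "\<phi> \<in> \<Gamma> \<Longrightarrow> inverse_map \<phi> \<in> \<Gamma>"
proof -
  show "id \<in> \<Gamma>" using subgroup.one_closed[OF assms] by (simp add: Aut_K_def)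
  show "\<phi> \<in> \<Gamma> \<Longrightarrow> \<psi> \<in> \<Gamma> \<Longrightarrow> \<phi> \<circ> \<psi> \<in> \<Gamma>" for \<phi> \<psi>
    using subgroup.m_closed[OF assms, of \<phi> \<psi>] by (simp add: Aut_K_def)
  show "inverse_map \<phi> \<in> \<Gamma>" if "\<phi> \<in> \<Gamma>" for \<phi>
  proof -
    let ?G = "Aut_K adj K"
    have i: "inv\<^bsub>?G\<^esub> \<phi> \<in> \<Gamma>" using subgroup.m_inv_closed[OF assms that] .
    have c: "\<phi> \<in> carrier ?G" using subgroup.subset[OF assms] that by auto
    have "inverse_map \<phi> \<in> carrier ?G"
    proof -
      have b: "bij \<phi>" using c by (auto simp: Aut_K_def)
      have s: "\<phi> (inverse_map \<phi> u) = u" for u using b by (simp add: bij_is_surj surj_f_inv_f)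
      have "adj (inverse_map \<phi> u) (inverse_map \<phi> v) \<longleftrightarrow> adj u v" "K u v = K (inverse_map \<phi> u) (inverse_map \<phi> v)" for u v
        using c s[of u] s[of v] by (auto simp: Aut_K_def) metis+
      thus ?thesis using b by (auto simp: Aut_K_def bij_imp_bij_inv)
    qed
    moreover have "inverse_map \<phi> \<circ> \<phi> = id" "\<phi> \<circ> inverse_map \<phi> = id"
      using c by (auto simp: Aut_K_def bij_is_inj bij_is_surj surj_iff[symmetric])
    ultimately have ex: "\<exists>y. y \<in> carrier ?G \<and> \<phi> \<otimes>\<^bsub>?G\<^esub> y = \<one>\<^bsub>?G\<^esub> \<and> y \<otimes>\<^bsub>?G\<^esub> \<phi> = \<one>\<^bsub>?G\<^esub>"
      by (intro exI[of _ "inverse_map \<phi>"]) (simp add: Aut_K_def)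
    have uniq: "y = inverse_map \<phi>" if "\<phi> \<circ> y = id" for y
    proof -
      have "y = inverse_map \<phi> \<circ> \<phi> \<circ> y" using \<open>inverse_map \<phi> \<circ> \<phi> = id\<close> by simp
      also have "\<dots> = inverse_map \<phi> \<circ> (\<phi> \<circ> y)" by (simp add: comp_assoc)
      finally show ?thesis using that by simp
    qed
    have "inv\<^bsub>?G\<^esub> \<phi> = inverse_map \<phi>"
      unfolding m_inv_def by (rule the_equality) (use ex uniq in \<open>auto simp: Aut_K_def\<close>)
    thus ?thesis using i by simp
  qed
qed

lemma ennreal_divide_mult_of_nat: "n \<noteq> 0 \<Longrightarrow> (a :: ennreal) / of_nat n * of_nat n = a"
  by (metis ennreal_of_nat_neq_top ennreal_times_divide mult_divide_eq_ennreal mult_of_nat_commute of_nat_eq_0_iff)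

text \<open>Pair \<open>v\<close> with \<open>u\<close> when some symmetry carries \<open>(x, v)\<close> to \<open>(u, x)\<close>. Both sides of this
  relation have fibres of size \<open>card (\<Gamma>\<^sub>x v) = card (\<Gamma>\<^sub>v x)\<close>, so double counting applies.\<close>

theorem mass_transport:
  fixes f :: "'v \<Rightarrow> 'v \<Rightarrow> ennreal"
  assumes G: "subgroup \<Gamma> (Aut_K adj K)" and trans: "transitive_on \<Gamma>" and unim: "unimodular_on \<Gamma>"
    and cnt: "countable (UNIV :: 'v set)"
    and inv: "\<And>\<phi> u v. \<phi> \<in> \<Gamma> \<Longrightarrow> f (\<phi> u) (\<phi> v) = f u v"
  shows "(\<integral>\<^sup>+v. f x v \<partial>count_space UNIV) = (\<integral>\<^sup>+v. f v x \<partial>count_space UNIV)"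
proof -
  define R where "R v u \<longleftrightarrow> (\<exists>\<psi>\<in>\<Gamma>. \<psi> x = u \<and> \<psi> v = x)" for v u
  note closed = Aut_K_closed[OF G] 
  have bij: "bij \<psi>" if "\<psi> \<in> \<Gamma>" for \<psi> using Aut_K_D(1)[OF G that] .
  have invs: "inverse_map \<psi> (\<psi> y) = y" "\<psi> (inverse_map \<psi> y) = y" if "\<psi> \<in> \<Gamma>" for \<psi> y
    using bij[OF that] by (simp_all add: bij_is_inj bij_is_surj surj_f_inv_f)
  have ex1: "\<exists>u. R v u" for v
    using trans unfolding transitive_on_def maps_to_def R_def by blast
  have ex2: "\<exists>v. R v u" for u
  proof -
    obtain \<psi> where "\<psi> \<in> \<Gamma>" "\<psi> x = u" using trans unfolding transitive_on_def maps_to_def by blast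
    thus ?thesis unfolding R_def using invs by metis
  qed
  \<comment> \<open>Two symmetries taking \<open>v\<close> to \<open>x\<close> differ by an element
    of the stabiliser of \<open>v\<close>, so this fibre is an image of the orbit of
    \<open>x\<close> under that stabiliser.\<close>
  have fib1: "{u'. R v u'} = \<psi> ` ((\<lambda>\<phi>. \<phi> x) ` maps_to \<Gamma> v v)" if \<psi>: "\<psi> \<in> \<Gamma>" "\<psi> v = x" for v \<psi>
  proof safe
    fix u' assume "R v u'"
    then obtain \<theta> where \<theta>: "\<theta> \<in> \<Gamma>" "\<theta> x = u'" "\<theta> v = x" by (auto simp: R_def)
    have "inverse_map \<psi> \<circ> \<theta> \<in> maps_to \<Gamma> v v"
      using closed \<psi> \<theta> invs(1)[OF \<psi>(1), of v] by (auto simp: maps_to_def)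
    moreover have "u' = \<psi> ((inverse_map \<psi> \<circ> \<theta>) x)" using \<theta> invs(2)[OF \<psi>(1)] by simp
    ultimately show "u' \<in> \<psi> ` ((\<lambda>\<phi>. \<phi> x) ` maps_to \<Gamma> v v)" by blast
  next
    fix \<phi> assume "\<phi> \<in> maps_to \<Gamma> v v"
    thus "R v (\<psi> (\<phi> x))" unfolding R_def maps_to_def using closed(2)[OF \<psi>(1), of \<phi>] \<psi>
      by (intro bexI[of _ "\<psi> \<circ> \<phi>"]) auto
  qed
  have fib2: "{v'. R v' u} = (\<lambda>\<phi>. \<phi> v) ` maps_to \<Gamma> x x" if vu: "R v u" for v u
  proof -
    obtain \<psi> where \<psi>: "\<psi> \<in> \<Gamma>" "\<psi> x = u" "\<psi> v = x" using vu by (auto simp: R_def)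
    show ?thesis
    proof safe
      fix v' assume "R v' u"
      then obtain \<theta> where \<theta>: "\<theta> \<in> \<Gamma>" "\<theta> x = u" "\<theta> v' = x" by (auto simp: R_def)
      have "inverse_map \<theta> \<circ> \<psi> \<in> maps_to \<Gamma> x x"
        using closed \<psi> \<theta> invs(1)[OF \<theta>(1), of x] by (auto simp: maps_to_def)
      moreover have "v' = (inverse_map \<theta> \<circ> \<psi>) v" using \<theta> \<psi> invs(1)[OF \<theta>(1), of v'] by simp
      ultimately show "v' \<in> (\<lambda>\<phi>. \<phi> v) ` maps_to \<Gamma> x x" by blast
    next
      fix \<phi> assume \<phi>: "\<phi> \<in> maps_to \<Gamma> x x"
      hence \<phi>': "\<phi> \<in> \<Gamma>" "\<phi> x = x" by (auto simp: maps_to_def)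
      have "inverse_map \<phi> x = x" using invs(1)[OF \<phi>'(1), of x] \<phi>' by simp
      moreover have "inverse_map \<phi> (\<phi> v) = v" using invs(1)[OF \<phi>'(1)] .
      ultimately show "R (\<phi> v) u" unfolding R_def using closed(2)[OF \<psi>(1) closed(3)[OF \<phi>'(1)]] \<psi>
        by (intro bexI[of _ "\<psi> \<circ> inverse_map \<phi>"]) auto
    qed
  qed
  have un: "finite ((\<lambda>\<phi>. \<phi> x) ` maps_to \<Gamma> v v)" "finite ((\<lambda>\<phi>. \<phi> v) ` maps_to \<Gamma> x x)"
    "card ((\<lambda>\<phi>. \<phi> x) ` maps_to \<Gamma> v v) = card ((\<lambda>\<phi>. \<phi> v) ` maps_to \<Gamma> x x)" for v
    using unim unfolding unimodular_on_def by (metis)+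
  have fin1: "finite {u. R v u}" for v
  proof -
    obtain \<psi> where "\<psi> \<in> \<Gamma>" "\<psi> v = x" using ex1[of v] by (auto simp: R_def)
    thus ?thesis using fib1 un by simp
  qed
  have fin2: "finite {v. R v u}" for u using ex2[of u] fib2 un by metis
  have cards: "card {v'. R v' u} = card {u'. R v u'}" if vu: "R v u" for v u
  proof -
    obtain \<psi> where \<psi>: "\<psi> \<in> \<Gamma>" "\<psi> x = u" "\<psi> v = x" using vu by (auto simp: R_def)
    have "card {u'. R v u'} = card ((\<lambda>\<phi>. \<phi> x) ` maps_to \<Gamma> v v)"
      unfolding fib1[OF \<psi>(1,3)] using bij[OF \<psi>(1)] 
      by (intro card_image) (auto simp: bij_def inj_def inj_on_def)
    thus ?thesis using un fib2[OF vu] by simp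
  qed
  have fR: "f x v = f u x" if "R v u" for v u
    using that inv[of _ x v] by (auto simp: R_def)
  define c1 where "c1 v = card {u. R v u}" for v
  define c2 where "c2 u = card {v. R v u}" for u
  have c1: "c1 v \<noteq> 0" and c2: "c2 u \<noteq> 0" for u v 
    using fin1 fin2 ex1 ex2 by (auto simp: c1_def c2_def)
  \<comment> \<open>Each mass \<open>f x v\<close> is spread evenly over the \<open>c1 v\<close>
    partners \<open>u\<close> of \<open>v\<close>. By \<open>fR\<close> and \<open>cards\<close>,
    the same array summed the other way spreads \<open>f u x\<close> evenly over the
    \<open>c2 u\<close> partners of \<open>u\<close>.\<close>
  have "(\<integral>\<^sup>+v. f x v \<partial>count_space UNIV) = 
        (\<integral>\<^sup>+v. \<integral>\<^sup>+u. f x v / of_nat (c1 v) * indicator {u. R v u} u \<partial>count_space UNIV \<partial>count_space UNIV)"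
    using fin1 c1 by (simp add: nn_integral_cmult c1_def[symmetric] ennreal_divide_mult_of_nat)
  also have "\<dots> = (\<integral>\<^sup>+u. \<integral>\<^sup>+v. f x v / of_nat (c1 v) * indicator {u. R v u} u \<partial>count_space UNIV \<partial>count_space UNIV)"
    using cnt by (intro nn_integral_count_space_nn_integral) auto
  also have "\<dots> = (\<integral>\<^sup>+u. \<integral>\<^sup>+v. f u x / of_nat (c2 u) * indicator {v. R v u} v \<partial>count_space UNIV \<partial>count_space UNIV)"
    using fR cards by (intro nn_integral_cong) (auto simp: c1_def c2_def indicator_def)
  also have "\<dots> = (\<integral>\<^sup>+u. f u x \<partial>count_space UNIV)"
    using fin2 c2 by (simp add: nn_integral_cmult c2_def[symmetric] ennreal_divide_mult_of_nat)
  finally show ?thesis .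
qed

section \<open>Measurability\<close>

lemma measurable_spec [measurable]: "spec \<in> measurable particle_space (count_space UNIV)"
  unfolding spec_def[abs_def] particle_space_def by measurable

lemma measurable_walk [measurable]: "(\<lambda>q. walk q n) \<in> measurable particle_space (count_space UNIV)"
  unfolding walk_def[abs_def] particle_space_def path_space_def by measurable

lemma measurable_wait [measurable]: "(\<lambda>q. wait q n) \<in> borel_measurable particle_space"
  unfolding wait_def[abs_def] particle_space_def by measurable

lemma measurable_bravery [measurable]: "bravery \<in> borel_measurable particle_space"
  unfolding bravery_def[abs_def] particle_space_def by measurable

lemma measurable_ring [measurable]: "(\<lambda>q. ring q n) \<in> borel_measurable particle_space"
  unfolding ring_def[abs_def] by measurable

lemma measurable_rate [measurable]: "(\<lambda>q. rate (spec q)) \<in> borel_measurable particle_space"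
  for rate :: "species \<Rightarrow> real"
  by (rule measurable_compose[OF measurable_spec]) simp

lemma measurable_jumps [measurable (raw)]:
  assumes [measurable]: "q \<in> measurable N particle_space" "t \<in> borel_measurable N"
  shows "(\<lambda>\<omega>. jumps rate (q \<omega>) (t \<omega>)) \<in> measurable N (count_space UNIV)"
  unfolding jumps_def by measurable

lemma measurable_walk_at [measurable (raw)]:
  assumes [measurable]: "q \<in> measurable N particle_space" "n \<in> measurable N (count_space UNIV)"
  shows "(\<lambda>\<omega>. walk (q \<omega>) (n \<omega>)) \<in> measurable N (count_space UNIV)"
proof (rule measurable_compose_countable[of "\<lambda>k \<omega>. walk (q \<omega>) k" _ _ n])
  show "(\<lambda>\<omega>. walk (q \<omega>) k) \<in> measurable N (count_space UNIV)" for k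
    by (rule measurable_compose[OF assms(1) measurable_walk])
qed fact

lemma pred_countable_Bex:
  "countable I \<Longrightarrow> (\<And>i. i \<in> I \<Longrightarrow> Measurable.pred M (\<lambda>x. P x i)) \<Longrightarrow> Measurable.pred M (\<lambda>x. \<exists>i\<in>I. P x i)"
  unfolding pred_def by (intro sets.sets_Collect_countable_Ex') auto

lemma pred_countable_Ball:
  "countable I \<Longrightarrow> (\<And>i. i \<in> I \<Longrightarrow> Measurable.pred M (\<lambda>x. P x i)) \<Longrightarrow> Measurable.pred M (\<lambda>x. \<forall>i\<in>I. P x i)"
  unfolding pred_def by (intro sets.sets_Collect_countable_All') auto

lemma measurable_count_space_subset:
  assumes "f \<in> measurable N (count_space UNIV)" "\<And>x. x \<in> space N \<Longrightarrow> f x \<in> A"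
  shows "f \<in> measurable N (count_space A)"
  using assms measurable_sets[OF assms(1)] by (intro measurableI) auto

lemma measurable_card_countable:
  fixes S :: "'a \<Rightarrow> 'v set"
  assumes "countable (UNIV :: 'v set)" and [measurable]: "\<And>i. {x \<in> space M. i \<in> S x} \<in> sets M"
  shows "(\<lambda>x. card (S x)) \<in> measurable M (count_space UNIV)"
proof -
  let ?f = "to_nat_on (UNIV :: 'v set)"
  have inj: "inj ?f" using assms(1) by (rule inj_on_to_nat_on)
  have "(\<lambda>x. card (?f ` S x)) \<in> measurable M (count_space UNIV)"
  proof (rule measurable_card)
    fix i
    have "{x \<in> space M. i \<in> ?f ` S x} = {x \<in> space M. \<exists>v\<in>{v. ?f v = i}. v \<in> S x}" by auto
    also have "\<dots> \<in> sets M"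
      by (intro sets.sets_Collect_countable_Ex') (auto intro: countable_subset[OF _ assms(1)])
    finally show "{x \<in> space M. i \<in> ?f ` S x} \<in> sets M" .
  qed
  moreover have "card (?f ` S x) = card (S x)" for x
    using inj by (intro card_image) (auto simp: inj_on_def)
  ultimately show ?thesis by simp
qed

lemma measurable_finite_Collect:
  assumes "finite S" "\<And>i. i \<in> S \<Longrightarrow> Measurable.pred N (\<lambda>\<omega>. P \<omega> i)"
  shows "(\<lambda>\<omega>. {i \<in> S. P \<omega> i}) \<in> measurable N (count_space UNIV)"
  using assms
proof (induction S rule: finite_induct)
  case empty thus ?case by simp
next
  case (insert a S)
  have eq: "{i \<in> insert a S. P \<omega> i} = (if P \<omega> a then insert a {i \<in> S. P \<omega> i} else {i \<in> S. P \<omega> i})" for \<omega>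
    by auto
  have 1: "(\<lambda>\<omega>. {i \<in> S. P \<omega> i}) \<in> measurable N (count_space UNIV)"
    using insert.IH insert.prems by simp
  have 2: "(\<lambda>\<omega>. insert a {i \<in> S. P \<omega> i}) \<in> measurable N (count_space UNIV)"
    by (rule measurable_compose[OF 1, of "insert a"]) simp
  have "{\<omega> \<in> space N. P \<omega> a} \<in> sets N" using insert.prems[of a] by (auto simp: pred_def)
  thus ?case unfolding eq using 1 2 by (intro measurable_If) auto
qed

text \<open>Every map out of a \<open>count_space\<close> is measurable, so it is enough that
  \<open>g\<close> factors through \<open>X\<close>; \<open>h\<close> evaluates \<open>g\<close> at
  an arbitrary point of the fibre.\<close>

lemma measurable_determined:
  assumes "X \<in> measurable N (count_space UNIV)"
    and "\<And>\<omega> \<omega>'. \<omega> \<in> space N \<Longrightarrow> \<omega>' \<in> space N \<Longrightarrow> X \<omega> = X \<omega>' \<Longrightarrow> g \<omega> = g \<omega>'"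
  shows "g \<in> measurable N (count_space UNIV)"
proof -
  define h where "h x = g (SOME \<omega>. \<omega> \<in> space N \<and> X \<omega> = x)" for x
  have "h (X \<omega>) = g \<omega>" if "\<omega> \<in> space N" for \<omega>
  proof -
    have "(SOME \<omega>'. \<omega>' \<in> space N \<and> X \<omega>' = X \<omega>) \<in> space N \<and> X (SOME \<omega>'. \<omega>' \<in> space N \<and> X \<omega>' = X \<omega>) = X \<omega>"
      by (rule someI[of _ \<omega>]) (use that in simp)
    thus ?thesis unfolding h_def using assms(2)[OF _ that] by blast
  qed
  moreover have "(\<lambda>\<omega>. h (X \<omega>)) \<in> measurable N (count_space UNIV)"
    by (rule measurable_compose[OF assms(1)]) simp
  ultimately show ?thesis by (simp cong: measurable_cong)
qed

text \<open>A supported state is coded by two relations on the finite set \<open>F\<close>. Finitely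
  many possible states allow random reactions to be composed measurably, state by state.\<close>

lemma finite_supported: assumes "finite F" shows "finite {\<sigma>. supported F \<sigma>}"
proof -
  let ?h = "\<lambda>\<sigma> :: 'a state. ({(v, l). fst \<sigma> v = Some l}, snd \<sigma>)"
  have i: "inj ?h"
  proof (rule injI)
    fix \<sigma> \<sigma>' :: "'a state" assume *: "?h \<sigma> = ?h \<sigma>'"
    have "fst \<sigma> v = Some l \<longleftrightarrow> fst \<sigma>' v = Some l" for v l
    proof -
      have "{(v, l). fst \<sigma> v = Some l} = {(v, l). fst \<sigma>' v = Some l}" using * by simp
      hence "(v, l) \<in> {(v, l). fst \<sigma> v = Some l} \<longleftrightarrow> (v, l) \<in> {(v, l). fst \<sigma>' v = Some l}" by (simp only:)
      thus ?thesis by simp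
    qed
    hence "fst \<sigma> v = fst \<sigma>' v" for v by (metis not_None_eq)
    thus "\<sigma> = \<sigma>'" using * by (auto simp: prod_eq_iff)
  qed
  have "?h ` {\<sigma>. supported F \<sigma>} \<subseteq> Pow (F \<times> F) \<times> Pow (F \<times> F)"
    by (auto simp: supported_def)
  hence "finite (?h ` {\<sigma>. supported F \<sigma>})" by (rule finite_subset) (use assms in simp)
  thus ?thesis by (rule finite_imageD[OF _ inj_on_subset[OF i subset_UNIV]])
qed

text \<open>The time is a random variable rather than a constant, so that the same lemmas serve
  fixed times, shifted times, and joint measurability in sample point and time on a product
  space.\<close>

locale measurable_env =
  fixes N :: "'n measure" and e :: "'n \<Rightarrow> 'v \<Rightarrow> 'v particle" and t :: "'n \<Rightarrow> real"
    and rate :: "species \<Rightarrow> real" and cap :: "species \<Rightarrow> enat"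
  assumes cnt: "countable (UNIV :: 'v set)"
    and env_meas [measurable]: "\<And>v. (\<lambda>\<omega>. e \<omega> v) \<in> measurable N particle_space"
    and time_meas [measurable]: "t \<in> borel_measurable N"
    and rate_nonneg: "\<And>s. 0 \<le> rate s"
begin

lemma measurable_position:
  assumes [measurable]: "s \<in> borel_measurable N"
  shows "(\<lambda>\<omega>. position rate (e \<omega>) v (s \<omega>)) \<in> measurable N (count_space UNIV)"
  unfolding position_jumps by measurable

lemma pred_position_eq:
  assumes s: "s \<in> borel_measurable N"
  shows "Measurable.pred N (\<lambda>\<omega>. position rate (e \<omega>) u (s \<omega>) = position rate (e \<omega>) v (s \<omega>))"
proof -
  note [measurable] = measurable_position[OF s]
  have "Measurable.pred N (\<lambda>\<omega>. \<exists>y\<in>UNIV. position rate (e \<omega>) u (s \<omega>) = y \<and> position rate (e \<omega>) v (s \<omega>) = y)"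
    by (rule pred_countable_Bex[OF cnt]) measurable
  also have "(\<lambda>\<omega>. \<exists>y\<in>UNIV. position rate (e \<omega>) u (s \<omega>) = y \<and> position rate (e \<omega>) v (s \<omega>) = y) =
    (\<lambda>\<omega>. position rate (e \<omega>) u (s \<omega>) = position rate (e \<omega>) v (s \<omega>))" by auto
  finally show ?thesis .
qed

lemma measurable_resolve:
  assumes F: "finite F" "supported F \<sigma>" and s: "s \<in> borel_measurable N"
  shows "(\<lambda>\<omega>. resolve cap (e \<omega>) (\<lambda>v. position rate (e \<omega>) v (s \<omega>)) \<sigma>) \<in> measurable N (count_space {\<sigma>. supported F \<sigma>})"
proof -
  \<comment> \<open>The indices 0, 1, 2 encode the three kinds of questions that decide the outcome
    by \<open>resolve_cong\<close>: same position, smaller bravery, type \<open>A\<close>.\<close>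
  define P where "P \<omega> k = (case k of (u, v, i :: nat) \<Rightarrow> 
     (i = 0 \<and> position rate (e \<omega>) u (s \<omega>) = position rate (e \<omega>) v (s \<omega>)) \<or>
     (i = 1 \<and> bravery (e \<omega> u) < bravery (e \<omega> v)) \<or> (i = 2 \<and> spec (e \<omega> u) = TypeA))" for \<omega> k
  let ?S = "F \<times> F \<times> {0, 1, 2 :: nat}"
  have P: "P \<omega> (u, v, 0) = (position rate (e \<omega>) u (s \<omega>) = position rate (e \<omega>) v (s \<omega>))"
    "P \<omega> (u, v, 1) = (bravery (e \<omega> u) < bravery (e \<omega> v))" "P \<omega> (u, v, 2) = (spec (e \<omega> u) = TypeA)" for \<omega> u v
    by (simp_all add: P_def)
  have "Measurable.pred N (\<lambda>\<omega>. P \<omega> k)" for k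
    unfolding P_def using pred_position_eq[OF s] by (cases k) simp
  hence X: "(\<lambda>\<omega>. {k \<in> ?S. P \<omega> k}) \<in> measurable N (count_space UNIV)"
    using F by (intro measurable_finite_Collect) auto
  have det: "resolve cap (e \<omega>) (\<lambda>v. position rate (e \<omega>) v (s \<omega>)) \<sigma> = resolve cap (e \<omega>') (\<lambda>v. position rate (e \<omega>') v (s \<omega>')) \<sigma>
     \<and> supported F (resolve cap (e \<omega>) (\<lambda>v. position rate (e \<omega>) v (s \<omega>)) \<sigma>)"
    if eq: "{k \<in> ?S. P \<omega> k} = {k \<in> ?S. P \<omega>' k}" for \<omega> \<omega>'
  proof (rule resolve_cong[OF F])
    have *: "P \<omega> k \<longleftrightarrow> P \<omega>' k" if "k \<in> ?S" for k using eq that by blast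
    show "spec (e \<omega> v) = spec (e \<omega>' v)" if "v \<in> F" for v
      using *[of "(v, v, 2)"] that P(3) by (cases "spec (e \<omega> v)"; cases "spec (e \<omega>' v)") auto
    show "(bravery (e \<omega> u) < bravery (e \<omega> v)) = (bravery (e \<omega>' u) < bravery (e \<omega>' v))" if "u \<in> F" "v \<in> F" for u v
      using *[of "(u, v, 1)"] that P(2) by auto
    show "(position rate (e \<omega>) u (s \<omega>) = position rate (e \<omega>) v (s \<omega>)) =
          (position rate (e \<omega>') u (s \<omega>') = position rate (e \<omega>') v (s \<omega>'))" if "u \<in> F" "v \<in> F" for u v
      using *[of "(u, v, 0)"] that P(1) by auto
  qed
  have A: "(\<lambda>\<omega>. resolve cap (e \<omega>) (\<lambda>v. position rate (e \<omega>) v (s \<omega>)) \<sigma>) \<in> measurable N (count_space UNIV)"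
  proof (rule measurable_determined[OF X])
    fix \<omega> \<omega>' assume "{k \<in> ?S. P \<omega> k} = {k \<in> ?S. P \<omega>' k}"
    thus "resolve cap (e \<omega>) (\<lambda>v. position rate (e \<omega>) v (s \<omega>)) \<sigma> =
      resolve cap (e \<omega>') (\<lambda>v. position rate (e \<omega>') v (s \<omega>')) \<sigma>"
      by (rule conjunct1[OF det])
  qed
  have B: "supported F (resolve cap (e \<omega>) (\<lambda>v. position rate (e \<omega>) v (s \<omega>)) \<sigma>)" for \<omega>
    by (rule conjunct2[OF det[of \<omega> \<omega>, OF refl]])
  show ?thesis by (rule measurable_count_space_subset[OF A]) (rule CollectI, rule B)
qed

lemma measurable_fold_resolve:
  assumes F: "finite F" and "\<And>s. s \<in> set ss \<Longrightarrow> s \<in> borel_measurable N"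
    and "\<sigma> \<in> measurable N (count_space {\<sigma>. supported F \<sigma>})"
  shows "(\<lambda>\<omega>. fold (\<lambda>s. resolve cap (e \<omega>) (\<lambda>v. position rate (e \<omega>) v s)) (map (\<lambda>s. s \<omega>) ss) (\<sigma> \<omega>))
     \<in> measurable N (count_space {\<sigma>. supported F \<sigma>})"
  using assms(2,3)
proof (induction ss arbitrary: \<sigma>)
  case (Cons s ss)
  have "(\<lambda>\<omega>. resolve cap (e \<omega>) (\<lambda>v. position rate (e \<omega>) v (s \<omega>)) (\<sigma> \<omega>)) \<in> measurable N (count_space {\<sigma>. supported F \<sigma>})"
  proof (rule measurable_compose_countable'[of "{\<sigma>. supported F \<sigma>}" "\<lambda>\<sigma> \<omega>. resolve cap (e \<omega>) (\<lambda>v. position rate (e \<omega>) v (s \<omega>)) \<sigma>"])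
    show "(\<lambda>\<omega>. resolve cap (e \<omega>) (\<lambda>v. position rate (e \<omega>) v (s \<omega>)) \<tau>) \<in> measurable N (count_space {\<sigma>. supported F \<sigma>})"
      if "\<tau> \<in> {\<sigma>. supported F \<sigma>}" for \<tau> using that Cons.prems by (intro measurable_resolve F) auto
  qed (use Cons.prems finite_supported[OF F] in \<open>auto intro: countable_finite\<close>)
  from Cons.IH[OF _ this] show ?case using Cons.prems by simp
qed simp

text \<open>The number and order of the jump times are random. The sample space is therefore split
  into countably many events according to a list of names of rings that enumerates the jump times in
  increasing order; on each event the system is a fold over measurable times.\<close>

lemma measurable_finite_system:
  assumes F: "finite F"
  shows "(\<lambda>\<omega>. finite_system rate cap (e \<omega>) F (t \<omega>)) \<in> measurable N (count_space UNIV)"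
proof -
  \<comment> \<open>\<open>Some (v, n)\<close> names ring \<open>n\<close> of particle
    \<open>v\<close>. The name \<open>None\<close>, with time 0, serves degenerate environments in
    which a particle of rate 0 has a ring at level 0.\<close>
  define T where "T k \<omega> = (case k of None \<Rightarrow> 0 | Some (v, n) \<Rightarrow> ring (e \<omega> v) n / rate (spec (e \<omega> v)))" for k \<omega>
  define I where "I = insert None (Some ` (F \<times> (UNIV :: nat set)))"
  have cI: "countable I" unfolding I_def using F by (auto intro: countable_finite)
  \<comment> \<open>In such an environment every time in \<open>{0..t \<omega>}\<close> counts as a
    jump time: infinitely many if \<open>0 < t \<omega>\<close>, and just time 0 if
    \<open>t \<omega> = 0\<close>.\<close>
  define bad where "bad \<omega> \<longleftrightarrow> (\<exists>v\<in>F. \<exists>n. rate (spec (e \<omega> v)) = 0 \<and> ring (e \<omega> v) n = 0)" for \<omega>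
  define act where "act k \<omega> = (case k of None \<Rightarrow> bad \<omega> \<and> t \<omega> = 0 | Some (v, n) \<Rightarrow> 
    rate (spec (e \<omega> v)) \<noteq> 0 \<and> 0 \<le> T k \<omega> \<and> T k \<omega> \<le> t \<omega>)" for k \<omega>
  have T_meas [measurable]: "T k \<in> borel_measurable N" for k
    unfolding T_def by (cases k; simp split: prod.split) measurable
  have bad_meas [measurable]: "Measurable.pred N bad"
    unfolding bad_def using F by measurable
  have act_meas [measurable]: "Measurable.pred N (act k)" for k
    unfolding act_def by (cases k; simp split: prod.split) measurable
  have jt: "jump_times rate (e \<omega>) F (t \<omega>) = {T k \<omega> | k. k \<in> I \<and> act k \<omega>}" if "\<not> (bad \<omega> \<and> 0 < t \<omega>)" for \<omega>
  proof (intro equalityI subsetI)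
    fix s assume "s \<in> jump_times rate (e \<omega>) F (t \<omega>)"
    then obtain v n where v: "0 \<le> s" "s \<le> t \<omega>" "v \<in> F" "ring (e \<omega> v) n = rate (spec (e \<omega> v)) * s"
      by (auto simp: jump_times_def)
    show "s \<in> {T k \<omega> | k. k \<in> I \<and> act k \<omega>}"
    proof (cases "rate (spec (e \<omega> v)) = 0")
      case True
      hence "bad \<omega>" using v by (auto simp: bad_def)
      hence "t \<omega> = 0" "s = 0" using that v by auto
      thus ?thesis using \<open>bad \<omega>\<close> by (auto simp: I_def act_def T_def intro!: exI[of _ None])
    next
      case False
      hence "s = T (Some (v, n)) \<omega>" using v by (simp add: T_def)
      moreover from this have "act (Some (v, n)) \<omega>" using v False by (simp add: act_def)
      moreover have "Some (v, n) \<in> I" using v by (simp add: I_def)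
      ultimately show ?thesis by blast
    qed
  next
    fix s assume "s \<in> {T k \<omega> | k. k \<in> I \<and> act k \<omega>}"
    then obtain k where k: "s = T k \<omega>" "k \<in> I" "act k \<omega>" by blast
    show "s \<in> jump_times rate (e \<omega>) F (t \<omega>)"
    proof (cases k)
      case None
      thus ?thesis using k by (auto simp: act_def T_def bad_def jump_times_def)
    next
      case (Some vn)
      obtain v n where vn: "vn = (v, n)" by (cases vn)
      have v: "v \<in> F" using k Some vn by (auto simp: I_def)
      have "rate (spec (e \<omega> v)) \<noteq> 0" "0 \<le> s" "s \<le> t \<omega>" "s = ring (e \<omega> v) n / rate (spec (e \<omega> v))"
        using k Some vn by (auto simp: act_def T_def)
      thus ?thesis unfolding jump_times_def using v by (auto intro!: bexI[of _ v] exI[of _ n])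
    qed
  qed
  have inf: "infinite (jump_times rate (e \<omega>) F (t \<omega>))" if "bad \<omega>" "0 < t \<omega>" for \<omega>
  proof -
    obtain v n where "v \<in> F" "rate (spec (e \<omega> v)) = 0" "ring (e \<omega> v) n = 0"
      using \<open>bad \<omega>\<close> unfolding bad_def by blast
    hence "{0..t \<omega>} \<subseteq> jump_times rate (e \<omega>) F (t \<omega>)"
      unfolding jump_times_def by (auto intro!: bexI[of _ v] exI[of _ n])
    thus ?thesis using that(2) infinite_Icc finite_subset by metis
  qed
  \<comment> \<open>\<open>ks\<close> has to list one name for each jump time, in strictly
    increasing order of times. Of several simultaneous rings only one is named.\<close>
  define B where "B ks \<omega> \<longleftrightarrow> \<not> (bad \<omega> \<and> 0 < t \<omega>) \<and> (\<forall>k\<in>I. act k \<omega> \<longrightarrow> (\<exists>j\<in>set ks. T k \<omega> = T j \<omega>)) \<and>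
     (\<forall>j\<in>set ks. act j \<omega>) \<and> (\<forall>i<length ks. \<forall>j<i. T (ks ! j) \<omega> < T (ks ! i) \<omega>)" for ks \<omega>
  have B_meas [measurable]: "Measurable.pred N (B ks)" for ks
    unfolding B_def 
    by (intro pred_intros_logic pred_countable_Ball[OF cI] pred_intros_finite pred_intros_countable_bounded) measurable
  have B1: "sorted_list_of_set (jump_times rate (e \<omega>) F (t \<omega>)) = map (\<lambda>k. T k \<omega>) ks \<and> finite (jump_times rate (e \<omega>) F (t \<omega>))"
    if "B ks \<omega>" "ks \<in> lists I" for ks \<omega>
  proof -
    have "jump_times rate (e \<omega>) F (t \<omega>) = set (map (\<lambda>k. T k \<omega>) ks)"
      using that by (subst jt) (fastforce simp: B_def)+
    moreover have "sorted_wrt (<) (map (\<lambda>k. T k \<omega>) ks)"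
      using that(1) by (auto simp: B_def sorted_wrt_iff_nth_less)
    ultimately show ?thesis
      by (metis List.finite_set sorted_list_of_set.idem_if_sorted_distinct strict_sorted_iff)
  qed
  have B2: "\<exists>ks\<in>lists I. B ks \<omega>" if fin: "finite (jump_times rate (e \<omega>) F (t \<omega>))" for \<omega>
  proof -
    have nb: "\<not> (bad \<omega> \<and> 0 < t \<omega>)" using inf fin by blast
    let ?L = "sorted_list_of_set (jump_times rate (e \<omega>) F (t \<omega>))"
    have "\<forall>s\<in>set ?L. \<exists>k. k \<in> I \<and> act k \<omega> \<and> s = T k \<omega>"
      using fin jt[OF nb] by auto
    from bchoice[OF this] obtain h where h: "\<forall>s\<in>set ?L. h s \<in> I \<and> act (h s) \<omega> \<and> s = T (h s) \<omega>" by blast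
    let ?ks = "map h ?L"
    have TL: "map (\<lambda>k. T k \<omega>) ?ks = ?L" using h by (simp add: map_idI)
    have "sorted_wrt (<) (map (\<lambda>k. T k \<omega>) ?ks)" unfolding TL by simp
    hence "\<forall>i<length ?ks. \<forall>j<i. T (?ks ! j) \<omega> < T (?ks ! i) \<omega>"
      by (auto simp: sorted_wrt_iff_nth_less simp del: map_map)
    moreover have "\<exists>j\<in>set ?ks. T k \<omega> = T j \<omega>" if "k \<in> I" "act k \<omega>" for k
    proof -
      have "T k \<omega> \<in> set ?L" using jt[OF nb] that fin by auto
      thus ?thesis using h by auto
    qed
    ultimately have "B ?ks \<omega>" unfolding B_def using nb h by auto
    moreover have "?ks \<in> lists I" using h by auto
    ultimately show ?thesis by blast
  qed
  define G where "G ks \<omega> = fold (\<lambda>s. resolve cap (e \<omega>) (\<lambda>v. position rate (e \<omega>) v s)) (map (\<lambda>k. T k \<omega>) ks) (present F)" for ks \<omega>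
  have G_meas: "G ks \<in> measurable N (count_space UNIV)" for ks
  proof -
    have "(\<lambda>\<omega>. fold (\<lambda>s. resolve cap (e \<omega>) (\<lambda>v. position rate (e \<omega>) v s)) (map (\<lambda>s. s \<omega>) (map T ks)) (present F))
      \<in> measurable N (count_space {\<sigma>. supported F \<sigma>})"
      by (rule measurable_fold_resolve[OF F]) (auto simp: supported_def)
    hence "G ks \<in> measurable N (count_space {\<sigma>. supported F \<sigma>})"
      by (simp add: G_def[abs_def] comp_def)
    thus ?thesis using measurable_compose[of "G ks" N "count_space {\<sigma>. supported F \<sigma>}" "\<lambda>x. x" "count_space UNIV"] by simp
  qed
  define c :: "'v state" where "c = (\<lambda>v. None, UNIV)"
  have G: "finite_system rate cap (e \<omega>) F (t \<omega>) = G ks \<omega>" if "B ks \<omega>" "ks \<in> lists I" for ks \<omega>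
    using B1[OF that] by (simp add: finite_system_def G_def)
  have C: "finite_system rate cap (e \<omega>) F (t \<omega>) = c" if "\<forall>ks\<in>lists I. \<not> B ks \<omega>" for \<omega>
  proof -
    have "infinite (jump_times rate (e \<omega>) F (t \<omega>))" using B2 that by blast
    thus ?thesis by (simp add: finite_system_def c_def)
  qed
  have cl: "countable (lists I)" using cI by simp
  show ?thesis
  proof (rule measurableI)
    fix A
    have "(\<lambda>\<omega>. finite_system rate cap (e \<omega>) F (t \<omega>)) -` A \<inter> space N =
       {\<omega> \<in> space N. \<exists>ks\<in>lists I. B ks \<omega> \<and> G ks \<omega> \<in> A} \<union> {\<omega> \<in> space N. c \<in> A \<and> (\<forall>ks\<in>lists I. \<not> B ks \<omega>)}"
    proof (intro equalityI subsetI)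
      fix \<omega> assume *: "\<omega> \<in> (\<lambda>\<omega>. finite_system rate cap (e \<omega>) F (t \<omega>)) -` A \<inter> space N"
      show "\<omega> \<in> {\<omega> \<in> space N. \<exists>ks\<in>lists I. B ks \<omega> \<and> G ks \<omega> \<in> A} \<union> {\<omega> \<in> space N. c \<in> A \<and> (\<forall>ks\<in>lists I. \<not> B ks \<omega>)}"
      proof (cases "\<exists>ks\<in>lists I. B ks \<omega>")
        case True
        then obtain ks where "ks \<in> lists I" "B ks \<omega>" by blast
        thus ?thesis using * G[of ks \<omega>] by auto
      next
        case False
        thus ?thesis using * C[of \<omega>] by simp
      qed
    next
      fix \<omega> assume *: "\<omega> \<in> {\<omega> \<in> space N. \<exists>ks\<in>lists I. B ks \<omega> \<and> G ks \<omega> \<in> A} \<union> {\<omega> \<in> space N. c \<in> A \<and> (\<forall>ks\<in>lists I. \<not> B ks \<omega>)}"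
      show "\<omega> \<in> (\<lambda>\<omega>. finite_system rate cap (e \<omega>) F (t \<omega>)) -` A \<inter> space N"
      proof (cases "\<exists>ks\<in>lists I. B ks \<omega>")
        case True
        then obtain ks where "ks \<in> lists I" "B ks \<omega>" "G ks \<omega> \<in> A" "\<omega> \<in> space N" using * by blast
        thus ?thesis using G[of ks \<omega>] by simp
      next
        case False
        thus ?thesis using * C[of \<omega>] by simp
      qed
    qed
    also have "\<dots> \<in> sets N"
    proof (intro sets.Un)
      have "{\<omega> \<in> space N. B ks \<omega> \<and> G ks \<omega> \<in> A} \<in> sets N" for ks
      proof -
        have "{\<omega> \<in> space N. G ks \<omega> \<in> A} \<in> sets N" using measurable_sets[OF G_meas, of A] by (simp add: vimage_def Int_def conj_commute)
        moreover have "{\<omega> \<in> space N. B ks \<omega>} \<in> sets N" using B_meas[of ks] by (simp add: pred_def)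
        ultimately have "{\<omega> \<in> space N. B ks \<omega>} \<inter> {\<omega> \<in> space N. G ks \<omega> \<in> A} \<in> sets N" by blast
        also have "{\<omega> \<in> space N. B ks \<omega>} \<inter> {\<omega> \<in> space N. G ks \<omega> \<in> A} = {\<omega> \<in> space N. B ks \<omega> \<and> G ks \<omega> \<in> A}" by auto
        finally show ?thesis .
      qed
      thus "{\<omega> \<in> space N. \<exists>ks\<in>lists I. B ks \<omega> \<and> G ks \<omega> \<in> A} \<in> sets N"
        by (intro sets.sets_Collect_countable_Ex' cl)
      have "{\<omega> \<in> space N. \<forall>ks\<in>lists I. \<not> B ks \<omega>} \<in> sets N"
        by (intro sets.sets_Collect_countable_All' cl) measurable
      thus "{\<omega> \<in> space N. c \<in> A \<and> (\<forall>ks\<in>lists I. \<not> B ks \<omega>)} \<in> sets N"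
        by (cases "c \<in> A") simp_all
    qed
    finally show "(\<lambda>\<omega>. finite_system rate cap (e \<omega>) F (t \<omega>)) -` A \<inter> space N \<in> sets N" .
  qed simp
qed

text \<open>A countable set has only countably many finite subsets, so the filter statement is a
  countable union of countable intersections of events.\<close>

lemma pred_eventually_finite_subsets:
  assumes "\<And>F. finite F \<Longrightarrow> Measurable.pred N (\<lambda>\<omega>. Q \<omega> F)"
  shows "Measurable.pred N (\<lambda>\<omega>. \<forall>\<^sub>F F :: 'v set in finite_subsets_at_top UNIV. Q \<omega> F)"
proof -
  have c: "countable {X :: 'v set. finite X}"
    using countable_Collect_finite_subset[OF cnt] by simp
  have "Measurable.pred N (\<lambda>\<omega>. \<exists>X\<in>{X. finite X}. \<forall>Y\<in>{Y. finite Y \<and> X \<subseteq> Y}. Q \<omega> Y)"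
    using assms by (intro pred_countable_Bex pred_countable_Ball c) (auto intro: countable_subset[OF _ c])
  thus ?thesis by (simp add: eventually_finite_subsets_at_top)
qed

lemma pred_state:
  "finite F \<Longrightarrow> Measurable.pred N (\<lambda>\<omega>. fst (finite_system rate cap (e \<omega>) F (t \<omega>)) v = c)"
  by (rule measurable_compose[OF measurable_finite_system, of F "\<lambda>\<sigma>. fst \<sigma> v = c"]) auto

lemma pred_follows: "Measurable.pred N (\<lambda>\<omega>. follows rate cap (e \<omega>) (t \<omega>) v l)"
  unfolding follows_def by (intro pred_eventually_finite_subsets pred_state)

lemma pred_destroyed: "Measurable.pred N (\<lambda>\<omega>. destroyed rate cap (e \<omega>) (t \<omega>) v)"
  unfolding destroyed_def by (intro pred_eventually_finite_subsets pred_state)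

lemma measurable_xi: "(\<lambda>\<omega>. xi rate cap (e \<omega>) i (t \<omega>) x) \<in> measurable N (count_space UNIV)"
  unfolding xi_def
proof (rule measurable_card_countable[OF cnt])
  fix l
  have "(\<lambda>\<omega>. card {v. follows rate cap (e \<omega>) (t \<omega>) v l}) \<in> measurable N (count_space UNIV)"
    by (rule measurable_card_countable[OF cnt]) (use pred_follows in \<open>simp add: pred_def\<close>)
  moreover note [measurable] = measurable_position[OF time_meas] this
  show "{\<omega> \<in> space N. l \<in> {l. spec (e \<omega> l) = TypeA \<and> position rate (e \<omega>) l (t \<omega>) = x \<and>
        card {v. follows rate cap (e \<omega>) (t \<omega>) v l} = i}} \<in> sets N"
    by simp measurable
qed

end

lemma destroyed_mono: "destroyed rate cap e s v \<Longrightarrow> s \<le> t \<Longrightarrow> destroyed rate cap e t v"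
  unfolding destroyed_def
proof -
  assume *: "\<forall>\<^sub>F F in finite_subsets_at_top UNIV. fst (finite_system rate cap e F s) v = None" "s \<le> t"
  have "\<forall>\<^sub>F F in finite_subsets_at_top (UNIV :: 'a set). finite F"
    by (auto simp: eventually_finite_subsets_at_top)
  with *(1) show "\<forall>\<^sub>F F in finite_subsets_at_top UNIV. fst (finite_system rate cap e F t) v = None"
    by eventually_elim (rule finite_system_dead_mono[OF _ *(2)])
qed

text \<open>Destruction is monotone in time, so the infimum over uncountably many times is decided
  by the times \<open>t + 1 / real (Suc n)\<close>. They lie strictly beyond \<open>t\<close>
  because the strict inequality asks for survival during some time after \<open>t\<close>.\<close>

lemma lifespan_gt_iff:
  assumes "0 \<le> t"
  shows "ennreal t < lifespan rate cap e u \<longleftrightarrow> spec (e u) = TypeA \<and> (\<exists>n. \<not> destroyed rate cap e (t + 1 / real (Suc n)) u)"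
proof (cases "spec (e u)")
  case TypeB thus ?thesis by (simp add: lifespan_def)
next
  case TypeA
  let ?D = "{t. 0 \<le> t \<and> destroyed rate cap e t u}"
  have L: "lifespan rate cap e u = (INF t\<in>?D. ennreal t)" using TypeA by (simp add: lifespan_def)
  show ?thesis
  proof
    assume *: "ennreal t < lifespan rate cap e u"
    then obtain c where c: "ennreal t < c" "c < lifespan rate cap e u" using dense by blast
    then obtain r where r: "c = ennreal r" "0 \<le> r" 
      by (cases c rule: ennreal_cases) auto
    have "t < r" using c r assms by (simp add: ennreal_less_iff)
    then obtain n where n: "1 / real (Suc n) < r - t"
      using reals_Archimedean[of "r - t"] by (auto simp: inverse_eq_divide)
    have "\<not> destroyed rate cap e (t + 1 / real (Suc n)) u"
    proof
      assume "destroyed rate cap e (t + 1 / real (Suc n)) u"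
      hence "t + 1 / real (Suc n) \<in> ?D" using assms by simp
      hence "lifespan rate cap e u \<le> ennreal (t + 1 / real (Suc n))" unfolding L by (rule INF_lower)
      also have "\<dots> \<le> c" using n r by (simp add: ennreal_leI)
      finally show False using c(2) by simp
    qed
    thus "spec (e u) = TypeA \<and> (\<exists>n. \<not> destroyed rate cap e (t + 1 / real (Suc n)) u)" using TypeA by blast
  next
    assume "spec (e u) = TypeA \<and> (\<exists>n. \<not> destroyed rate cap e (t + 1 / real (Suc n)) u)"
    then obtain n where n: "\<not> destroyed rate cap e (t + 1 / real (Suc n)) u" by blast
    have "ennreal t < ennreal (t + 1 / real (Suc n))" using assms by (simp add: ennreal_less_iff)
    also have "\<dots> \<le> lifespan rate cap e u"
      unfolding L
    proof (rule INF_greatest)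
      fix s assume "s \<in> ?D"
      hence "\<not> s \<le> t + 1 / real (Suc n)" using n destroyed_mono[of rate cap e s u "t + 1 / real (Suc n)"] by (simp only: mem_Collect_eq) blast
      thus "ennreal (t + 1 / real (Suc n)) \<le> ennreal s" by (simp add: ennreal_leI)
    qed
    finally show "ennreal t < lifespan rate cap e u" .
  qed
qed

lemma (in measurable_env) pred_lifespan:
  assumes "\<And>\<omega>. 0 \<le> t \<omega>"
  shows "Measurable.pred N (\<lambda>\<omega>. ennreal (t \<omega>) < lifespan rate cap (e \<omega>) u)"
proof -
  interpret n: measurable_env N e "\<lambda>\<omega>. t \<omega> + 1 / real (Suc n)" rate cap for n
    by unfold_locales (auto simp: cnt rate_nonneg)
  note [measurable] = n.pred_destroyed
  show ?thesis unfolding lifespan_gt_iff[OF assms] by measurable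
qed

section \<open>Laws of the random ingredients\<close>

text \<open>Independence of a subfamily needs only distinct indices. It is applied to pairs of
  sites, to inverses of symmetries and to the particles of a chain.\<close>

lemma (in prob_space) indep_vars_reindex_inj:
  assumes X: "indep_vars M' X UNIV" and f: "inj_on f I"
  shows "indep_vars (\<lambda>j. M' (f j)) (\<lambda>j. X (f j)) I"
  unfolding indep_vars_def2
proof (intro conjI ballI)
  have rv: "random_variable (M' i) (X i)" for i using X by (auto simp: indep_vars_def2)
  show "random_variable (M' (f j)) (X (f j))" for j by (rule rv)
  show "indep_sets (\<lambda>j. {X (f j) -` A \<inter> space M |A. A \<in> sets (M' (f j))}) I"
  proof (rule indep_setsI)
    show "{X (f j) -` A \<inter> space M |A. A \<in> sets (M' (f j))} \<subseteq> events" for j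
      using measurable_sets[OF rv] by auto
  next
    fix A J assume J: "J \<noteq> {}" "J \<subseteq> I" "finite J" "\<forall>j\<in>J. A j \<in> {X (f j) -` A \<inter> space M |A. A \<in> sets (M' (f j))}"
    then obtain B where B: "\<And>j. j \<in> J \<Longrightarrow> A j = X (f j) -` B j \<inter> space M" "\<And>j. j \<in> J \<Longrightarrow> B j \<in> sets (M' (f j))"
      by (simp add: Bex_def) metis
    have fJ: "inj_on f J" using f J(2) by (rule inj_on_subset)
    define C where "C i = B (inv_into J f i)" for i
    have C: "C (f j) = B j" if "j \<in> J" for j using fJ that by (simp add: C_def)
    have "prob (\<Inter>i\<in>f ` J. X i -` C i \<inter> space M) = (\<Prod>i\<in>f ` J. prob (X i -` C i \<inter> space M))"
      by (rule indep_varsD[OF X]) (use J B C in auto)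
    also have "\<dots> = (\<Prod>j\<in>J. prob (X (f j) -` C (f j) \<inter> space M))"
      by (rule prod.reindex[OF fJ, unfolded comp_def])
    finally show "prob (\<Inter>j\<in>J. A j) = (\<Prod>j\<in>J. prob (A j))"
      using B J(1) by (simp add: C)
  qed
qed

section \<open>Cylinder sets and uniqueness of the walk law\<close>

definition cyl :: "'a list \<Rightarrow> (nat \<Rightarrow> 'a) set" where
  "cyl xs = {s. \<forall>i<length xs. s i = xs ! i}"

lemma space_path_space [simp]: "space path_space = UNIV"
  by (simp add: path_space_def space_PiM PiE_UNIV_domain)

text \<open>A condition on coordinate \<open>i\<close> is a union of cylinders given by the first
  \<open>Suc i\<close> values, a countable union because the state space is countable. The empty set
  is added to make the generator closed under intersection, as incompatible cylinders are
  disjoint.\<close>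

lemma sets_path_space_cyl:
  assumes "countable (UNIV :: 'a set)"
  shows "sets (path_space :: (nat \<Rightarrow> 'a) measure) = sigma_sets UNIV (insert {} (range cyl))"
proof (rule antisym)
  let ?E = "insert {} (range (cyl :: 'a list \<Rightarrow> _))"
  have "{f. f i \<in> A} \<in> sigma_sets UNIV ?E" for i and A :: "'a set"
  proof -
    define L where "L = {xs :: 'a list. length xs = Suc i \<and> xs ! i \<in> A}"
    have "countable L" unfolding L_def using countable_subset[OF _ countable_lists[OF assms]] by auto
    have "{f. f i \<in> A} = (\<Union>xs\<in>L. cyl xs)"
    proof (intro equalityI subsetI)
      fix f assume "f \<in> {f. f i \<in> A}"
      hence "map f [0..<Suc i] \<in> L" "f \<in> cyl (map f [0..<Suc i])"
        by (auto simp: L_def cyl_def nth_append simp del: upt_Suc)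
      thus "f \<in> (\<Union>xs\<in>L. cyl xs)" by blast
    qed (auto simp: L_def cyl_def)
    also have "\<dots> \<in> sigma_sets UNIV ?E"
      using \<open>countable L\<close> by (intro sigma_sets_UNION) (auto intro: sigma_sets.Basic)
    finally show ?thesis .
  qed
  hence "{{f \<in> \<Pi>\<^sub>E i\<in>UNIV. space (count_space UNIV). f i \<in> A} | i A. i \<in> UNIV \<and> A \<in> sets (count_space (UNIV :: 'a set))} 
      \<subseteq> sigma_sets UNIV ?E"
    by (auto simp: PiE_UNIV_domain)
  thus "sets (path_space :: (nat \<Rightarrow> 'a) measure) \<subseteq> sigma_sets UNIV ?E"
    unfolding path_space_def sets_PiM_single by (simp add: PiE_UNIV_domain sigma_sets_mono)
next
  have "cyl xs \<in> sets path_space" for xs :: "'a list"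
  proof -
    have "cyl xs = {s \<in> space path_space. \<forall>i<length xs. s i = xs ! i}" by (simp add: cyl_def)
    also have "\<dots> \<in> sets path_space" unfolding path_space_def by measurable
    finally show ?thesis .
  qed
  thus "sigma_sets UNIV (insert {} (range cyl)) \<subseteq> sets (path_space :: (nat \<Rightarrow> 'a) measure)"
    using sets.sigma_sets_subset[of "insert {} (range cyl)" path_space] by auto
qed

lemma cyl_Int: "\<exists>zs. cyl xs \<inter> cyl ys = cyl zs \<or> cyl xs \<inter> cyl ys = {}"
proof (cases "cyl xs \<inter> cyl ys = {}")
  case False
  then obtain s where s: "s \<in> cyl xs" "s \<in> cyl ys" by auto
  let ?n = "max (length xs) (length ys)"
  have "cyl xs \<inter> cyl ys = cyl (map s [0..<?n])"
    using s by (auto simp: cyl_def less_max_iff_disj)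
  thus ?thesis by blast
qed blast

text \<open>The probabilities in \<open>walk_law\<close> determine the measure on an
  intersection-stable generator. Uniqueness is needed because \<open>dlacs_randomness\<close> only
  provides some such law at each site, with no stated relation between sites.\<close>

lemma walk_law_unique:
  assumes cnt: "countable (UNIV :: 'v set)" and \<mu>: "walk_law K (x :: 'v) \<mu>" and \<nu>: "walk_law K x \<nu>"
  shows "\<mu> = \<nu>"
proof (rule measure_eqI_generator_eq[where \<Omega> = UNIV and E = "insert {} (range cyl)" and A = "\<lambda>_. UNIV"])
  show "Int_stable (insert {} (range (cyl :: 'v list \<Rightarrow> _)))"
  proof (rule Int_stableI)
    fix a b :: "(nat \<Rightarrow> 'v) set"
    assume ab: "a \<in> insert {} (range cyl)" "b \<in> insert {} (range cyl)"
    show "a \<inter> b \<in> insert {} (range cyl)"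
    proof (cases "a = {} \<or> b = {}")
      case False
      then obtain xs ys where "a = cyl xs" "b = cyl ys" using ab by blast
      thus ?thesis using cyl_Int[of xs ys] by auto
    qed auto
  qed
  have ps: "prob_space \<mu>" "prob_space \<nu>" and sets: "sets \<mu> = sets path_space" "sets \<nu> = sets path_space"
    using \<mu> \<nu> by (auto simp: walk_law_def)
  interpret m: prob_space \<mu> by fact
  interpret n: prob_space \<nu> by fact
  have sp: "space \<mu> = UNIV" "space \<nu> = UNIV" using sets_eq_imp_space_eq[OF sets(1)] sets_eq_imp_space_eq[OF sets(2)] by simp_all
  show "sets \<mu> = sigma_sets UNIV (insert {} (range cyl))" "sets \<nu> = sigma_sets UNIV (insert {} (range cyl))"
    using sets sets_path_space_cyl[OF cnt] by simp_all
  have "measure \<mu> (cyl xs) = measure \<nu> (cyl xs)" for xs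
  proof (cases xs)
    case Nil
    thus ?thesis using m.prob_space n.prob_space sp by (simp add: cyl_def)
  next
    case (Cons a ys)
    have "cyl xs = {s. \<forall>i\<le>length ys. s i = xs ! i}"
      using Cons by (auto simp: cyl_def less_Suc_eq_le)
    thus ?thesis using \<mu> \<nu> sp unfolding walk_law_def by simp
  qed
  thus "emeasure \<mu> X = emeasure \<nu> X" if "X \<in> insert {} (range cyl)" for X
    using that by (auto simp: m.emeasure_eq_measure n.emeasure_eq_measure)
  show "range (\<lambda>_ :: nat. UNIV) \<subseteq> insert {} (range cyl)" by (auto simp: cyl_def intro!: image_eqI[of _ _ "[]"])
  show "emeasure \<mu> UNIV \<noteq> \<infinity>" by simp
qed auto

lemma walk_law_map:
  assumes \<mu>: "walk_law K x \<mu>" and \<phi>: "bij \<phi>" "\<And>u v. K u v = K (\<phi> u) (\<phi> v)"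
  shows "walk_law K (\<phi> x) (distr \<mu> path_space (\<lambda>s. \<phi> \<circ> s))"
proof -
  have ps: "prob_space \<mu>" and sets [measurable_cong]: "sets \<mu> = sets path_space"
    using \<mu> by (auto simp: walk_law_def)
  interpret m: prob_space \<mu> by fact
  have sp: "space \<mu> = UNIV" using sets_eq_imp_space_eq[OF sets] by simp
  have meas: "(\<lambda>s. \<phi> \<circ> s) \<in> measurable \<mu> path_space"
    unfolding measurable_cong_sets[OF sets refl] unfolding path_space_def comp_def
    by (rule measurable_PiM_single')
      (auto simp: PiE_UNIV_domain intro!: measurable_compose[OF measurable_component_singleton])
  have "measure (distr \<mu> path_space (\<lambda>s. \<phi> \<circ> s)) {s. \<forall>i\<le>n. s i = y i} =
     (if y 0 = \<phi> x then \<Prod>i<n. K (y i) (y (Suc i)) else 0)" for n y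
  proof -
    have "{s. \<forall>i\<le>n. s i = y i} \<in> sets path_space"
    proof -
      have "{s \<in> space path_space. \<forall>i\<le>n. s i = y i} \<in> sets path_space" unfolding path_space_def by measurable
      thus ?thesis by simp
    qed
    hence "measure (distr \<mu> path_space (\<lambda>s. \<phi> \<circ> s)) {s. \<forall>i\<le>n. s i = y i} = measure \<mu> {s. \<forall>i\<le>n. (\<phi> \<circ> s) i = y i}"
      by (simp add: measure_distr[OF meas] sp vimage_def)
    also have "{s. \<forall>i\<le>n. (\<phi> \<circ> s) i = y i} = {s \<in> space \<mu>. \<forall>i\<le>n. s i = inverse_map \<phi> (y i)}"
      using \<phi>(1) sp by (simp add: bij_inv_eq_iff)
    also have "measure \<mu> \<dots> = (if inverse_map \<phi> (y 0) = x then \<Prod>i<n. K (inverse_map \<phi> (y i)) (inverse_map \<phi> (y (Suc i))) else 0)"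
      by (rule \<mu>[unfolded walk_law_def, THEN conjunct2, THEN conjunct2, rule_format, of n "\<lambda>i. inverse_map \<phi> (y i)"])
    also have "\<dots> = (if y 0 = \<phi> x then \<Prod>i<n. K (y i) (y (Suc i)) else 0)"
      using \<phi> by (auto simp: bij_is_inj bij_is_surj surj_f_inv_f \<phi>(2)[of "inverse_map \<phi> _"])
    finally show ?thesis .
  qed
  moreover have "prob_space (distr \<mu> path_space (\<lambda>s. \<phi> \<circ> s))" by (rule m.prob_space_distr[OF meas])
  ultimately show ?thesis unfolding walk_law_def by simp
qed

section \<open>Sums of independent exponential waiting times\<close>

abbreviation "exp1 \<equiv> density lborel (\<lambda>s. ennreal (exponential_density 1 s))"

lemma prob_exp1: "prob_space exp1" by (rule prob_space_exponential_density) simp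

lemma sets_wait_law [measurable_cong]: "sets wait_law = sets (PiM UNIV (\<lambda>_. borel))"
  unfolding wait_law_def by (intro sets_PiM_cong) auto

lemma prob_wait_law: "prob_space wait_law"
  unfolding wait_law_def by (intro prob_space_PiM prob_exp1)

lemma distr_wait_component: "distr wait_law exp1 (\<lambda>w. w n) = exp1"
  unfolding wait_law_def by (intro distr_PiM_component prob_exp1) simp

lemma indep_wait: "prob_space.indep_vars wait_law (\<lambda>_. exp1) (\<lambda>n w. w n) UNIV"
proof -
  interpret W: prob_space wait_law by (rule prob_wait_law)
  have rv: "(\<lambda>w. w n) \<in> measurable wait_law exp1" for n
    unfolding wait_law_def by simp
  have "distr wait_law (PiM UNIV (\<lambda>_. exp1)) (\<lambda>w. \<lambda>n\<in>UNIV. w n) = wait_law"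
    unfolding wait_law_def by (simp add: restrict_UNIV distr_id2)
  also have "\<dots> = (\<Pi>\<^sub>M n\<in>UNIV. distr wait_law exp1 (\<lambda>w. w n))"
    unfolding distr_wait_component by (simp add: wait_law_def)
  finally show ?thesis using W.indep_vars_iff_distr_eq_PiM'[of UNIV "\<lambda>n w. w n" "\<lambda>_. exp1"] rv by simp
qed

lemma AE_exp1_pos: "AE s in exp1. 0 < s"
proof -
  have "AE s in lborel. s \<noteq> (0 :: real)" by (rule AE_lborel_singleton)
  hence "AE s in lborel. 0 < ennreal (exponential_density 1 s) \<longrightarrow> 0 < s"
    by eventually_elim (auto simp: erlang_density_def)
  thus ?thesis by (subst AE_density) auto
qed

lemma AE_wait_pos: "AE w in wait_law. \<forall>n. 0 < w n"
  unfolding AE_all_countable wait_law_def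
  by (intro allI AE_PiM_component prob_exp1 AE_exp1_pos) auto

text \<open>The Laplace transform of the exponential law at 7, that is \<open>1 / (1 + 7)\<close>:
  tilting the density of rate 1 by \<open>exp (- 7 * s)\<close> gives one eighth of the density of
  rate 8.\<close>

lemma nn_integral_exp1: "(\<integral>\<^sup>+s. ennreal (exp (- 7 * s)) \<partial>exp1) = ennreal (1 / 8)"
proof -
  interpret E: prob_space "density lborel (\<lambda>s. ennreal (exponential_density 8 s))"
    by (rule prob_space_exponential_density) simp
  have "(\<integral>\<^sup>+s. ennreal (exp (- 7 * s)) \<partial>exp1) = (\<integral>\<^sup>+s. ennreal (exponential_density 1 s) * ennreal (exp (- 7 * s)) \<partial>lborel)"
    by (rule nn_integral_density) auto
  also have "\<dots> = (\<integral>\<^sup>+s. ennreal (1 / 8) * ennreal (exponential_density 8 s) \<partial>lborel)"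
    by (intro nn_integral_cong) (auto simp: erlang_density_def ennreal_mult[symmetric] exp_add[symmetric] algebra_simps)
  also have "\<dots> = ennreal (1 / 8) * (\<integral>\<^sup>+s. ennreal (exponential_density 8 s) \<partial>lborel)"
    by (rule nn_integral_cmult) auto
  also have "(\<integral>\<^sup>+s. ennreal (exponential_density 8 s) \<partial>lborel) = 1"
    using E.emeasure_space_1 by (simp add: emeasure_density)
  finally show ?thesis by simp
qed

text \<open>The exponent 7 makes the tail decay like \<open>8\<^sup>-\<^sup>n\<close>, which beats the growth of \<open>4\<^sup>n \<ge> (n + 1)\<^sup>2\<close>.\<close>

lemma wait_sum_tail:
  "emeasure wait_law {w \<in> space wait_law. (\<Sum>k\<le>n. w k) \<le> C} \<le> ennreal (exp (7 * C)) * ennreal (1 / 8) ^ Suc n"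
proof -
  interpret W: prob_space wait_law by (rule prob_wait_law)
  have "emeasure wait_law {w \<in> space wait_law. (\<Sum>k\<le>n. w k) \<le> C} = 
      (\<integral>\<^sup>+w. indicator {w \<in> space wait_law. (\<Sum>k\<le>n. w k) \<le> C} w \<partial>wait_law)"
    by (subst nn_integral_indicator) auto
  \<comment> \<open>Exponential Markov inequality: on the event, \<open>exp (7 * C)\<close> times
    the product of the factors \<open>exp (- 7 * w k)\<close> is at least 1.\<close>
  also have "\<dots> \<le> (\<integral>\<^sup>+w. ennreal (exp (7 * C)) * ennreal (\<Prod>k\<le>n. exp (- 7 * w k)) \<partial>wait_law)"
  proof (intro nn_integral_mono)
    fix w :: "nat \<Rightarrow> real"
    have "1 \<le> exp (7 * C) * (\<Prod>k\<le>n. exp (- 7 * w k))" if "(\<Sum>k\<le>n. w k) \<le> C"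
    proof -
      have "exp (7 * C) * (\<Prod>k\<le>n. exp (- 7 * w k)) = exp (7 * (C - (\<Sum>k\<le>n. w k)))"
        by (simp add: exp_sum[symmetric] exp_add[symmetric] sum_negf sum_distrib_left right_diff_distrib)
      thus ?thesis using that by simp
    qed
    thus "indicator {w \<in> space wait_law. (\<Sum>k\<le>n. w k) \<le> C} w \<le> ennreal (exp (7 * C)) * ennreal (\<Prod>k\<le>n. exp (- 7 * w k))"
      by (auto simp: indicator_def ennreal_mult[symmetric] prod_nonneg)
  qed
  also have "\<dots> = ennreal (exp (7 * C)) * (\<integral>\<^sup>+w. ennreal (\<Prod>k\<le>n. exp (- 7 * w k)) \<partial>wait_law)"
    by (rule nn_integral_cmult) measurable
  also have "(\<integral>\<^sup>+w. ennreal (\<Prod>k\<le>n. exp (- 7 * w k)) \<partial>wait_law) = (\<integral>\<^sup>+w. (\<Prod>k\<le>n. ennreal (exp (- 7 * w k))) \<partial>wait_law)"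
    by (simp add: prod_ennreal)
  also have "\<dots> = (\<Prod>k\<le>n. \<integral>\<^sup>+w. ennreal (exp (- 7 * w k)) \<partial>wait_law)"
  proof (rule W.indep_vars_nn_integral)
    have "W.indep_vars (\<lambda>_. borel) (\<lambda>i w. ennreal (exp (- 7 * w i))) UNIV"
      by (rule W.indep_vars_compose2[OF indep_wait]) auto
    thus "W.indep_vars (\<lambda>_. borel) (\<lambda>i w. ennreal (exp (- 7 * w i))) {..n}" by (rule W.indep_vars_subset) simp
  qed auto
  also have "\<dots> = (\<Prod>k\<le>n. ennreal (1 / 8))"
  proof (intro prod.cong refl)
    fix k
    have "(\<integral>\<^sup>+w. ennreal (exp (- 7 * w k)) \<partial>wait_law) = (\<integral>\<^sup>+s. ennreal (exp (- 7 * s)) \<partial>distr wait_law exp1 (\<lambda>w. w k))"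
      by (subst nn_integral_distr) (auto simp: wait_law_def)
    thus "(\<integral>\<^sup>+w. ennreal (exp (- 7 * w k)) \<partial>wait_law) = ennreal (1 / 8)"
      unfolding distr_wait_component nn_integral_exp1 .
  qed
  finally show ?thesis by simp
qed

text \<open>The sum has an Erlang density and hence no atoms. This excludes a jump exactly at a
  prescribed time.\<close>

lemma AE_wait_sum_neq: "AE w in wait_law. (\<Sum>k\<le>n. w k) \<noteq> c"
proof -
  interpret W: prob_space wait_law by (rule prob_wait_law)
  have "distributed wait_law lborel (\<lambda>w. \<Sum>k\<in>{..n}. w k) (erlang_density (card {..n} - 1) 1)"
  proof (rule W.exponential_distributed_sum)
    fix i
    have "distr wait_law lborel (\<lambda>w. w i) = distr wait_law exp1 (\<lambda>w. w i)"
      by (rule distr_cong) auto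
    thus "distributed wait_law lborel (\<lambda>w. w i) (exponential_density 1)"
      unfolding distributed_def distr_wait_component by auto
    show "W.indep_vars (\<lambda>i. borel) (\<lambda>i w. w i) {..n}"
    proof -
      have "W.indep_vars (\<lambda>_. borel) (\<lambda>i w. w i) UNIV"
        by (rule W.indep_vars_compose2[OF indep_wait]) simp
      thus ?thesis by (rule W.indep_vars_subset) simp
    qed
  qed auto
  hence D: "distr wait_law lborel (\<lambda>w. \<Sum>k\<le>n. w k) = density lborel (\<lambda>x. ennreal (erlang_density n 1 x))"
    by (simp add: distributed_def)
  have "AE x in density lborel (\<lambda>x. ennreal (erlang_density n 1 x)). x \<noteq> c"
    using AE_lborel_singleton[of c] by (subst AE_density) (auto elim: eventually_mono)
  from AE_distrD[OF _ this[folded D]] show ?thesis by simp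
qed

lemma sets_bravery_law [measurable_cong]: "sets bravery_law = sets borel"
  by (simp add: bravery_law_def)

lemma prob_bravery_law: "prob_space bravery_law"
  unfolding bravery_law_def by (rule prob_space_uniform_measure) auto

lemma AE_bravery_neq: "AE b in bravery_law. b \<noteq> c"
  unfolding bravery_law_def using AE_lborel_singleton[of c]
  by (intro AE_uniform_measureI) (auto elim: eventually_mono)

lemma measurable_wait_fun [measurable]: "wait \<in> measurable particle_space (PiM UNIV (\<lambda>_. borel))"
  unfolding wait_def[abs_def] particle_space_def by measurable

lemma measurable_walk_fun [measurable]: "walk \<in> measurable particle_space path_space"
  unfolding walk_def[abs_def] particle_space_def by measurable

lemma measurable_comp_path [measurable]: "(\<lambda>s. \<phi> \<circ> s) \<in> measurable path_space path_space"
  unfolding path_space_def comp_def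
  by (rule measurable_PiM_single')
    (auto simp: PiE_UNIV_domain intro!: measurable_compose[OF measurable_component_singleton])

lemma measurable_relabel_particle [measurable]: "relabel_particle \<phi> \<in> measurable particle_space particle_space"
proof -
  have "(\<lambda>q. (spec q, \<phi> \<circ> walk q, wait q, bravery q)) \<in>
    measurable particle_space (count_space UNIV \<Otimes>\<^sub>M path_space \<Otimes>\<^sub>M PiM UNIV (\<lambda>_. borel) \<Otimes>\<^sub>M borel)"
    by (intro measurable_Pair measurable_compose[OF measurable_walk_fun measurable_comp_path]) measurable
  thus ?thesis unfolding particle_space_def relabel_particle_def[abs_def] .
qed

abbreviation "env_space \<equiv> PiM UNIV (\<lambda>_ :: 'v. particle_space :: 'v particle measure)"

section \<open>The random environment and its invariance under the symmetries\<close>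

locale dlacs =
  fixes adj :: "'v \<Rightarrow> 'v \<Rightarrow> bool" and K :: "'v \<Rightarrow> 'v \<Rightarrow> real" and \<Gamma> :: "('v \<Rightarrow> 'v) set"
    and rate :: "species \<Rightarrow> real" and cap :: "species \<Rightarrow> enat" and p :: real
    and P :: "'w measure" and \<eta> :: "'v \<Rightarrow> 'w \<Rightarrow> 'v particle"
  assumes graph: "simple_lf_connected_graph adj"
    and subgroup: "subgroup \<Gamma> (Aut_K adj K)"
    and transitive: "transitive_on \<Gamma>"
    and unimodular: "unimodular_on \<Gamma>"
    and rates: "0 < rate TypeA" "0 \<le> rate TypeB"
    and random: "dlacs_randomness K p P \<eta>"
begin

abbreviation env :: "'w \<Rightarrow> 'v \<Rightarrow> 'v particle" where "env \<omega> \<equiv> \<lambda>x. \<eta> x \<omega>"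

sublocale prob_space P
  using random by (simp add: dlacs_randomness_def)

lemma cnt: "countable (UNIV :: 'v set)"
  using graph by (rule countable_graph)

lemma rate_nonneg: "0 \<le> rate s"
  using rates by (cases s) auto

lemma transport:
  assumes "\<And>\<phi> u v. \<phi> \<in> \<Gamma> \<Longrightarrow> f (\<phi> u) (\<phi> v) = (f u v :: ennreal)"
  shows "(\<integral>\<^sup>+v. f v x \<partial>count_space UNIV) = (\<integral>\<^sup>+v. f x v \<partial>count_space UNIV)"
  using mass_transport[OF subgroup transitive unimodular cnt, of f x] assms by simp

lemma bij_sym: "\<phi> \<in> \<Gamma> \<Longrightarrow> bij \<phi>" and kernel_sym: "\<phi> \<in> \<Gamma> \<Longrightarrow> K u v = K (\<phi> u) (\<phi> v)"
  using Aut_K_D[OF subgroup] by blast+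

lemma indep: "indep_vars (\<lambda>_. particle_space) \<eta> UNIV"
  using random by (simp add: dlacs_randomness_def)

lemma eta_meas [measurable]: "\<eta> x \<in> measurable P particle_space"
  using indep by (simp add: indep_vars_def)

lemma env_meas [measurable]: "env \<in> measurable P env_space"
  by (rule measurable_PiM_single') (auto simp: PiE_UNIV_domain dest: measurable_space[OF eta_meas])

definition walk_measure :: "'v \<Rightarrow> (nat \<Rightarrow> 'v) measure" where
  "walk_measure x = (SOME \<mu>. walk_law K x \<mu> \<and>
     distr P particle_space (\<eta> x) = species_law p \<Otimes>\<^sub>M \<mu> \<Otimes>\<^sub>M wait_law \<Otimes>\<^sub>M bravery_law)"

lemma walk_measure: "walk_law K x (walk_measure x)"
  and law: "distr P particle_space (\<eta> x) = species_law p \<Otimes>\<^sub>M walk_measure x \<Otimes>\<^sub>M wait_law \<Otimes>\<^sub>M bravery_law"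
proof -
  have "\<exists>\<mu>. walk_law K x \<mu> \<and> distr P particle_space (\<eta> x) = species_law p \<Otimes>\<^sub>M \<mu> \<Otimes>\<^sub>M wait_law \<Otimes>\<^sub>M bravery_law"
    using random by (simp add: dlacs_randomness_def)
  from someI_ex[OF this] show "walk_law K x (walk_measure x)"
    "distr P particle_space (\<eta> x) = species_law p \<Otimes>\<^sub>M walk_measure x \<Otimes>\<^sub>M wait_law \<Otimes>\<^sub>M bravery_law"
    unfolding walk_measure_def by blast+
qed

lemma prob_walk_measure: "prob_space (walk_measure x)"
  and sets_walk_measure [measurable_cong]: "sets (walk_measure x) = sets path_space"
  using walk_measure by (auto simp: walk_law_def)

text \<open>Tonelli for the product law of one particle. A function of a single component then
  yields the marginal law, since the other factors have mass 1.\<close>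

lemma nn_integral_particle:
  assumes f: "f \<in> borel_measurable particle_space"
  shows "(\<integral>\<^sup>+\<omega>. f (\<eta> x \<omega>) \<partial>P) = (\<integral>\<^sup>+s. \<integral>\<^sup>+y. \<integral>\<^sup>+w. \<integral>\<^sup>+b. f (s, y, w, b) \<partial>bravery_law \<partial>wait_law \<partial>walk_measure x \<partial>species_law p)"
proof -
  interpret B: prob_space bravery_law by (rule prob_bravery_law)
  interpret W: prob_space wait_law by (rule prob_wait_law)
  interpret M: prob_space "walk_measure x" by (rule prob_walk_measure)
  interpret WB: pair_prob_space wait_law bravery_law ..
  interpret MWB: pair_prob_space "walk_measure x" "wait_law \<Otimes>\<^sub>M bravery_law" ..
  have [measurable_cong]: "sets (species_law p) = sets (count_space UNIV)" by (simp add: species_law_def)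
  have [measurable_cong]: "sets (particle_space :: 'v particle measure) = sets (species_law p \<Otimes>\<^sub>M walk_measure x \<Otimes>\<^sub>M wait_law \<Otimes>\<^sub>M bravery_law)"
    using law[of x] by (metis sets_distr)
  have f1: "f \<in> borel_measurable (species_law p \<Otimes>\<^sub>M walk_measure x \<Otimes>\<^sub>M wait_law \<Otimes>\<^sub>M bravery_law)"
    using f by measurable
  have f2: "(\<lambda>z. f (s, z)) \<in> borel_measurable (walk_measure x \<Otimes>\<^sub>M wait_law \<Otimes>\<^sub>M bravery_law)" for s
    by (rule measurable_compose[OF _ f1]) (simp add: species_law_def)
  have f3: "(\<lambda>z. f (s, y, z)) \<in> borel_measurable (wait_law \<Otimes>\<^sub>M bravery_law)" for s y
    by (rule measurable_compose[OF _ f2]) (use sets_eq_imp_space_eq[OF sets_walk_measure] in simp)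
  have "(\<integral>\<^sup>+\<omega>. f (\<eta> x \<omega>) \<partial>P) = (\<integral>\<^sup>+q. f q \<partial>distr P particle_space (\<eta> x))"
    using f by (simp add: nn_integral_distr)
  also have "\<dots> = (\<integral>\<^sup>+q. f q \<partial>(species_law p \<Otimes>\<^sub>M walk_measure x \<Otimes>\<^sub>M wait_law \<Otimes>\<^sub>M bravery_law))"
    unfolding law ..
  also have "\<dots> = (\<integral>\<^sup>+s. \<integral>\<^sup>+z. f (s, z) \<partial>(walk_measure x \<Otimes>\<^sub>M wait_law \<Otimes>\<^sub>M bravery_law) \<partial>species_law p)"
    using f1 by (rule MWB.P.nn_integral_fst[symmetric])
  also have "\<dots> = (\<integral>\<^sup>+s. \<integral>\<^sup>+y. \<integral>\<^sup>+z. f (s, y, z) \<partial>(wait_law \<Otimes>\<^sub>M bravery_law) \<partial>walk_measure x \<partial>species_law p)"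
    by (intro nn_integral_cong WB.P.nn_integral_fst[symmetric] f2)
  also have "\<dots> = (\<integral>\<^sup>+s. \<integral>\<^sup>+y. \<integral>\<^sup>+w. \<integral>\<^sup>+b. f (s, y, w, b) \<partial>bravery_law \<partial>wait_law \<partial>walk_measure x \<partial>species_law p)"
    by (intro nn_integral_cong B.nn_integral_fst[symmetric] f3)
  finally show ?thesis .
qed

lemma prob_species_law: "prob_space (species_law p)"
  unfolding species_law_def by (rule prob_space_measure_pmf)

lemma distr_wait: "distr P (PiM UNIV (\<lambda>_. borel)) (\<lambda>\<omega>. wait (\<eta> x \<omega>)) = wait_law"
proof (rule measure_eqI)
  interpret B: prob_space bravery_law by (rule prob_bravery_law)
  interpret M: prob_space "walk_measure x" by (rule prob_walk_measure)
  interpret S: prob_space "species_law p" by (rule prob_species_law)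
  show "sets (distr P (PiM UNIV (\<lambda>_. borel)) (\<lambda>\<omega>. wait (\<eta> x \<omega>))) = sets wait_law" by (simp add: sets_wait_law)
  fix A assume "A \<in> sets (distr P (PiM UNIV (\<lambda>_. borel)) (\<lambda>\<omega>. wait (\<eta> x \<omega>)))"
  hence [measurable]: "A \<in> sets (PiM UNIV (\<lambda>_. borel))" by simp
  have f: "(\<lambda>q. indicator A (wait q) :: ennreal) \<in> borel_measurable particle_space" by measurable
  have "emeasure (distr P (PiM UNIV (\<lambda>_. borel)) (\<lambda>\<omega>. wait (\<eta> x \<omega>))) A = (\<integral>\<^sup>+\<omega>. indicator A (wait (\<eta> x \<omega>)) \<partial>P)"
    by (subst nn_integral_indicator[symmetric], simp, subst nn_integral_distr) auto
  also have "\<dots> = (\<integral>\<^sup>+w. indicator A w \<partial>wait_law)"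
    unfolding nn_integral_particle[OF f] by (simp add: wait_def B.emeasure_space_1 M.emeasure_space_1 S.emeasure_space_1)
  also have "\<dots> = emeasure wait_law A" by simp
  finally show "emeasure (distr P (PiM UNIV (\<lambda>_. borel)) (\<lambda>\<omega>. wait (\<eta> x \<omega>))) A = emeasure wait_law A" .
qed

lemma distr_walk: "distr P path_space (\<lambda>\<omega>. walk (\<eta> x \<omega>)) = walk_measure x"
proof (rule measure_eqI)
  interpret B: prob_space bravery_law by (rule prob_bravery_law)
  interpret W: prob_space wait_law by (rule prob_wait_law)
  interpret S: prob_space "species_law p" by (rule prob_species_law)
  show "sets (distr P path_space (\<lambda>\<omega>. walk (\<eta> x \<omega>))) = sets (walk_measure x)" by (simp add: sets_walk_measure)
  fix A assume "A \<in> sets (distr P path_space (\<lambda>\<omega>. walk (\<eta> x \<omega>)))"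
  hence [measurable]: "A \<in> sets path_space" by simp
  have f: "(\<lambda>q. indicator A (walk q) :: ennreal) \<in> borel_measurable particle_space" by measurable
  have "emeasure (distr P path_space (\<lambda>\<omega>. walk (\<eta> x \<omega>))) A = (\<integral>\<^sup>+\<omega>. indicator A (walk (\<eta> x \<omega>)) \<partial>P)"
    by (subst nn_integral_indicator[symmetric], simp, subst nn_integral_distr) auto
  also have "\<dots> = (\<integral>\<^sup>+w. indicator A w \<partial>walk_measure x)"
    unfolding nn_integral_particle[OF f] by (simp add: walk_def B.emeasure_space_1 W.emeasure_space_1 S.emeasure_space_1)
  also have "\<dots> = emeasure (walk_measure x) A" by simp
  finally show "emeasure (distr P path_space (\<lambda>\<omega>. walk (\<eta> x \<omega>))) A = emeasure (walk_measure x) A" .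
qed

lemma distr_bravery: "distr P borel (\<lambda>\<omega>. bravery (\<eta> x \<omega>)) = bravery_law"
proof (rule measure_eqI)
  interpret W: prob_space wait_law by (rule prob_wait_law)
  interpret M: prob_space "walk_measure x" by (rule prob_walk_measure)
  interpret S: prob_space "species_law p" by (rule prob_species_law)
  show "sets (distr P borel (\<lambda>\<omega>. bravery (\<eta> x \<omega>))) = sets bravery_law" by (simp add: sets_bravery_law)
  fix A assume "A \<in> sets (distr P borel (\<lambda>\<omega>. bravery (\<eta> x \<omega>)))"
  hence [measurable]: "A \<in> sets borel" by simp
  have f: "(\<lambda>q. indicator A (bravery q) :: ennreal) \<in> borel_measurable particle_space" by measurable
  have "emeasure (distr P borel (\<lambda>\<omega>. bravery (\<eta> x \<omega>))) A = (\<integral>\<^sup>+\<omega>. indicator A (bravery (\<eta> x \<omega>)) \<partial>P)"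
    by (subst nn_integral_indicator[symmetric], simp, subst nn_integral_distr) auto
  also have "\<dots> = (\<integral>\<^sup>+w. indicator A w \<partial>bravery_law)"
    unfolding nn_integral_particle[OF f] by (simp add: bravery_def W.emeasure_space_1 M.emeasure_space_1 S.emeasure_space_1)
  also have "\<dots> = emeasure bravery_law A" by simp
  finally show "emeasure (distr P borel (\<lambda>\<omega>. bravery (\<eta> x \<omega>))) A = emeasure bravery_law A" .
qed

lemma AE_wait:
  assumes "AE w in wait_law. R w" shows "AE \<omega> in P. R (wait (\<eta> x \<omega>))"
  using assms[folded distr_wait[of x]] by (rule AE_distrD[rotated]) measurable

lemma AE_walk_start: "AE \<omega> in P. walk (\<eta> x \<omega>) 0 = x"
proof -
  interpret M: prob_space "walk_measure x" by (rule prob_walk_measure)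
  have "M.prob {s \<in> space (walk_measure x). \<forall>i\<le>0. s i = x} = 1"
    using walk_measure[of x, unfolded walk_law_def, THEN conjunct2, THEN conjunct2, rule_format, of 0 "\<lambda>_. x"] by simp
  moreover have "{s \<in> space (walk_measure x). \<forall>i\<le>0. s i = x} \<in> M.events"
    unfolding path_space_def by (measurable, simp_all add: sets_walk_measure path_space_def)
  ultimately have "AE s in walk_measure x. s \<in> {s \<in> space (walk_measure x). \<forall>i\<le>0. s i = x}"
    using M.prob_eq_1 by blast
  hence "AE s in walk_measure x. s 0 = x" by eventually_elim auto
  from this[folded distr_walk] show ?thesis by (rule AE_distrD[rotated]) measurable
qed

text \<open>The joint law is a product, so it is enough that one bravery avoids each fixed value of
  the other, which holds because the uniform law has no atoms.\<close>

lemma AE_bravery_distinct: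
  assumes "u \<noteq> v" shows "AE \<omega> in P. bravery (\<eta> u \<omega>) \<noteq> bravery (\<eta> v \<omega>)"
proof -
  interpret B: prob_space bravery_law by (rule prob_bravery_law)
  interpret BB: pair_prob_space bravery_law bravery_law ..
  \<comment> \<open>\<open>indep_var\<close> is independence of a family indexed by
    \<open>bool\<close>, so the two sites are named by truth values.\<close>
  let ?f = "\<lambda>b. if b then u else v"
  have "indep_vars (\<lambda>_. particle_space) (\<lambda>b. \<eta> (?f b)) UNIV"
    using indep_vars_reindex_inj[OF indep, of ?f UNIV] assms by (auto simp: inj_on_def)
  hence "indep_vars (\<lambda>_. borel) (\<lambda>b \<omega>. bravery (\<eta> (?f b) \<omega>)) UNIV"
    by (rule indep_vars_compose2) measurable
  hence "indep_var borel (\<lambda>\<omega>. bravery (\<eta> u \<omega>)) borel (\<lambda>\<omega>. bravery (\<eta> v \<omega>))"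
    unfolding indep_var_def
    by (rule indep_vars_cong[THEN iffD1, rotated 3]) (auto split: bool.split)
  hence J: "distr P (borel \<Otimes>\<^sub>M borel) (\<lambda>\<omega>. (bravery (\<eta> u \<omega>), bravery (\<eta> v \<omega>))) = bravery_law \<Otimes>\<^sub>M bravery_law"
    unfolding indep_var_distribution_eq distr_bravery by simp
  have "AE z in bravery_law \<Otimes>\<^sub>M bravery_law. fst z \<noteq> snd z"
    by (rule BB.AE_pair_measure) (use AE_bravery_neq in \<open>auto simp: eq_commute\<close>)
  from this[folded J] have "AE \<omega> in P. fst (bravery (\<eta> u \<omega>), bravery (\<eta> v \<omega>)) \<noteq> snd (bravery (\<eta> u \<omega>), bravery (\<eta> v \<omega>))"
    by (rule AE_distrD[rotated]) measurable
  thus ?thesis by simp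
qed

text \<open>The event that all partial sums stay below \<open>c\<close> lies in every event bounded
  by \<open>wait_sum_tail\<close>, and these bounds tend to 0.\<close>

lemma AE_wait_diverges: "AE w in wait_law. \<forall>c :: nat. \<exists>n. real c < (\<Sum>k\<le>n. w k)"
  unfolding AE_all_countable
proof
  fix c :: nat
  interpret W: prob_space wait_law by (rule prob_wait_law)
  let ?A = "{w \<in> space wait_law. \<forall>n. (\<Sum>k\<le>n. w k) \<le> real c}"
  have A: "?A \<in> W.events" by measurable
  have "emeasure wait_law ?A \<le> ennreal (exp (7 * real c) * (1 / 8) ^ Suc n)" for n
  proof -
    have "emeasure wait_law ?A \<le> emeasure wait_law {w \<in> space wait_law. (\<Sum>k\<le>n. w k) \<le> real c}"
      by (rule emeasure_mono) auto
    also have "\<dots> \<le> ennreal (exp (7 * real c)) * ennreal (1 / 8) ^ Suc n" by (rule wait_sum_tail)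
    finally show ?thesis by (simp add: ennreal_mult ennreal_power del: power_Suc)
  qed
  moreover have "(\<lambda>n. ennreal (exp (7 * real c) * (1 / 8) ^ Suc n)) \<longlonglongrightarrow> ennreal (exp (7 * real c) * 0)"
    by (intro tendsto_intros tendsto_ennrealI LIMSEQ_Suc LIMSEQ_realpow_zero) auto
  ultimately have "emeasure wait_law ?A \<le> ennreal (exp (7 * real c) * 0)"
    by (intro LIMSEQ_le_const) auto
  hence "?A \<in> null_sets wait_law" using A by (simp add: null_sets_def)
  hence "AE w in wait_law. w \<notin> ?A" by (rule AE_not_in)
  moreover have "AE w in wait_law. w \<in> space wait_law" by simp
  ultimately show "AE w in wait_law. \<exists>n. real c < (\<Sum>k\<le>n. w k)"
    by eventually_elim (auto simp: not_le)
qed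

lemma AE_regular: "AE \<omega> in P. regular (env \<omega>)"
proof -
  have "AE \<omega> in P. \<forall>z\<in>{z. fst z \<noteq> snd z}. bravery (\<eta> (fst z) \<omega>) \<noteq> bravery (\<eta> (snd z) \<omega>)"
    by (subst AE_ball_countable) 
      (use countable_subset[OF subset_UNIV, of "UNIV :: ('v \<times> 'v) set"] cnt AE_bravery_distinct in
        \<open>auto simp: UNIV_Times_UNIV[symmetric] simp del: UNIV_Times_UNIV intro: countable_subset[OF subset_UNIV]\<close>)
  moreover have "AE \<omega> in P. \<forall>v\<in>UNIV. walk (\<eta> v \<omega>) 0 = v \<and> (\<forall>n. 0 < wait (\<eta> v \<omega>) n) \<and>
     (\<forall>c :: nat. \<exists>n. real c < (\<Sum>k\<le>n. wait (\<eta> v \<omega>) k))"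
    by (subst AE_ball_countable[OF cnt]) 
      (intro ballI AE_conjI AE_walk_start AE_wait[OF AE_wait_pos] AE_wait[OF AE_wait_diverges])
  ultimately show ?thesis
  proof eventually_elim
    case (elim \<omega>)
    have "finite {n. ring (\<eta> v \<omega>) n \<le> c}" for v c
    proof -
      obtain n where n: "real (nat \<lceil>c\<rceil>) < (\<Sum>k\<le>n. wait (\<eta> v \<omega>) k)" using elim(2) by blast
      have "m < n" if "ring (\<eta> v \<omega>) m \<le> c" for m
      proof (rule ccontr)
        assume "\<not> m < n"
        hence "(\<Sum>k\<le>n. wait (\<eta> v \<omega>) k) \<le> (\<Sum>k\<le>m. wait (\<eta> v \<omega>) k)"
          using elim(2) by (intro sum_mono2) (auto simp: less_imp_le)
        thus False using n that real_nat_ceiling_ge[of c] unfolding ring_def by linarith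
      qed
      hence "{m. ring (\<eta> v \<omega>) m \<le> c} \<subseteq> {..<n}" by blast
      thus ?thesis by (rule finite_subset) simp
    qed
    moreover have "inj (\<lambda>v. bravery (\<eta> v \<omega>))"
      
    proof (rule injI)
      fix u v assume "bravery (\<eta> u \<omega>) = bravery (\<eta> v \<omega>)"
      thus "u = v" using elim(1)[rule_format, of "(u, v)"] by auto
    qed
    ultimately show ?case using elim(2) by (auto simp: regular_def)
  qed
qed

text \<open>By uniqueness, the walk law at \<open>\<phi> x\<close> is the image of the one at
  \<open>x\<close>; the other components have the same law at all sites.\<close>

lemma particle_invariant:
  assumes \<phi>: "\<phi> \<in> \<Gamma>" and f: "f \<in> borel_measurable particle_space"
  shows "(\<integral>\<^sup>+\<omega>. f (\<eta> (\<phi> x) \<omega>) \<partial>P) = (\<integral>\<^sup>+\<omega>. f (relabel_particle \<phi> (\<eta> x \<omega>)) \<partial>P)"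
proof -
  interpret B: prob_space bravery_law by (rule prob_bravery_law)
  interpret W: prob_space wait_law by (rule prob_wait_law)
  have \<mu>: "walk_measure (\<phi> x) = distr (walk_measure x) path_space (\<lambda>s. \<phi> \<circ> s)"
  proof (rule walk_law_unique[OF cnt walk_measure])
    show "walk_law K (\<phi> x) (distr (walk_measure x) path_space (\<lambda>s. \<phi> \<circ> s))"
      by (rule walk_law_map[of K x "walk_measure x" \<phi>, OF walk_measure bij_sym[OF \<phi>]]) (rule kernel_sym[OF \<phi>])
  qed
  have [measurable]: "f \<in> borel_measurable (count_space UNIV \<Otimes>\<^sub>M path_space \<Otimes>\<^sub>M PiM UNIV (\<lambda>_. borel) \<Otimes>\<^sub>M borel)"
    using f by (simp add: particle_space_def)
  have m: "(\<lambda>y. \<integral>\<^sup>+w. \<integral>\<^sup>+b. f (s, y, w, b) \<partial>bravery_law \<partial>wait_law) \<in> borel_measurable path_space" for s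
  proof -
    have "f \<in> borel_measurable (count_space UNIV \<Otimes>\<^sub>M path_space \<Otimes>\<^sub>M wait_law \<Otimes>\<^sub>M bravery_law)" by measurable
    note [measurable] = this
    show ?thesis by measurable
  qed
  have "(\<integral>\<^sup>+\<omega>. f (\<eta> (\<phi> x) \<omega>) \<partial>P) =
      (\<integral>\<^sup>+s. \<integral>\<^sup>+y. \<integral>\<^sup>+w. \<integral>\<^sup>+b. f (s, \<phi> \<circ> y, w, b) \<partial>bravery_law \<partial>wait_law \<partial>walk_measure x \<partial>species_law p)"
    unfolding nn_integral_particle[OF f] \<mu> using m by (simp add: nn_integral_distr)
  also have "\<dots> = (\<integral>\<^sup>+\<omega>. f (relabel_particle \<phi> (\<eta> x \<omega>)) \<partial>P)"
    unfolding nn_integral_particle[OF measurable_compose[OF measurable_relabel_particle f]]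
    by (simp add: relabel_particle_def spec_def walk_def wait_def bravery_def)
  finally show ?thesis .
qed

text \<open>The relabelled particles are again independent, and by \<open>particle_invariant\<close>
  each has the law belonging to its site, so both environments have the same product law. This gives
  the invariance that mass transport requires for functions of the whole environment.\<close>

lemma env_invariant:
  assumes \<phi>: "\<phi> \<in> \<Gamma>" and f: "f \<in> borel_measurable env_space"
  shows "(\<integral>\<^sup>+\<omega>. f (relabel \<phi> (env \<omega>)) \<partial>P) = (\<integral>\<^sup>+\<omega>. f (env \<omega>) \<partial>P)"
proof -
  note b = bij_sym[OF \<phi>]
  let ?X = "\<lambda>x \<omega>. relabel_particle \<phi> (\<eta> (inverse_map \<phi> x) \<omega>)"
  have "indep_vars (\<lambda>_. particle_space) (\<lambda>x. \<eta> (inverse_map \<phi> x)) UNIV"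
    using indep_vars_reindex_inj[OF indep, of "inverse_map \<phi>" UNIV] b by (simp add: bij_imp_bij_inv bij_is_inj)
  hence ind: "indep_vars (\<lambda>_. particle_space) ?X UNIV"
    by (rule indep_vars_compose2) measurable
  have X [measurable]: "?X x \<in> measurable P particle_space" for x by measurable
  have d: "distr P particle_space (?X x) = distr P particle_space (\<eta> x)" for x
  proof (rule measure_eqI)
    fix A assume "A \<in> sets (distr P particle_space (?X x))"
    hence [measurable]: "A \<in> sets particle_space" by simp
    have "emeasure (distr P particle_space (?X x)) A = (\<integral>\<^sup>+\<omega>. indicator A (?X x \<omega>) \<partial>P)"
      by (subst nn_integral_indicator[symmetric], simp, subst nn_integral_distr) auto
    also have "\<dots> = (\<integral>\<^sup>+\<omega>. indicator A (\<eta> (\<phi> (inverse_map \<phi> x)) \<omega>) \<partial>P)"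
      by (rule particle_invariant[OF \<phi>, symmetric]) measurable
    also have "\<phi> (inverse_map \<phi> x) = x" using b by (simp add: bij_is_surj surj_f_inv_f)
    also have "(\<integral>\<^sup>+\<omega>. indicator A (\<eta> x \<omega>) \<partial>P) = emeasure (distr P particle_space (\<eta> x)) A"
      by (subst nn_integral_indicator[symmetric], simp, subst nn_integral_distr) auto
    finally show "emeasure (distr P particle_space (?X x)) A = emeasure (distr P particle_space (\<eta> x)) A" .
  qed simp
  have "distr P env_space (\<lambda>\<omega>. relabel \<phi> (env \<omega>)) = (\<Pi>\<^sub>M x\<in>UNIV. distr P particle_space (?X x))"
    using indep_vars_iff_distr_eq_PiM'[of UNIV ?X "\<lambda>_. particle_space"] ind X
    by (simp add: restrict_UNIV relabel_def[abs_def])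
  also have "\<dots> = distr P env_space env"
    using indep_vars_iff_distr_eq_PiM'[of UNIV \<eta> "\<lambda>_. particle_space"] indep
    by (simp add: restrict_UNIV d)
  finally have e: "distr P env_space (\<lambda>\<omega>. relabel \<phi> (env \<omega>)) = distr P env_space env" .
  have [measurable]: "(\<lambda>\<omega>. relabel \<phi> (env \<omega>)) \<in> measurable P env_space"
    by (rule measurable_PiM_single') (auto simp: PiE_UNIV_domain relabel_def dest: measurable_space[OF X])
  have "(\<integral>\<^sup>+\<omega>. f (relabel \<phi> (env \<omega>)) \<partial>P) = (\<integral>\<^sup>+z. f z \<partial>distr P env_space (\<lambda>\<omega>. relabel \<phi> (env \<omega>)))"
    using f by (simp add: nn_integral_distr)
  also have "\<dots> = (\<integral>\<^sup>+\<omega>. f (env \<omega>) \<partial>P)"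
    unfolding e using f by (simp add: nn_integral_distr)
  finally show ?thesis .
qed

end

section \<open>No percolation over short time intervals\<close>

lemma borel_measurable_sum_countable:
  fixes f :: "'i \<Rightarrow> 'a \<Rightarrow> ennreal"
  assumes cnt: "countable (UNIV :: 'i set)" and f: "\<And>i. f i \<in> borel_measurable M"
  shows "(\<lambda>\<omega>. \<integral>\<^sup>+i. f i \<omega> \<partial>count_space UNIV) \<in> borel_measurable M"
proof -
  interpret C: sigma_finite_measure "count_space (UNIV :: 'i set)"
    using cnt by (rule sigma_finite_measure_count_space_countable)
  have "(\<lambda>z. f (snd z) (fst z)) \<in> borel_measurable (M \<Otimes>\<^sub>M count_space UNIV)"
    by (rule measurable_compose_countable'[where I = UNIV and f = "\<lambda>i z. f i (fst z)"])
      (auto simp: cnt intro: measurable_compose[OF measurable_fst f])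
  hence "case_prod (\<lambda>\<omega> i. f i \<omega>) \<in> borel_measurable (M \<Otimes>\<^sub>M count_space UNIV)"
    by (simp add: case_prod_beta')
  thus ?thesis by (rule C.borel_measurable_nn_integral)
qed

text \<open>The range of the particle's own path, followed whether or not the particle still exists.
  Ranges of distinct particles are thus independent, and yet they cover every position that a leader
  takes during the interval. The site occupied at time \<open>a\<close> is included.\<close>

definition visited :: "(species \<Rightarrow> real) \<Rightarrow> real \<Rightarrow> real \<Rightarrow> 'v particle \<Rightarrow> 'v set" where
  "visited rate a b q = walk q ` {jumps rate q a..jumps rate q b}"

definition moves :: "(species \<Rightarrow> real) \<Rightarrow> real \<Rightarrow> real \<Rightarrow> 'v particle \<Rightarrow> bool" where
  "moves rate a b q \<longleftrightarrow> jumps rate q a < jumps rate q b"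

definition link :: "(species \<Rightarrow> real) \<Rightarrow> real \<Rightarrow> real \<Rightarrow> 'v particle \<Rightarrow> 'v \<Rightarrow> 'v \<Rightarrow> bool" where
  "link rate a b q x y \<longleftrightarrow> moves rate a b q \<and> x \<in> visited rate a b q \<and> y \<in> visited rate a b q"

text \<open>Particles that do not jump cannot connect distinct sites, so it suffices that the graph on
  sites spanned by the ranges of the jumping particles has finite components.\<close>

lemma (in regular_env) finite_touch:
  assumes ab: "a \<le> b"
    and S: "\<And>x. finite {y. (\<lambda>x y. \<exists>v. link rate a b (e v) x y)\<^sup>*\<^sup>* x y}"
    and vis: "\<And>x. finite {v. x \<in> visited rate a b (e v)}"
  shows "finite {w. (touch a b)\<^sup>*\<^sup>* l w}"
proof -
  let ?L = "\<lambda>x y. \<exists>v. link rate a b (e v) x y"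
  define x0 where "x0 = pos a l"
  have pv: "pos s v \<in> visited rate a b (e v)" if "a \<le> s" "s \<le> b" for s v
    using jumps_mono[OF that(1), of v] jumps_mono[OF that(2), of v]
    by (auto simp: visited_def position_jumps)
  have ext: "visited rate a b (e w) \<subseteq> {y. ?L\<^sup>*\<^sup>* x0 y}" if "y \<in> visited rate a b (e w)" "?L\<^sup>*\<^sup>* x0 y" for w y
  proof
    fix z assume z: "z \<in> visited rate a b (e w)"
    show "z \<in> {y. ?L\<^sup>*\<^sup>* x0 y}"
    proof (cases "moves rate a b (e w)")
      case True
      hence "?L y z" using that z by (auto simp: link_def)
      thus ?thesis using that(2) by (auto intro: rtranclp.rtrancl_into_rtrancl)
    next
      case False
      hence "jumps rate (e w) a = jumps rate (e w) b"
        using jumps_mono[OF ab, of w] by (simp add: moves_def)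
      hence "z = y" using z that(1) by (auto simp: visited_def)
      thus ?thesis using that(2) by simp
    qed
  qed
  have sub: "visited rate a b (e w) \<subseteq> {y. ?L\<^sup>*\<^sup>* x0 y}" if "(touch a b)\<^sup>*\<^sup>* l w" for w
    using that
  proof (induction rule: rtranclp_induct)
    case base
    show ?case by (rule ext[of x0]) (use pv[of a l] ab in \<open>auto simp: x0_def\<close>)
  next
    case (step u w)
    obtain s where s: "a < s" "s \<le> b" "pos s u = pos s w" using step(2) by (auto simp: touch_def)
    have "pos s u \<in> {y. ?L\<^sup>*\<^sup>* x0 y}" using step.IH pv[of s u] s by auto
    thus ?case using ext[of "pos s w" w] pv[of s w] s by simp
  qed
  have "{w. (touch a b)\<^sup>*\<^sup>* l w} \<subseteq> (\<Union>x\<in>{y. ?L\<^sup>*\<^sup>* x0 y}. {v. x \<in> visited rate a b (e v)})"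
    using sub pv[of a] ab by blast
  moreover have "finite \<dots>" using S vis by blast
  ultimately show ?thesis by (rule finite_subset)
qed

section \<open>Chains of links, loop erasure and geometric weights\<close>

fun chain :: "('p \<Rightarrow> 'v \<Rightarrow> 'v \<Rightarrow> bool) \<Rightarrow> 'v \<Rightarrow> ('p \<times> 'v) list \<Rightarrow> bool" where
  "chain L x [] \<longleftrightarrow> True"
| "chain L x ((v, z) # ps) \<longleftrightarrow> L v x z \<and> chain L z ps"

fun endpoint :: "'v \<Rightarrow> ('p \<times> 'v) list \<Rightarrow> 'v" where
  "endpoint x [] = x"
| "endpoint x ((v, z) # ps) = endpoint z ps"

lemma chain_append: "chain L x (ps @ qs) \<longleftrightarrow> chain L x ps \<and> chain L (endpoint x ps) qs"
  by (induction ps arbitrary: x) auto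

lemma endpoint_append: "endpoint x (ps @ qs) = endpoint (endpoint x ps) qs"
  by (induction ps arbitrary: x) auto

lemma rtranclp_chain:
  assumes "(\<lambda>x y. \<exists>v. L v x y)\<^sup>*\<^sup>* x y"
  shows "\<exists>ps. chain L x ps \<and> endpoint x ps = y"
  using assms
proof (induction rule: rtranclp_induct)
  case base
  show ?case by (rule exI[of _ "[]"]) simp
next
  case (step y z)
  then obtain ps v where "chain L x ps" "endpoint x ps = y" "L v y z" by blast
  thus ?case by (intro exI[of _ "ps @ [(v, z)]"]) (simp add: chain_append endpoint_append)
qed

text \<open>Loop erasure: if a particle occurs twice, the chain can pass directly from the site
  where it first enters that particle to the site where it leaves its second occurrence, and gets
  shorter. The assumption \<open>L\<close> holds for \<open>link\<close> because that relation
  imposes separate conditions on the two sites.\<close>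

lemma distinct_chain:
  assumes L: "\<And>v x z x' z'. L v x z \<Longrightarrow> L v x' z' \<Longrightarrow> L v x z'"
  shows "chain L x ps \<Longrightarrow> \<exists>qs. chain L x qs \<and> endpoint x qs = endpoint x ps \<and> distinct (map fst qs)"
proof (induction "length ps" arbitrary: ps rule: less_induct)
  case less
  show ?case
  proof (cases "distinct (map fst ps)")
    case True thus ?thesis using less.prems by blast
  next
    case False
    then obtain as bs cs v where "map fst ps = as @ [v] @ bs @ [v] @ cs"
      using not_distinct_decomp by blast
    then obtain p1 r1 where r1: "ps = p1 @ r1" "map fst r1 = v # bs @ v # cs"
      by (auto simp: map_eq_append_conv)
    obtain z r2 where r2: "r1 = (v, z) # r2" "map fst r2 = bs @ v # cs"
      using r1(2) by (cases r1) auto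
    obtain p2 r3 where r3: "r2 = p2 @ r3" "map fst r3 = v # cs"
      using r2(2) by (auto simp: map_eq_append_conv)
    obtain z' p3 where "r3 = (v, z') # p3"
      using r3(2) by (cases r3) auto
    hence ps: "ps = p1 @ (v, z) # p2 @ (v, z') # p3"
      using r1 r2 r3 by simp
    have "chain L x (p1 @ (v, z') # p3)" "endpoint x (p1 @ (v, z') # p3) = endpoint x ps"
      using less.prems L[of v "endpoint x p1" z "endpoint z p2" z'] unfolding ps
      by (auto simp: chain_append endpoint_append)
    thus ?thesis using less.hyps[of "p1 @ (v, z') # p3"] ps by auto
  qed
qed

lemma chain_iff_nth:
  "chain L x ps \<longleftrightarrow> (\<forall>k<length ps. L (fst (ps ! k)) ((x # map snd ps) ! k) (snd (ps ! k)))"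
proof (induction ps arbitrary: x)
  case (Cons p ps)
  show ?case using Cons.IH[of "snd p"] by (cases p) (simp add: All_less_Suc2)
qed simp

fun weight :: "('p \<Rightarrow> 'v \<Rightarrow> 'v \<Rightarrow> ennreal) \<Rightarrow> 'v \<Rightarrow> ('p \<times> 'v) list \<Rightarrow> ennreal" where
  "weight w x [] = 1"
| "weight w x ((v, z) # ps) = w v x z * weight w z ps"

lemma weight_nth:
  "weight w x ps = (\<Prod>k<length ps. w (fst (ps ! k)) ((x # map snd ps) ! k) (snd (ps ! k)))"
proof (induction ps arbitrary: x)
  case (Cons p ps)
  show ?case using Cons.IH[of "snd p"] by (cases p) (simp add: prod.lessThan_Suc_shift del: prod.lessThan_Suc)
qed simp

text \<open>Peeling off the leading link gives a factor of at most \<open>c\<close> uniformly in the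
  starting site, so the induction is over all \<open>x\<close> at once.\<close>

lemma sum_weight_length:
  fixes w :: "'p \<Rightarrow> 'v \<Rightarrow> 'v \<Rightarrow> ennreal"
  assumes c: "\<And>x. (\<integral>\<^sup>+v. \<integral>\<^sup>+z. w v x z \<partial>count_space UNIV \<partial>count_space UNIV) \<le> c"
  shows "(\<integral>\<^sup>+ps. weight w x ps * indicator {ps. length ps = n} ps \<partial>count_space UNIV) \<le> c ^ n"
proof (induction n arbitrary: x)
  case 0
  have "(\<integral>\<^sup>+ps. weight w x ps * indicator {ps. length ps = 0} ps \<partial>count_space UNIV) =
    (\<integral>\<^sup>+ps. indicator {[] :: ('p \<times> 'v) list} ps \<partial>count_space UNIV)"
    by (intro nn_integral_cong) (auto simp: indicator_def)
  thus ?case by simp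
next
  case (Suc n)
  let ?f = "\<lambda>ps. weight w x ps * indicator {ps. length ps = Suc n} ps"
  have "(\<integral>\<^sup>+ps. ?f ps \<partial>count_space UNIV) = (\<integral>\<^sup>+ps. ?f ps \<partial>count_space (range (\<lambda>(p, ps). p # ps)))"
    by (rule nn_integral_count_space_eq) (auto simp: indicator_def length_Suc_conv image_iff)
  also have "\<dots> = (\<integral>\<^sup>+z. ?f (case z of (p, ps) \<Rightarrow> p # ps) \<partial>count_space UNIV)"
    by (rule nn_integral_bij_count_space[symmetric]) (auto simp: bij_betw_def inj_on_def)
  also have "\<dots> = (\<integral>\<^sup>+p. \<integral>\<^sup>+ps. ?f (p # ps) \<partial>count_space UNIV \<partial>count_space UNIV)"
    by (subst nn_integral_fst_count_space[symmetric]) simp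
  also have "\<dots> = (\<integral>\<^sup>+v. \<integral>\<^sup>+z. \<integral>\<^sup>+ps. ?f ((v, z) # ps) \<partial>count_space UNIV \<partial>count_space UNIV \<partial>count_space UNIV)"
    by (subst nn_integral_fst_count_space[symmetric]) simp
  also have "\<dots> = (\<integral>\<^sup>+v. \<integral>\<^sup>+z. w v x z * (\<integral>\<^sup>+ps. weight w z ps * indicator {ps. length ps = n} ps \<partial>count_space UNIV) \<partial>count_space UNIV \<partial>count_space UNIV)"
    by (intro nn_integral_cong, subst nn_integral_cmult[symmetric])
      (auto intro!: nn_integral_cong simp: indicator_def mult.assoc)
  also have "\<dots> \<le> (\<integral>\<^sup>+v. \<integral>\<^sup>+z. w v x z * c ^ n \<partial>count_space UNIV \<partial>count_space UNIV)"
    by (intro nn_integral_mono mult_left_mono Suc.IH) simp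
  also have "\<dots> = (\<integral>\<^sup>+v. \<integral>\<^sup>+z. w v x z \<partial>count_space UNIV \<partial>count_space UNIV) * c ^ n"
    by (simp add: nn_integral_multc)
  also have "\<dots> \<le> c * c ^ n" by (intro mult_right_mono c) simp
  finally show ?case by simp
qed

lemma sum_weight:
  fixes w :: "'p \<Rightarrow> 'v \<Rightarrow> 'v \<Rightarrow> ennreal"
  assumes "\<And>x. (\<integral>\<^sup>+v. \<integral>\<^sup>+z. w v x z \<partial>count_space UNIV \<partial>count_space UNIV) \<le> ennreal (1 / 2)"
  shows "(\<integral>\<^sup>+ps. weight w x ps \<partial>count_space UNIV) < \<infinity>"
proof -
  \<comment> \<open>The inserted sum over \<open>n\<close> of the indicator of
    \<open>{length ps}\<close> equals 1 and sorts the chains by length; with the bound 1/2 per link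
    the lengths contribute a convergent geometric series.\<close>
  have "(\<integral>\<^sup>+ps. weight w x ps \<partial>count_space UNIV) = (\<integral>\<^sup>+ps. \<integral>\<^sup>+n. weight w x ps * indicator {length ps} n \<partial>count_space UNIV \<partial>count_space UNIV)"
    by (simp add: nn_integral_cmult)
  also have "\<dots> = (\<integral>\<^sup>+n. \<integral>\<^sup>+ps. weight w x ps * indicator {length ps} n \<partial>count_space UNIV \<partial>count_space UNIV)"
    by (rule nn_integral_count_space_nn_integral) auto
  also have "\<dots> = (\<Sum>n. \<integral>\<^sup>+ps. weight w x ps * indicator {length ps} n \<partial>count_space UNIV)"
    by (rule nn_integral_count_space_nat)
  also have "\<dots> = (\<Sum>n. \<integral>\<^sup>+ps. weight w x ps * indicator {ps. length ps = n} ps \<partial>count_space UNIV)"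
    by (intro suminf_cong nn_integral_cong) (auto simp: indicator_def)
  also have "\<dots> \<le> (\<Sum>n. ennreal ((1 / 2) ^ n))"
  proof (intro suminf_le)
    fix n
    have "(\<integral>\<^sup>+ps. weight w x ps * indicator {ps. length ps = n} ps \<partial>count_space UNIV) \<le> ennreal (1 / 2) ^ n"
      by (rule sum_weight_length[OF assms])
    also have "ennreal (1 / 2) ^ n = ennreal ((1 / 2) ^ n)" by (rule ennreal_power) simp
    finally show "(\<integral>\<^sup>+ps. weight w x ps * indicator {ps. length ps = n} ps \<partial>count_space UNIV) \<le> ennreal ((1 / 2) ^ n)" .
  qed auto
  also have "\<dots> < \<infinity>"
  proof -
    have "summable (\<lambda>n. (1 / 2 :: real) ^ n)" by (rule summable_geometric) simp
    hence "(\<Sum>n. ennreal ((1 / 2) ^ n)) \<noteq> \<infinity>"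
      unfolding infinity_ennreal_def by (rule ennreal_suminf_neq_top) simp
    thus ?thesis unfolding infinity_ennreal_def by (rule less_top[THEN iffD1])
  qed
  finally show ?thesis .
qed

section \<open>Ranges and activity of a single particle\<close>

lemma jumps_relabel [simp]: "jumps rate (relabel_particle \<phi> q) = jumps rate q"
  by (simp add: jumps_def fun_eq_iff)

lemma visited_relabel [simp]: "visited rate a b (relabel_particle \<phi> q) = \<phi> ` visited rate a b q"
  by (auto simp: visited_def)

lemma moves_relabel [simp]: "moves rate a b (relabel_particle \<phi> q) = moves rate a b q"
  by (simp add: moves_def)

lemma finite_visited [simp]: "finite (visited rate a b q)"
  by (simp add: visited_def)

lemma card_visited: "card (visited rate a b q) \<le> jumps rate q b - jumps rate q a + 1"
  unfolding visited_def by (rule order_trans[OF card_image_le]) auto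

lemma pred_visited [measurable]: "Measurable.pred particle_space (\<lambda>q. x \<in> visited rate a b q)"
proof -
  have "(\<lambda>q. x \<in> visited rate a b q) = (\<lambda>q. \<exists>n. jumps rate q a \<le> n \<and> n \<le> jumps rate q b \<and> walk q n = x)"
    by (rule ext) (auto simp: visited_def image_iff Bex_def)
  thus ?thesis by simp
qed

lemma measurable_nat_nat:
  assumes "f \<in> measurable M (count_space (UNIV :: nat set))" "g \<in> measurable M (count_space (UNIV :: nat set))"
    and "\<And>m n. h m n \<in> space N"
  shows "(\<lambda>x. h (f x) (g x)) \<in> measurable M N"
proof (rule measurable_compose_countable[of "\<lambda>m x. h m (g x)", OF _ assms(1)])
  show "(\<lambda>x. h m (g x)) \<in> measurable M N" for m
    by (rule measurable_compose[OF assms(2), of "h m"]) (use assms(3) in simp)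
qed

lemma pred_moves [measurable]: "Measurable.pred particle_space (moves rate a b)"
  unfolding moves_def[abs_def]
  by (rule measurable_nat_nat[of "\<lambda>q. jumps rate q a" _ "\<lambda>q. jumps rate q b" "(<)"]) auto

lemma pred_link [measurable]: "Measurable.pred particle_space (\<lambda>q. link rate a b q x y)"
  unfolding link_def by measurable

text \<open>The bound for the expected number of links leaving a site: the square counts pairs of an
  entrance and an exit in the range. Restricting it to moving particles makes its expectation small
  on short intervals.\<close>

definition activity :: "(species \<Rightarrow> real) \<Rightarrow> real \<Rightarrow> real \<Rightarrow> 'v particle \<Rightarrow> ennreal" where
  "activity rate a b q = (if moves rate a b q then ennreal (real ((jumps rate q b - jumps rate q a + 1)\<^sup>2)) else 0)"

lemma measurable_activity [measurable]: "activity rate a b \<in> borel_measurable particle_space"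
  unfolding activity_def[abs_def]
  by (intro measurable_If_set measurable_nat_nat[of "\<lambda>q. jumps rate q a" _ "\<lambda>q. jumps rate q b"
      "\<lambda>m n. ennreal (real ((n - m + 1)\<^sup>2))"] measurable_If) (use pred_moves in \<open>auto simp: pred_def\<close>)

lemma prod_of_bool: "(\<Prod>k<(n :: nat). of_bool (B k)) = (of_bool (\<forall>k<n. B k) :: 'a :: comm_semiring_1)"
  by (induction n) (auto simp: All_less_Suc)

section \<open>Expected numbers of visitors, links and chains\<close>

context dlacs begin

lemma measurable_card_visited [measurable]: "(\<lambda>q. card (visited rate a b q)) \<in> measurable (particle_space :: 'v particle measure) (count_space UNIV)"
  by (rule measurable_card_countable[OF cnt]) (use pred_visited in \<open>simp add: pred_def\<close>)

text \<open>Mass transport, with unit mass sent from the initial site of a particle to every site it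
  visits, turns visits received by \<open>x\<close> into visits made from \<open>x\<close>.\<close>

lemma sum_visited:
  "(\<integral>\<^sup>+v. \<integral>\<^sup>+\<omega>. of_bool (x \<in> visited rate a b (\<eta> v \<omega>)) \<partial>P \<partial>count_space UNIV) = (\<integral>\<^sup>+\<omega>. of_nat (card (visited rate a b (\<eta> x \<omega>))) \<partial>P)"
proof -
  define f where "f v x = (\<integral>\<^sup>+\<omega>. indicator {q. x \<in> visited rate a b q} (\<eta> v \<omega>) \<partial>P)" for v x
  have f: "f (\<phi> v) (\<phi> x) = f v x" if \<phi>: "\<phi> \<in> \<Gamma>" for \<phi> v x
  proof -
    have "f (\<phi> v) (\<phi> x) = (\<integral>\<^sup>+\<omega>. indicator {q. \<phi> x \<in> visited rate a b q} (relabel_particle \<phi> (\<eta> v \<omega>)) \<partial>P)"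
      unfolding f_def by (rule particle_invariant[OF \<phi>]) measurable
    also have "\<dots> = f v x"
      unfolding f_def using bij_sym[OF \<phi>] by (intro nn_integral_cong) (auto simp: indicator_def inj_image_mem_iff bij_is_inj)
    finally show ?thesis .
  qed
  have "(\<integral>\<^sup>+v. \<integral>\<^sup>+\<omega>. of_bool (x \<in> visited rate a b (\<eta> v \<omega>)) \<partial>P \<partial>count_space UNIV) = (\<integral>\<^sup>+v. f v x \<partial>count_space UNIV)"
    unfolding f_def by (intro nn_integral_cong) (auto simp: indicator_def)
  also have "\<dots> = (\<integral>\<^sup>+v. f x v \<partial>count_space UNIV)" by (rule transport) (rule f)
  also have "\<dots> = (\<integral>\<^sup>+\<omega>. \<integral>\<^sup>+v. indicator {q. v \<in> visited rate a b q} (\<eta> x \<omega>) \<partial>count_space UNIV \<partial>P)"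
    unfolding f_def by (rule nn_integral_count_space_nn_integral[OF cnt, symmetric]) measurable
  also have "\<dots> = (\<integral>\<^sup>+\<omega>. \<integral>\<^sup>+v. indicator (visited rate a b (\<eta> x \<omega>)) v \<partial>count_space UNIV \<partial>P)"
    by (intro nn_integral_cong) (auto simp: indicator_def)
  also have "\<dots> = (\<integral>\<^sup>+\<omega>. of_nat (card (visited rate a b (\<eta> x \<omega>))) \<partial>P)" by simp
  finally show ?thesis .
qed

text \<open>A moving particle sends to each site of its range as much mass as the range has sites,
  that is, the number of ends of links starting there. So \<open>x\<close> receives the number of
  links leaving it, and the particle from \<open>x\<close> sends the square of the size of its
  range.\<close>

lemma sum_link:
  "(\<integral>\<^sup>+v. \<integral>\<^sup>+z. \<integral>\<^sup>+\<omega>. of_bool (link rate a b (\<eta> v \<omega>) x z) \<partial>P \<partial>count_space UNIV \<partial>count_space UNIV) \<le> (\<integral>\<^sup>+\<omega>. activity rate a b (\<eta> x \<omega>) \<partial>P)"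
proof -
  define g where "g x q = (if moves rate a b q \<and> x \<in> visited rate a b q then of_nat (card (visited rate a b q)) else 0 :: ennreal)" for x and q :: "'v particle"
  have g_meas [measurable]: "g x \<in> borel_measurable particle_space" for x
    unfolding g_def[abs_def] by measurable
  define f where "f v x = (\<integral>\<^sup>+\<omega>. g x (\<eta> v \<omega>) \<partial>P)" for v x
  have f: "f (\<phi> v) (\<phi> x) = f v x" if \<phi>: "\<phi> \<in> \<Gamma>" for \<phi> v x
  proof -
    have inj: "inj \<phi>" using bij_sym[OF \<phi>] by (rule bij_is_inj)
    have "f (\<phi> v) (\<phi> x) = (\<integral>\<^sup>+\<omega>. g (\<phi> x) (relabel_particle \<phi> (\<eta> v \<omega>)) \<partial>P)"
      unfolding f_def by (rule particle_invariant[OF \<phi>]) measurable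
    also have "\<dots> = f v x"
      unfolding f_def g_def using inj
      by (intro nn_integral_cong) (auto simp: inj_image_mem_iff card_image inj_on_subset[OF inj])
    finally show ?thesis .
  qed
  have "(\<integral>\<^sup>+v. \<integral>\<^sup>+z. \<integral>\<^sup>+\<omega>. of_bool (link rate a b (\<eta> v \<omega>) x z) \<partial>P \<partial>count_space UNIV \<partial>count_space UNIV) =
     (\<integral>\<^sup>+v. \<integral>\<^sup>+\<omega>. \<integral>\<^sup>+z. of_bool (link rate a b (\<eta> v \<omega>) x z) \<partial>count_space UNIV \<partial>P \<partial>count_space UNIV)"
    by (intro nn_integral_cong nn_integral_count_space_nn_integral[OF cnt, symmetric]) measurable
  also have "\<dots> = (\<integral>\<^sup>+v. f v x \<partial>count_space UNIV)"
    unfolding f_def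
  proof (intro nn_integral_cong)
    fix v \<omega>
    have "(\<integral>\<^sup>+z. of_bool (link rate a b (\<eta> v \<omega>) x z) \<partial>count_space UNIV) =
      (\<integral>\<^sup>+z. of_bool (moves rate a b (\<eta> v \<omega>) \<and> x \<in> visited rate a b (\<eta> v \<omega>)) * indicator (visited rate a b (\<eta> v \<omega>)) z \<partial>count_space UNIV)"
      by (intro nn_integral_cong) (auto simp: link_def indicator_def)
    thus "(\<integral>\<^sup>+z. of_bool (link rate a b (\<eta> v \<omega>) x z) \<partial>count_space UNIV) = g x (\<eta> v \<omega>)"
      by (simp add: nn_integral_cmult g_def)
  qed
  also have "\<dots> = (\<integral>\<^sup>+v. f x v \<partial>count_space UNIV)" by (rule transport) (rule f)
  also have "\<dots> = (\<integral>\<^sup>+\<omega>. \<integral>\<^sup>+v. g v (\<eta> x \<omega>) \<partial>count_space UNIV \<partial>P)"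
    unfolding f_def by (rule nn_integral_count_space_nn_integral[OF cnt, symmetric]) measurable
  also have "\<dots> \<le> (\<integral>\<^sup>+\<omega>. activity rate a b (\<eta> x \<omega>) \<partial>P)"
  proof (intro nn_integral_mono)
    fix \<omega>
    let ?q = "\<eta> x \<omega>" let ?n = "card (visited rate a b ?q)"
    have "(\<integral>\<^sup>+v. g v ?q \<partial>count_space UNIV) =
      (\<integral>\<^sup>+v. (of_bool (moves rate a b ?q) * of_nat ?n) * indicator (visited rate a b ?q) v \<partial>count_space UNIV)"
      by (intro nn_integral_cong) (auto simp: g_def indicator_def)
    also have "\<dots> = of_bool (moves rate a b ?q) * of_nat ?n * of_nat ?n"
      by (simp add: nn_integral_cmult)
    also have "\<dots> \<le> activity rate a b ?q"
    proof -
      have "?n * ?n \<le> (jumps rate ?q b - jumps rate ?q a + 1)\<^sup>2"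
        unfolding power2_eq_square by (intro mult_mono card_visited) auto
      hence "ennreal (real (?n * ?n)) \<le> ennreal (real ((jumps rate ?q b - jumps rate ?q a + 1)\<^sup>2))"
        by (intro ennreal_leI) (simp only: of_nat_le_iff)
      moreover have "of_nat ?n * of_nat ?n = ennreal (real (?n * ?n))"
        by (simp add: ennreal_of_nat_eq_real_of_nat ennreal_mult)
      ultimately show ?thesis by (simp add: activity_def)
    qed
    finally show "(\<integral>\<^sup>+v. g v ?q \<partial>count_space UNIV) \<le> activity rate a b ?q" .
  qed
  finally show ?thesis .
qed

text \<open>Each link depends on one particle only, and distinct particles are independent, so the
  expectation of the product of the link indicators factorises.\<close>

lemma prob_chain:
  assumes "distinct (map fst ps)"
  shows "(\<integral>\<^sup>+\<omega>. of_bool (chain (\<lambda>v. link rate a b (\<eta> v \<omega>)) x ps) \<partial>P) =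
     weight (\<lambda>v x z. \<integral>\<^sup>+\<omega>. of_bool (link rate a b (\<eta> v \<omega>) x z) \<partial>P) x ps"
proof -
  define X where "X k q = (of_bool (link rate a b q ((x # map snd ps) ! k) (snd (ps ! k))) :: ennreal)" for k and q :: "'v particle"
  let ?v = "\<lambda>k. fst (ps ! k)"
  have [measurable]: "X k \<in> borel_measurable particle_space" for k
    unfolding X_def[abs_def] by measurable
  have inj: "inj_on ?v {..<length ps}"
    using assms by (auto simp: distinct_conv_nth inj_on_def)
  have "indep_vars (\<lambda>_. particle_space) (\<lambda>k. \<eta> (?v k)) {..<length ps}"
    using indep_vars_reindex_inj[OF indep inj] .
  hence ind: "indep_vars (\<lambda>_. borel) (\<lambda>k \<omega>. X k (\<eta> (?v k) \<omega>)) {..<length ps}"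
    by (rule indep_vars_compose2) measurable
  have "(\<integral>\<^sup>+\<omega>. of_bool (chain (\<lambda>v. link rate a b (\<eta> v \<omega>)) x ps) \<partial>P) = (\<integral>\<^sup>+\<omega>. (\<Prod>k<length ps. X k (\<eta> (?v k) \<omega>)) \<partial>P)"
    by (intro nn_integral_cong) (simp add: chain_iff_nth X_def prod_of_bool)
  also have "\<dots> = (\<Prod>k<length ps. \<integral>\<^sup>+\<omega>. X k (\<eta> (?v k) \<omega>) \<partial>P)"
    by (rule indep_vars_nn_integral[OF _ ind]) auto
  also have "\<dots> = weight (\<lambda>v x z. \<integral>\<^sup>+\<omega>. of_bool (link rate a b (\<eta> v \<omega>) x z) \<partial>P) x ps"
    by (simp add: weight_nth X_def)
  finally show ?thesis .
qed

text \<open>The expected number of chains of distinct particles from \<open>x\<close> is finite, so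
  almost surely there are finitely many of them; after loop erasure every reachable site is the
  endpoint of one.\<close>

lemma AE_finite_reach:
  assumes "\<And>x. (\<integral>\<^sup>+\<omega>. activity rate a b (\<eta> x \<omega>) \<partial>P) \<le> ennreal (1 / 2)"
  shows "AE \<omega> in P. finite {y. (\<lambda>x y. \<exists>v. link rate a b (\<eta> v \<omega>) x y)\<^sup>*\<^sup>* x y}"
proof -
  let ?w = "\<lambda>v x z. \<integral>\<^sup>+\<omega>. of_bool (link rate a b (\<eta> v \<omega>) x z) \<partial>P"
  let ?C = "\<lambda>\<omega> ps. chain (\<lambda>v. link rate a b (\<eta> v \<omega>)) x ps \<and> distinct (map fst ps)"
  have cp: "countable (UNIV :: ('v \<times> 'v) list set)"
  proof -
    have "countable ((UNIV :: 'v set) \<times> (UNIV :: 'v set))" using cnt by (intro countable_SIGMA) auto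
    hence "countable (lists (UNIV :: ('v \<times> 'v) set))" by (intro countable_lists) simp
    thus ?thesis by simp
  qed
  have C_meas: "(\<lambda>\<omega>. of_bool (?C \<omega> ps) :: ennreal) \<in> borel_measurable P" for ps
    unfolding chain_iff_nth by measurable
  have "(\<integral>\<^sup>+\<omega>. \<integral>\<^sup>+ps. of_bool (?C \<omega> ps) \<partial>count_space UNIV \<partial>P) = (\<integral>\<^sup>+ps. \<integral>\<^sup>+\<omega>. of_bool (?C \<omega> ps) \<partial>P \<partial>count_space UNIV)"
    by (rule nn_integral_count_space_nn_integral[OF cp C_meas])
  also have "\<dots> \<le> (\<integral>\<^sup>+ps. weight ?w x ps \<partial>count_space UNIV)"
  proof (intro nn_integral_mono)
    fix ps
    show "(\<integral>\<^sup>+\<omega>. of_bool (?C \<omega> ps) \<partial>P) \<le> weight ?w x ps"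
      by (cases "distinct (map fst ps)") (simp_all add: prob_chain)
  qed
  also have "\<dots> < \<infinity>"
    using order_trans[OF sum_link assms] by (intro sum_weight)
  finally have "(\<integral>\<^sup>+\<omega>. \<integral>\<^sup>+ps. of_bool (?C \<omega> ps) \<partial>count_space UNIV \<partial>P) \<noteq> \<infinity>" by simp
  hence "AE \<omega> in P. (\<integral>\<^sup>+ps. of_bool (?C \<omega> ps) \<partial>count_space UNIV) \<noteq> \<infinity>"
    by (intro nn_integral_PInf_AE borel_measurable_sum_countable[OF cp] C_meas)
  thus ?thesis
  proof eventually_elim
    case (elim \<omega>)
    have "(\<integral>\<^sup>+ps. of_bool (?C \<omega> ps) \<partial>count_space UNIV) = (\<integral>\<^sup>+ps. indicator {ps. ?C \<omega> ps} ps \<partial>count_space UNIV)"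
      by (intro nn_integral_cong) (auto simp: indicator_def)
    hence ne: "emeasure (count_space UNIV) {ps. ?C \<omega> ps} \<noteq> \<infinity>" using elim by simp
    have fin: "finite {ps. ?C \<omega> ps}"
    proof (rule ccontr)
      assume "infinite {ps. ?C \<omega> ps}"
      from emeasure_count_space_infinite[OF subset_UNIV this] ne show False by contradiction
    qed
    have "{y. (\<lambda>x y. \<exists>v. link rate a b (\<eta> v \<omega>) x y)\<^sup>*\<^sup>* x y} \<subseteq> endpoint x ` {ps. ?C \<omega> ps}"
    proof
      fix y assume "y \<in> {y. (\<lambda>x y. \<exists>v. link rate a b (\<eta> v \<omega>) x y)\<^sup>*\<^sup>* x y}"
      then obtain ps where ps: "chain (\<lambda>v. link rate a b (\<eta> v \<omega>)) x ps" "endpoint x ps = y"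
        using rtranclp_chain[of "\<lambda>v. link rate a b (\<eta> v \<omega>)" x y] by blast
      have "\<exists>qs. chain (\<lambda>v. link rate a b (\<eta> v \<omega>)) x qs \<and> endpoint x qs = endpoint x ps \<and> distinct (map fst qs)"
        using ps(1) by (rule distinct_chain[rotated]) (auto simp: link_def)
      then obtain qs where "?C \<omega> qs" "endpoint x qs = y" using ps(2) by blast
      thus "y \<in> endpoint x ` {ps. ?C \<omega> ps}" by (intro image_eqI[of _ _ qs]) auto
    qed
    thus ?case using fin by (blast intro: finite_subset)
  qed
qed

end

section \<open>Existence of the infinite system\<close>

lemma down_closed_eq_lessThan:
  fixes A :: "nat set"
  assumes "finite A" "\<And>m n. n \<in> A \<Longrightarrow> m \<le> n \<Longrightarrow> m \<in> A"
  shows "A = {..<card A}"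
proof (cases "A = {}")
  case False
  have "A = {..<Suc (Max A)}"
  proof (intro equalityI subsetI)
    fix x assume "x \<in> A"
    thus "x \<in> {..<Suc (Max A)}" using Max_ge[OF assms(1)] by (simp add: less_Suc_eq_le)
  next
    fix x assume "x \<in> {..<Suc (Max A)}"
    thus "x \<in> A" using assms(2)[OF Max_in[OF assms(1) False], of x] by (simp add: less_Suc_eq_le)
  qed
  moreover from this have "card A = Suc (Max A)" by (metis card_lessThan)
  ultimately show ?thesis by simp
qed simp

lemma square_le_power4: "(n + 1)\<^sup>2 \<le> (4 :: nat) ^ n"
proof (induction n)
  case (Suc n)
  have "(Suc n + 1)\<^sup>2 \<le> (2 * (n + 1))\<^sup>2" by (rule power_mono) simp_all
  also have "\<dots> = 4 * (n + 1)\<^sup>2" by (simp only: power_mult_distrib) simp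
  also have "\<dots> \<le> 4 * 4 ^ n" using Suc.IH by simp
  finally show ?case by simp
qed simp

text \<open>A telescoping sum, used to write \<open>4 ^ J\<close> as a sum over the rings that have
  occurred.\<close>

lemma power4_sum: "(4 :: nat) ^ n = 1 + (\<Sum>k<n. 3 * 4 ^ k)"
  by (induction n) auto

lemma (in regular_env) ring_mono: "m \<le> n \<Longrightarrow> ring (e v) m \<le> ring (e v) n"
  unfolding ring_def using reg by (intro sum_mono2) (auto simp: regular_def less_imp_le)

text \<open>The rings increase, so those that have occurred are exactly the ones with index below
  the jump count \<open>J\<close>. With \<open>(J + 1) ^ 2 \<le> 4 ^ J\<close> and
  \<open>power4_sum\<close>, the square becomes a sum of indicators to which
  \<open>wait_sum_tail\<close> applies.\<close>

lemma (in regular_env) jumps_square_le: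
  "ennreal (real ((jumps rate (e v) c + 1)\<^sup>2)) \<le>
     1 + (\<Sum>n. ennreal (3 * 4 ^ n) * of_bool (ring (e v) n \<le> rate (spec (e v)) * c))"
proof -
  let ?A = "{n. ring (e v) n \<le> rate (spec (e v)) * c}" and ?N = "jumps rate (e v) c"
  have fA: "finite ?A" using reg by (simp add: regular_def)
  have A: "?A = {..<?N}"
    unfolding jumps_def
  proof (rule down_closed_eq_lessThan[OF fA])
    fix m n assume "n \<in> ?A" "m \<le> n"
    thus "m \<in> ?A" using ring_mono[of m n v] by simp
  qed
  have "real ((?N + 1)\<^sup>2) \<le> real (4 ^ ?N)"
    using square_le_power4[of ?N] by (simp only: of_nat_le_iff)
  also have "\<dots> = real (1 + (\<Sum>k<?N. 3 * 4 ^ k))"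
    unfolding power4_sum[of ?N] ..
  also have "\<dots> = 1 + (\<Sum>n\<in>?A. 3 * 4 ^ n)"
    unfolding A by (simp only: of_nat_add of_nat_sum of_nat_mult of_nat_power of_nat_1 of_nat_numeral)
  finally have "ennreal (real ((?N + 1)\<^sup>2)) \<le> ennreal (1 + (\<Sum>n\<in>?A. 3 * 4 ^ n))"
    by (rule ennreal_leI)
  also have "\<dots> = 1 + (\<Sum>n\<in>?A. ennreal (3 * 4 ^ n) * of_bool (ring (e v) n \<le> rate (spec (e v)) * c))"
  proof -
    have "ennreal (1 + (\<Sum>n\<in>?A. 3 * 4 ^ n)) = ennreal 1 + ennreal (\<Sum>n\<in>?A. 3 * 4 ^ n)"
      by (rule ennreal_plus) (auto intro: sum_nonneg)
    also have "ennreal (\<Sum>n\<in>?A. 3 * 4 ^ n) = (\<Sum>n\<in>?A. ennreal (3 * 4 ^ n))"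
      by (rule sum_ennreal[symmetric]) simp
    also have "\<dots> = (\<Sum>n\<in>?A. ennreal (3 * 4 ^ n) * of_bool (ring (e v) n \<le> rate (spec (e v)) * c))"
      by (intro sum.cong) auto
    finally show ?thesis by (simp only: ennreal_1)
  qed
  also have "\<dots> \<le> 1 + (\<Sum>n. ennreal (3 * 4 ^ n) * of_bool (ring (e v) n \<le> rate (spec (e v)) * c))"
    by (rule add_left_mono[OF sum_le_suminf[OF summableI fA]]) simp
  finally show ?thesis .
qed

lemma pred_ring_le: "Measurable.pred particle_space (\<lambda>q. ring q n \<le> rate (spec q) * c)"
  for rate :: "species \<Rightarrow> real"
  unfolding pred_def by (intro borel_measurable_le borel_measurable_times measurable_ring measurable_rate borel_measurable_const)

lemma activity_relabel: "activity rate a b (relabel_particle \<phi> q) = activity rate a b q"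
  by (cases "moves rate a b q") (simp_all add: activity_def)

context dlacs begin

lemma regular_envI: "regular (env \<omega>) \<Longrightarrow> regular_env rate (env \<omega>)"
  by (rule regular_env.intro) (rule rate_nonneg)

text \<open>Ring \<open>n\<close> has weight \<open>3 * 4 ^ n\<close> and occurs with probability at
  most a constant times \<open>(1 / 8) ^ Suc n\<close>, which leaves a series with terms of order
  \<open>(1 / 2) ^ n\<close>.\<close>

lemma jumps_square_finite: "(\<integral>\<^sup>+\<omega>. ennreal (real ((jumps rate (\<eta> x \<omega>) c + 1)\<^sup>2)) \<partial>P) < \<infinity>"
proof -
  \<comment> \<open>A level above \<open>rate s * c\<close> for both species, so that only the
    marginal law of the waiting times enters.\<close>
  define C where "C = max (rate TypeA * c) (rate TypeB * c)"
  have C: "rate s * c \<le> C" for s by (cases s) (auto simp: C_def)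
  have bound: "(\<integral>\<^sup>+\<omega>. ennreal (3 * 4 ^ n) * of_bool (ring (\<eta> x \<omega>) n \<le> rate (spec (\<eta> x \<omega>)) * c) \<partial>P) \<le>
     ennreal (3 / 8 * exp (7 * C) * (1 / 2) ^ n)" for n
  proof -
    have "(\<integral>\<^sup>+\<omega>. ennreal (3 * 4 ^ n) * of_bool (ring (\<eta> x \<omega>) n \<le> rate (spec (\<eta> x \<omega>)) * c) \<partial>P) \<le>
       (\<integral>\<^sup>+\<omega>. ennreal (3 * 4 ^ n) * indicator {w. (\<Sum>k\<le>n. w k) \<le> C} (wait (\<eta> x \<omega>)) \<partial>P)"
    proof (intro nn_integral_mono mult_left_mono)
      fix \<omega>
      show "of_bool (ring (\<eta> x \<omega>) n \<le> rate (spec (\<eta> x \<omega>)) * c) \<le> (indicator {w. (\<Sum>k\<le>n. w k) \<le> C} (wait (\<eta> x \<omega>)) :: ennreal)"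
        using C[of "spec (\<eta> x \<omega>)"] by (auto simp: indicator_def ring_def)
    qed simp
    also have "\<dots> = ennreal (3 * 4 ^ n) * (\<integral>\<^sup>+\<omega>. indicator {w. (\<Sum>k\<le>n. w k) \<le> C} (wait (\<eta> x \<omega>)) \<partial>P)"
      by (rule nn_integral_cmult) (simp add: indicator_def)
    also have "(\<integral>\<^sup>+\<omega>. indicator {w. (\<Sum>k\<le>n. w k) \<le> C} (wait (\<eta> x \<omega>)) \<partial>P) =
        (\<integral>\<^sup>+w. indicator {w. (\<Sum>k\<le>n. w k) \<le> C} w \<partial>wait_law)"
      unfolding distr_wait[of x, symmetric] by (subst nn_integral_distr) (auto simp: indicator_def)
    also have "\<dots> = (\<integral>\<^sup>+w. indicator {w \<in> space wait_law. (\<Sum>k\<le>n. w k) \<le> C} w \<partial>wait_law)"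
      by (intro nn_integral_cong) (auto simp: indicator_def)
    also have "\<dots> = emeasure wait_law {w \<in> space wait_law. (\<Sum>k\<le>n. w k) \<le> C}"
      by (rule nn_integral_indicator) measurable
    also have "ennreal (3 * 4 ^ n) * \<dots> \<le> ennreal (3 * 4 ^ n) * (ennreal (exp (7 * C)) * ennreal (1 / 8) ^ Suc n)"
      by (intro mult_left_mono wait_sum_tail) simp
    also have "ennreal (3 * 4 ^ n) * (ennreal (exp (7 * C)) * ennreal (1 / 8) ^ Suc n) =
        ennreal (3 / 8 * exp (7 * C) * (1 / 2) ^ n)"
    proof -
      have half: "(4 :: real) * (1 / 8) = 1 / 2" by simp
      have pow: "(4 :: real) ^ n * (1 / 8) ^ n = (1 / 2) ^ n"
        unfolding power_mult_distrib[symmetric] half ..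
      have "3 * A * (E * (1 / 8 * B)) = 3 / 8 * E * (A * B)" for A B E :: real by simp
      from this[of "4 ^ n" "exp (7 * C)" "(1 / 8) ^ n"]
      have eq: "3 * 4 ^ n * (exp (7 * C) * (1 / 8) ^ Suc n) = 3 / 8 * exp (7 * C) * (1 / 2) ^ n"
        unfolding power_Suc pow .
      have "ennreal (1 / 8) ^ Suc n = ennreal ((1 / 8) ^ Suc n)" by (rule ennreal_power) simp
      hence "ennreal (3 * 4 ^ n) * (ennreal (exp (7 * C)) * ennreal (1 / 8) ^ Suc n) =
          ennreal (3 * 4 ^ n) * ennreal (exp (7 * C) * (1 / 8) ^ Suc n)"
        by (simp only: ennreal_mult[OF exp_ge_zero zero_le_power[OF zero_le_divide_1_iff[THEN iffD2, OF zero_le_numeral]]])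
      also have "\<dots> = ennreal (3 * 4 ^ n * (exp (7 * C) * (1 / 8) ^ Suc n))"
        by (rule ennreal_mult[symmetric]) (intro mult_nonneg_nonneg zero_le_power exp_ge_zero; simp)+
      finally show ?thesis unfolding eq .
    qed
    finally show ?thesis .
  qed
  define f :: "nat \<Rightarrow> 'w \<Rightarrow> ennreal" where
    "f n \<omega> = ennreal (3 * 4 ^ n) * of_bool (ring (\<eta> x \<omega>) n \<le> rate (spec (\<eta> x \<omega>)) * c)" for n \<omega>
  have fm [measurable]: "f n \<in> borel_measurable P" for n
    unfolding f_def[abs_def]
    by (rule measurable_compose[OF measurable_compose[OF eta_meas pred_ring_le],
          of "\<lambda>b. ennreal (3 * 4 ^ n) * of_bool b" borel]) simp
  have "(\<integral>\<^sup>+\<omega>. ennreal (real ((jumps rate (\<eta> x \<omega>) c + 1)\<^sup>2)) \<partial>P) \<le> (\<integral>\<^sup>+\<omega>. 1 + (\<Sum>n. f n \<omega>) \<partial>P)"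
  proof (rule nn_integral_mono_AE)
    show "AE \<omega> in P. ennreal (real ((jumps rate (\<eta> x \<omega>) c + 1)\<^sup>2)) \<le> 1 + (\<Sum>n. f n \<omega>)"
      unfolding f_def using AE_regular by eventually_elim (rule regular_env.jumps_square_le[OF regular_envI])
  qed
  also have "\<dots> = (\<integral>\<^sup>+\<omega>. 1 \<partial>P) + (\<integral>\<^sup>+\<omega>. (\<Sum>n. f n \<omega>) \<partial>P)"
    by (rule nn_integral_add) measurable
  also have "\<dots> = 1 + (\<Sum>n. \<integral>\<^sup>+\<omega>. f n \<omega> \<partial>P)"
    using nn_integral_suminf[of f P] by (simp add: emeasure_space_1)
  also have "\<dots> \<le> 1 + (\<Sum>n. ennreal (3 / 8 * exp (7 * C) * (1 / 2) ^ n))"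
    using bound by (intro add_left_mono suminf_le) (auto simp: f_def)
  also have "\<dots> < \<infinity>"
  proof -
    have "summable (\<lambda>n. 3 / 8 * exp (7 * C) * (1 / 2 :: real) ^ n)" by (intro summable_mult summable_geometric) simp
    hence "(\<Sum>n. ennreal (3 / 8 * exp (7 * C) * (1 / 2) ^ n)) \<noteq> \<infinity>"
      unfolding infinity_ennreal_def by (rule ennreal_suminf_neq_top) simp
    hence "(\<Sum>n. ennreal (3 / 8 * exp (7 * C) * (1 / 2) ^ n)) < \<infinity>"
      unfolding infinity_ennreal_def by (rule less_top[THEN iffD1])
    thus ?thesis unfolding infinity_ennreal_def ennreal_add_less_top by simp
  qed
  finally show ?thesis .
qed

lemma AE_no_jump_at: "AE \<omega> in P. \<forall>n. ring (\<eta> x \<omega>) n \<noteq> rate (spec (\<eta> x \<omega>)) * t"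
proof -
  have "AE \<omega> in P. \<forall>n. (\<Sum>k\<le>n. wait (\<eta> x \<omega>) k) \<noteq> rate s * t" for s
    unfolding AE_all_countable by (intro allI AE_wait[OF AE_wait_sum_neq])
  from this[of TypeA] this[of TypeB] show ?thesis
  proof eventually_elim
    case (elim \<omega>)
    show ?case using elim by (cases "spec (\<eta> x \<omega>)") (simp_all add: ring_def)
  qed
qed

text \<open>On windows shrinking to \<open>t\<close> the activity is eventually 0, because almost
  surely no clock rings exactly at \<open>t\<close>; it is dominated by the integrable square of
  \<open>jumps_square_finite\<close>. Symmetries transfer the bound from one site to all.\<close>

lemma short_interval_activity:
  assumes "0 \<le> t"
  shows "\<exists>d>0. \<forall>a b. a \<le> t \<and> t \<le> b \<and> b - a < d \<longrightarrow> (\<forall>x. (\<integral>\<^sup>+\<omega>. activity rate a b (\<eta> x \<omega>) \<partial>P) \<le> ennreal (1 / 2))"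
proof -
  fix x0 :: 'v
  let ?d = "\<lambda>i. 1 / real (Suc i)"
  define u where "u i \<omega> = activity rate (t - ?d i) (t + ?d i) (\<eta> x0 \<omega>)" for i \<omega>
  have act_mono: "activity rate a b (env \<omega> x) \<le> activity rate a' b' (env \<omega> x)" if "regular (env \<omega>)" "a' \<le> a" "b \<le> b'" "a \<le> b" for a b a' b' \<omega> x
  proof -
    interpret regular_env rate cap "env \<omega>" using that(1) by (rule regular_envI)
    have j: "jumps rate (env \<omega> x) a' \<le> jumps rate (env \<omega> x) a" "jumps rate (env \<omega> x) a \<le> jumps rate (env \<omega> x) b"
      "jumps rate (env \<omega> x) b \<le> jumps rate (env \<omega> x) b'"
      using that by (intro jumps_mono; simp)+
    have "(jumps rate (env \<omega> x) b - jumps rate (env \<omega> x) a + 1)\<^sup>2 \<le> (jumps rate (env \<omega> x) b' - jumps rate (env \<omega> x) a' + 1)\<^sup>2"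
      using j by (intro power_mono) auto
    hence "ennreal (real ((jumps rate (env \<omega> x) b - jumps rate (env \<omega> x) a + 1)\<^sup>2)) \<le> 
      ennreal (real ((jumps rate (env \<omega> x) b' - jumps rate (env \<omega> x) a' + 1)\<^sup>2))"
      by (intro ennreal_leI) (simp only: of_nat_le_iff)
    thus ?thesis using j by (auto simp: activity_def moves_def)
  qed
  have "(\<lambda>i. \<integral>\<^sup>+\<omega>. u i \<omega> \<partial>P) \<longlonglongrightarrow> (\<integral>\<^sup>+\<omega>. 0 \<partial>P)"
  proof (rule nn_integral_dominated_convergence[where w = "\<lambda>\<omega>. ennreal (real ((jumps rate (\<eta> x0 \<omega>) (t + 1) + 1)\<^sup>2))"])
    show "u i \<in> borel_measurable P" for i unfolding u_def by measurable
    show "(\<lambda>\<omega>. ennreal (real ((jumps rate (\<eta> x0 \<omega>) (t + 1) + 1)\<^sup>2))) \<in> borel_measurable P"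
      by (rule measurable_compose[of "\<lambda>\<omega>. jumps rate (\<eta> x0 \<omega>) (t + 1)" _ "count_space UNIV" "\<lambda>n. ennreal (real ((n + 1)\<^sup>2))"]) simp_all
    show "(\<integral>\<^sup>+\<omega>. ennreal (real ((jumps rate (\<eta> x0 \<omega>) (t + 1) + 1)\<^sup>2)) \<partial>P) < \<infinity>"
      by (rule jumps_square_finite)
    show "AE \<omega> in P. u i \<omega> \<le> ennreal (real ((jumps rate (\<eta> x0 \<omega>) (t + 1) + 1)\<^sup>2))" for i
      using AE_regular
    proof eventually_elim
      case (elim \<omega>)
      interpret regular_env rate cap "env \<omega>" using elim by (rule regular_envI)
      have "jumps rate (env \<omega> x0) (t + ?d i) \<le> jumps rate (env \<omega> x0) (t + 1)" by (intro jumps_mono) simp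
      hence "(jumps rate (\<eta> x0 \<omega>) (t + ?d i) - jumps rate (\<eta> x0 \<omega>) (t - ?d i) + 1)\<^sup>2 \<le> (jumps rate (\<eta> x0 \<omega>) (t + 1) + 1)\<^sup>2"
        by (intro power_mono) auto
      hence "ennreal (real ((jumps rate (\<eta> x0 \<omega>) (t + ?d i) - jumps rate (\<eta> x0 \<omega>) (t - ?d i) + 1)\<^sup>2)) 
        \<le> ennreal (real ((jumps rate (\<eta> x0 \<omega>) (t + 1) + 1)\<^sup>2))"
        by (intro ennreal_leI) (simp only: of_nat_le_iff)
      thus ?case by (auto simp: u_def activity_def)
    qed
    show "AE \<omega> in P. (\<lambda>i. u i \<omega>) \<longlonglongrightarrow> 0"
      using AE_regular AE_no_jump_at[of x0 t]
    proof eventually_elim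
      case (elim \<omega>)
      let ?q = "\<eta> x0 \<omega>" let ?r = "rate (spec ?q)"
      have d0: "?d \<longlonglongrightarrow> 0" using LIMSEQ_inverse_real_of_nat by (simp add: inverse_eq_divide)
      have lim: "(\<lambda>i. ?r * (t - ?d i)) \<longlonglongrightarrow> ?r * (t - 0)" "(\<lambda>i. ?r * (t + ?d i)) \<longlonglongrightarrow> ?r * (t + 0)"
        by (intro tendsto_intros d0)+
      have "\<forall>\<^sub>F i in sequentially. ring ?q k \<le> ?r * (t - ?d i) \<longleftrightarrow> ring ?q k \<le> ?r * (t + ?d i)" for k
      proof (cases "ring ?q k < ?r * t")
        case True
        have "\<forall>\<^sub>F i in sequentially. ring ?q k < ?r * (t - ?d i)" "\<forall>\<^sub>F i in sequentially. ring ?q k < ?r * (t + ?d i)"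
          using lim True by (auto intro: order_tendstoD)
        thus ?thesis by eventually_elim simp
      next
        case False
        hence "?r * t < ring ?q k" using elim(2) by (meson linorder_neqE_linordered_idom)
        hence "\<forall>\<^sub>F i in sequentially. ?r * (t - ?d i) < ring ?q k" "\<forall>\<^sub>F i in sequentially. ?r * (t + ?d i) < ring ?q k"
          using lim by (auto intro: order_tendstoD)
        thus ?thesis by eventually_elim simp
      qed
      \<comment> \<open>Only the finitely many rings up to time \<open>t + 1\<close> matter, which
        makes the eventual statement uniform in \<open>k\<close>.\<close>
      moreover have fin: "finite {k. ring ?q k \<le> ?r * (t + 1)}" using elim(1) by (simp add: regular_def)
      ultimately have "\<forall>\<^sub>F i in sequentially. \<forall>k\<in>{k. ring ?q k \<le> ?r * (t + 1)}.
           ring ?q k \<le> ?r * (t - ?d i) \<longleftrightarrow> ring ?q k \<le> ?r * (t + ?d i)"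
        by (intro eventually_ball_finite) auto
      hence "\<forall>\<^sub>F i in sequentially. u i \<omega> = 0"
      proof eventually_elim
        case (elim i)
        have "0 \<le> ?d i" "?d i \<le> 1" by simp_all
        hence "?r * (t - ?d i) \<le> ?r * (t + 1)" "?r * (t + ?d i) \<le> ?r * (t + 1)"
          by (intro mult_left_mono rate_nonneg; linarith)+
        hence "{k. ring ?q k \<le> ?r * (t - ?d i)} = {k. ring ?q k \<le> ?r * (t + ?d i)}"
          using elim by (auto intro: order_trans)
        thus ?case by (simp add: u_def activity_def moves_def jumps_def)
      qed
      thus ?case by (rule tendsto_eventually)
    qed
  qed simp
  hence "(\<lambda>i. \<integral>\<^sup>+\<omega>. u i \<omega> \<partial>P) \<longlonglongrightarrow> 0" by simp
  hence "\<forall>\<^sub>F i in sequentially. (\<integral>\<^sup>+\<omega>. u i \<omega> \<partial>P) < ennreal (1 / 2)"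
    by (rule order_tendstoD) (subst ennreal_less_zero_iff, simp)
  then obtain i where i: "(\<integral>\<^sup>+\<omega>. u i \<omega> \<partial>P) < ennreal (1 / 2)"
    using eventually_happens'[OF sequentially_bot] by blast
  show ?thesis
  \<comment> \<open>An interval that contains \<open>t\<close> and is shorter than
    \<open>?d i\<close> lies inside the window from \<open>t - ?d i\<close> to
    \<open>t + ?d i\<close>.\<close>
  proof (intro exI[of _ "?d i"] conjI allI impI)
    fix a b x assume ab: "a \<le> t \<and> t \<le> b \<and> b - a < ?d i"
    obtain \<phi> where \<phi>: "\<phi> \<in> \<Gamma>" "\<phi> x0 = x" using transitive by (auto simp: transitive_on_def maps_to_def)
    have "(\<integral>\<^sup>+\<omega>. activity rate a b (\<eta> (\<phi> x0) \<omega>) \<partial>P) = (\<integral>\<^sup>+\<omega>. activity rate a b (relabel_particle \<phi> (\<eta> x0 \<omega>)) \<partial>P)"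
      by (rule particle_invariant[OF \<phi>(1)]) measurable
    also have "\<dots> = (\<integral>\<^sup>+\<omega>. activity rate a b (\<eta> x0 \<omega>) \<partial>P)"
      by (simp only: activity_relabel)
    also have "\<dots> \<le> (\<integral>\<^sup>+\<omega>. u i \<omega> \<partial>P)"
    proof (rule nn_integral_mono_AE)
      show "AE \<omega> in P. activity rate a b (\<eta> x0 \<omega>) \<le> u i \<omega>"
        using AE_regular by eventually_elim (use ab in \<open>auto simp: u_def intro!: act_mono\<close>)
    qed
    finally show "(\<integral>\<^sup>+\<omega>. activity rate a b (\<eta> x \<omega>) \<partial>P) \<le> ennreal (1 / 2)" using i \<phi>(2) by simp
  qed simp
qed

text \<open>By \<open>sum_visited\<close> the expected number of visitors equals the expected size
  of one range, which is finite.\<close>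

lemma AE_finite_visitors: "AE \<omega> in P. finite {v. x \<in> visited rate a b (\<eta> v \<omega>)}"
proof -
  have "(\<integral>\<^sup>+\<omega>. \<integral>\<^sup>+v. of_bool (x \<in> visited rate a b (\<eta> v \<omega>)) \<partial>count_space UNIV \<partial>P) =
    (\<integral>\<^sup>+v. \<integral>\<^sup>+\<omega>. of_bool (x \<in> visited rate a b (\<eta> v \<omega>)) \<partial>P \<partial>count_space UNIV)"
    by (rule nn_integral_count_space_nn_integral[OF cnt]) measurable
  also have "\<dots> = (\<integral>\<^sup>+\<omega>. of_nat (card (visited rate a b (\<eta> x \<omega>))) \<partial>P)" by (rule sum_visited)
  also have "\<dots> \<le> (\<integral>\<^sup>+\<omega>. ennreal (real ((jumps rate (\<eta> x \<omega>) b + 1)\<^sup>2)) \<partial>P)"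
  proof (intro nn_integral_mono)
    fix \<omega>
    have "card (visited rate a b (\<eta> x \<omega>)) \<le> jumps rate (\<eta> x \<omega>) b + 1"
      using card_visited[of rate a b "\<eta> x \<omega>"] by linarith
    also have "\<dots> \<le> (jumps rate (\<eta> x \<omega>) b + 1)\<^sup>2" by (simp add: power2_eq_square)
    finally show "of_nat (card (visited rate a b (\<eta> x \<omega>))) \<le> ennreal (real ((jumps rate (\<eta> x \<omega>) b + 1)\<^sup>2))"
      unfolding ennreal_of_nat_eq_real_of_nat by (intro ennreal_leI) (simp only: of_nat_le_iff)
  qed
  also have "\<dots> < \<infinity>" by (rule jumps_square_finite)
  finally have "(\<integral>\<^sup>+\<omega>. \<integral>\<^sup>+v. of_bool (x \<in> visited rate a b (\<eta> v \<omega>)) \<partial>count_space UNIV \<partial>P) \<noteq> \<infinity>" by simp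
  hence "AE \<omega> in P. (\<integral>\<^sup>+v. of_bool (x \<in> visited rate a b (\<eta> v \<omega>)) \<partial>count_space UNIV) \<noteq> \<infinity>"
    by (intro nn_integral_PInf_AE borel_measurable_sum_countable[OF cnt]) measurable
  thus ?thesis
  proof eventually_elim
    case (elim \<omega>)
    have "(\<integral>\<^sup>+v. of_bool (x \<in> visited rate a b (\<eta> v \<omega>)) \<partial>count_space UNIV) = 
      (\<integral>\<^sup>+v. indicator {v. x \<in> visited rate a b (\<eta> v \<omega>)} v \<partial>count_space UNIV)"
      by (intro nn_integral_cong) (auto simp: indicator_def)
    hence ne: "emeasure (count_space UNIV) {v. x \<in> visited rate a b (\<eta> v \<omega>)} \<noteq> \<infinity>" using elim by simp
    show ?case
    proof (rule ccontr)
      assume "infinite {v. x \<in> visited rate a b (\<eta> v \<omega>)}"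
      from emeasure_count_space_infinite[OF subset_UNIV this] ne show False by contradiction
    qed
  qed
qed

lemma AE_stable_step:
  assumes act: "\<And>x. (\<integral>\<^sup>+\<omega>. activity rate a b (\<eta> x \<omega>) \<partial>P) \<le> ennreal (1 / 2)" and "a \<le> b"
    and st: "AE \<omega> in P. regular_env.stable rate cap (env \<omega>) a"
  shows "AE \<omega> in P. regular_env.stable rate cap (env \<omega>) b"
proof -
  have "AE \<omega> in P. \<forall>x\<in>UNIV. finite {y. (\<lambda>x y. \<exists>v. link rate a b (\<eta> v \<omega>) x y)\<^sup>*\<^sup>* x y} \<and> finite {v. x \<in> visited rate a b (\<eta> v \<omega>)}"
    by (subst AE_ball_countable[OF cnt]) (intro ballI AE_conjI AE_finite_reach act AE_finite_visitors)
  with AE_regular st show ?thesis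
  proof eventually_elim
    case (elim \<omega>)
    interpret regular_env rate cap "env \<omega>" using elim(1) by (rule regular_envI)
    have "finite {w. (touch a b)\<^sup>*\<^sup>* l w}" for l
      using elim(3) by (intro finite_touch[OF assms(2)]) auto
    thus ?case using stable_step[OF elim(2) assms(2)] by blast
  qed
qed

text \<open>The interval length given by \<open>short_interval_activity\<close> depends on the time
  around which it is taken, so no uniform step size is at hand. \<open>Bolzano\<close> is applied to
  the transitive relation that stability at \<open>a\<close> implies stability at
  \<open>b\<close>.\<close>

theorem AE_stable:
  assumes "0 \<le> t"
  shows "AE \<omega> in P. regular_env.stable rate cap (env \<omega>) t"
proof -
  let ?S = "\<lambda>s. AE \<omega> in P. regular_env.stable rate cap (env \<omega>) s"
  have "a \<le> b \<Longrightarrow> ?S a \<Longrightarrow> ?S b" if "0 \<le> a" "a \<le> b" for a b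
    using that(2)
  proof (induction a b rule: Bolzano)
    case (trans a b c)
    thus ?case by blast
  next
    case (local x)
    have "0 \<le> x" using local(1) that(1) by simp
    from short_interval_activity[OF this] obtain d where d: "d > 0"
      "\<forall>a b. a \<le> x \<and> x \<le> b \<and> b - a < d \<longrightarrow> (\<forall>x. (\<integral>\<^sup>+\<omega>. activity rate a b (\<eta> x \<omega>) \<partial>P) \<le> ennreal (1 / 2))"
      by (elim exE conjE)
    show ?case
    proof (intro exI[of _ d] conjI allI impI d(1))
      fix a b assume "a \<le> x \<and> x \<le> b \<and> b - a < d" "?S a"
      thus "?S b" using d(2) by (intro AE_stable_step[of a b]) auto
    qed
  qed
  moreover have "?S 0"
    using AE_regular by eventually_elim (rule regular_env.stable_0[OF regular_envI])
  ultimately show ?thesis using assms by blast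
qed

end

section \<open>Occupation times\<close>

context regular_env begin

text \<open>The filter is proper, so whatever holds eventually holds in some actual finite system.
  In this way the limit inherits the properties proved for finite systems.\<close>

lemma eventually_sys: "(\<forall>\<^sub>F F in finite_subsets_at_top (UNIV :: 'v set). Q F) \<Longrightarrow> \<exists>F. finite F \<and> Q F"
  using eventually_happens'[OF finite_subsets_at_top_neq_bot eventually_conj[OF eventually_finite_sets]] by blast

lemma follows_unique:
  assumes "follows rate cap e t v l" "follows rate cap e t v m" shows "l = m"
  using eventually_sys[OF eventually_conj[OF assms[unfolded follows_def]]] by auto

lemma follows_not_destroyed:
  assumes "follows rate cap e t v l" shows "\<not> destroyed rate cap e t v"
proof
  assume "destroyed rate cap e t v"
  from eventually_sys[OF eventually_conj[OF assms[unfolded follows_def] this[unfolded destroyed_def]]] show False by auto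
qed

lemma follows_species:
  assumes "follows rate cap e t v l" shows "spec (e v) = spec (e l)"
proof -
  obtain F where F: "finite F" "fst (sys F t) v = Some l"
    using eventually_sys[OF assms[unfolded follows_def]] by (elim exE conjE)
  show ?thesis by (rule finite_system_species[OF F(1) finite_jtimes[OF F(1)] F(2)])
qed

lemma stable_follows:
  assumes "stable t" "\<not> destroyed rate cap e t v" shows "\<exists>l. follows rate cap e t v l"
proof -
  obtain c R where cR: "\<forall>\<^sub>F F in finite_subsets_at_top UNIV. fst (sys F t) v = c \<and> snd (sys F t) `` {v} = R"
    using assms(1) unfolding stable_def by blast
  have c: "\<forall>\<^sub>F F in finite_subsets_at_top UNIV. fst (sys F t) v = c"
    using cR by eventually_elim (rule conjunct1)
  show ?thesis
  proof (cases c)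
    case None
    thus ?thesis using c assms(2) by (simp add: destroyed_def)
  next
    case (Some l)
    thus ?thesis using c by (auto simp: follows_def)
  qed
qed

text \<open>The partner must be the same in all large finite systems. This comes from
  \<open>stable\<close>, under which the whole set of partners of \<open>v\<close> is eventually
  constant.\<close>

lemma stable_annihilated:
  assumes "stable t" "0 \<le> t" "destroyed rate cap e t v"
  shows "\<exists>w. spec (e w) \<noteq> spec (e v) \<and> annihilates rate cap e v w"
proof -
  obtain c R where cR: "\<forall>\<^sub>F F in finite_subsets_at_top UNIV. fst (sys F t) v = c \<and> snd (sys F t) `` {v} = R"
    using assms(1) unfolding stable_def by blast
  have "\<forall>\<^sub>F F in finite_subsets_at_top UNIV. v \<in> F"
    by (auto simp: eventually_finite_subsets_at_top intro!: exI[of _ "{v}"])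
  from eventually_sys[OF eventually_conj[OF cR eventually_conj[OF this assms(3)[unfolded destroyed_def]]]]
  obtain F where F: "finite F" "v \<in> F" "fst (sys F t) v = None" "snd (sys F t) `` {v} = R" by blast
  obtain w where w: "(v, w) \<in> snd (sys F t)" "spec (e w) \<noteq> spec (e v)"
    using finite_system_partner[OF F(1) finite_jtimes[OF F(1)]] F(2,3) by blast
  have "\<forall>\<^sub>F F in finite_subsets_at_top UNIV. (v, w) \<in> snd (sys F t)"
    using cR by eventually_elim (use F(4) w(1) in blast)
  thus ?thesis using w(2) assms(2) unfolding annihilates_def by blast
qed

text \<open>A finite set of followers is contained in the cluster of \<open>l\<close> in a single
  finite system, where the bound is known; an infinite set has \<open>card\<close> 0.\<close>

lemma card_followers_le:
  assumes "cap TypeA = enat M" "1 \<le> M" "spec (e l) = TypeA"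
  shows "card {v. follows rate cap e t v l} \<le> 2 * M"
proof (cases "finite {v. follows rate cap e t v l}")
  case True
  have "\<forall>\<^sub>F F in finite_subsets_at_top UNIV. \<forall>v\<in>{v. follows rate cap e t v l}. fst (sys F t) v = Some l"
    by (rule eventually_ball_finite[OF True]) (auto simp: follows_def)
  from eventually_sys[OF this] obtain F where F: "finite F" 
    "\<forall>v\<in>{v. follows rate cap e t v l}. fst (sys F t) v = Some l" by blast
  have "cluster (sys F t) l \<subseteq> F" 
    using supported_sys[OF F(1), of t] by (auto simp: supported_def cluster_def)
  hence "finite (cluster (sys F t) l)" using F(1) by (rule finite_subset)
  hence "card {v. follows rate cap e t v l} \<le> card (cluster (sys F t) l)"
    by (rule card_mono) (use F(2) in \<open>auto simp: cluster_def\<close>)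
  also have "\<dots> \<le> 2 * M"
    by (rule finite_system_cluster_bound[where rate = rate and cap = cap and e = e, OF F(1) finite_jtimes[OF F(1)] assms])
  finally show ?thesis .
qed simp

end

section \<open>Counting original particles by clusters\<close>

lemma sum_by_size:
  fixes g :: "'a \<Rightarrow> nat"
  assumes "finite L" "\<And>l. l \<in> L \<Longrightarrow> 1 \<le> g l \<and> g l \<le> n"
  shows "(\<Sum>i<n. Suc i * card {l \<in> L. g l = Suc i}) = (\<Sum>l\<in>L. g l)"
proof -
  have "(\<Sum>i<n. Suc i * card {l \<in> L. g l = Suc i}) = (\<Sum>i<n. \<Sum>l\<in>L. if g l = Suc i then Suc i else 0)"
  proof (rule sum.cong[OF refl])
    fix i
    have "(\<Sum>l\<in>L. if g l = Suc i then Suc i else 0) = (\<Sum>l\<in>{l \<in> L. g l = Suc i}. Suc i)"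
      using assms(1) by (rule sum.inter_filter[symmetric])
    thus "Suc i * card {l \<in> L. g l = Suc i} = (\<Sum>l\<in>L. if g l = Suc i then Suc i else 0)" by simp
  qed
  also have "\<dots> = (\<Sum>l\<in>L. \<Sum>i<n. if g l = Suc i then Suc i else 0)" by (rule sum.swap)
  also have "\<dots> = (\<Sum>l\<in>L. g l)"
  proof (rule sum.cong[OF refl])
    fix l assume l: "l \<in> L"
    have "(\<Sum>i<n. if g l = Suc i then Suc i else 0) = (\<Sum>i<n. if i = g l - 1 then g l else 0)"
      using assms(2)[OF l] by (intro sum.cong) auto
    also have "\<dots> = g l" using assms(2)[OF l] by auto
    finally show "(\<Sum>i<n. if g l = Suc i then Suc i else 0) = g l" .
  qed
  finally show ?thesis .
qed

text \<open>A cluster of size \<open>i\<close> at \<open>x\<close> accounts for \<open>i\<close> of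
  the original particles in \<open>U t x\<close>, and the clusters partition this set. Its
  finiteness matters since \<open>xi\<close> is built from \<open>card\<close>, which is 0 on
  infinite sets.\<close>

lemma (in regular_env) weighted_sum_xi:
  defines "U \<equiv> \<lambda>t x. {v. spec (e v) = TypeA \<and> (\<exists>l. follows rate cap e t v l \<and> position rate e l t = x)}"
  assumes fin: "finite (U t x)"
  shows "(\<Sum>i. of_nat (Suc i) * of_nat (xi rate cap e (Suc i) t x)) = (of_nat (card (U t x)) :: ennreal)"
proof -
  define C where "C l = {v. follows rate cap e t v l}" for l
  define L where "L = {l. spec (e l) = TypeA \<and> position rate e l t = x \<and> C l \<noteq> {}}"
  have CU: "C l \<subseteq> U t x" if "l \<in> L" for l
    using that follows_species by (auto simp: L_def C_def U_def)
  have fC: "finite (C l)" if "l \<in> L" for l using CU[OF that] fin by (rule finite_subset)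
  have disj: "C l \<inter> C m = {}" if "l \<noteq> m" for l m
    using that follows_unique by (auto simp: C_def)
  have UC: "U t x = (\<Union>l\<in>L. C l)"
    using CU follows_species by (fastforce simp: L_def C_def U_def)
  have fL: "finite L"
  proof -
    \<comment> \<open>A leader is recovered from any of its followers, so there are no more leaders
      than members of \<open>U t x\<close>.\<close>
    have "L \<subseteq> (\<lambda>v. THE l. follows rate cap e t v l) ` U t x"
    proof
      fix l assume l: "l \<in> L"
      then obtain v where v: "v \<in> C l" by (auto simp: L_def)
      have "(THE l. follows rate cap e t v l) = l"
        by (rule the_equality) (use v follows_unique in \<open>auto simp: C_def\<close>)
      thus "l \<in> (\<lambda>v. THE l. follows rate cap e t v l) ` U t x" using CU[OF l] v by blast
    qed
    thus ?thesis using fin by (meson finite_imageI finite_subset)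
  qed
  have xi: "xi rate cap e (Suc i) t x = card {l \<in> L. card (C l) = Suc i}" for i
  proof -
    have "C l \<noteq> {}" if "card (C l) = Suc i" for l using that by auto
    hence "{l. spec (e l) = TypeA \<and> position rate e l t = x \<and> card (C l) = Suc i} = {l \<in> L. card (C l) = Suc i}"
      unfolding L_def by blast
    thus ?thesis unfolding xi_def C_def by (simp only:)
  qed
  let ?n = "card (U t x)"
  have g: "1 \<le> card (C l) \<and> card (C l) \<le> ?n" if "l \<in> L" for l
    using that fC[OF that] card_mono[OF fin CU[OF that]] by (auto simp: L_def Suc_le_eq card_gt_0_iff)
  have "(\<Sum>i. of_nat (Suc i) * of_nat (xi rate cap e (Suc i) t x)) = 
      (\<Sum>i<?n. of_nat (Suc i) * (of_nat (xi rate cap e (Suc i) t x)) :: ennreal)"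
  proof (rule suminf_finite)
    fix i assume "i \<notin> {..<?n}"
    hence empty: "{l \<in> L. card (C l) = Suc i} = {}" using g by fastforce
    show "of_nat (Suc i) * of_nat (xi rate cap e (Suc i) t x) = (0 :: ennreal)"
      unfolding xi empty by (simp only: card.empty of_nat_0 mult_zero_right)
  qed simp
  also have "\<dots> = of_nat (\<Sum>i<?n. Suc i * card {l \<in> L. card (C l) = Suc i})"
    unfolding xi of_nat_sum of_nat_mult ..
  also have "(\<Sum>i<?n. Suc i * card {l \<in> L. card (C l) = Suc i}) = (\<Sum>l\<in>L. card (C l))"
    by (rule sum_by_size[OF fL g])
  also have "\<dots> = ?n"
    unfolding UC by (rule card_UN_disjoint[symmetric]) (use fL fC disj in auto)
  finally show ?thesis .
qed

context dlacs begin

abbreviation alive :: "'v \<Rightarrow> real \<Rightarrow> 'w \<Rightarrow> bool" where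
  "alive u t \<omega> \<equiv> spec (\<eta> u \<omega>) = TypeA \<and> \<not> destroyed rate cap (env \<omega>) t u"

text \<open>The indicator of this event is the transported mass. It is a predicate of the whole
  environment so that \<open>env_invariant\<close> applies to it.\<close>

definition sits :: "real \<Rightarrow> 'v \<Rightarrow> 'v \<Rightarrow> ('v \<Rightarrow> 'v particle) \<Rightarrow> bool" where
  "sits t u x e \<longleftrightarrow> spec (e u) = TypeA \<and> (\<exists>l. follows rate cap e t u l \<and> position rate e l t = x)"

lemma pred_sits: "Measurable.pred env_space (sits t u x)"
proof -
  interpret E: measurable_env "env_space :: ('v \<Rightarrow> 'v particle) measure" "\<lambda>e. e" "\<lambda>_. t" rate cap
    by unfold_locales (auto simp: cnt rate_nonneg)
  have 1: "Measurable.pred env_space (\<lambda>e. spec (e u) = TypeA)"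
    by (rule measurable_compose[of "\<lambda>e. e u" _ particle_space "\<lambda>q. spec q = TypeA"]) measurable
  have 2: "Measurable.pred env_space (\<lambda>e. position rate e l t = x)" for l
    by (rule measurable_compose[OF E.measurable_position[of "\<lambda>_. t"], of "\<lambda>y. y = x"]) auto
  have "Measurable.pred env_space (\<lambda>e. \<exists>l\<in>UNIV. follows rate cap e t u l \<and> position rate e l t = x)"
    by (rule pred_countable_Bex[OF cnt]) (rule pred_intros_logic E.pred_follows 2)+
  hence "Measurable.pred env_space (\<lambda>e. \<exists>l. follows rate cap e t u l \<and> position rate e l t = x)" by simp
  with 1 have "Measurable.pred env_space (\<lambda>e. spec (e u) = TypeA \<and> (\<exists>l. follows rate cap e t u l \<and> position rate e l t = x))"
    by (rule pred_intros_logic)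
  thus ?thesis unfolding sits_def[abs_def] .
qed

lemma sits_measurable: "(\<lambda>\<omega>. of_bool (sits t u x (env \<omega>)) :: ennreal) \<in> borel_measurable P"
  by (rule measurable_compose[OF measurable_compose[OF env_meas pred_sits], of of_bool]) simp

lemma sits_relabel:
  assumes "regular e" "bij \<phi>"
  shows "sits t (\<phi> u) (\<phi> x) (relabel \<phi> e) \<longleftrightarrow> sits t u x e"
proof -
  have inj: "inj (\<lambda>v. bravery (e v))" using assms(1) by (simp add: regular_def)
  have ex: "(\<exists>l. Q l) \<longleftrightarrow> (\<exists>l. Q (\<phi> l))" for Q using assms(2) by (metis bij_pointE)
  show ?thesis
    unfolding sits_def ex[of "\<lambda>l. follows rate cap (relabel \<phi> e) t (\<phi> u) l \<and> position rate (relabel \<phi> e) l t = \<phi> x"]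
      follows_relabel[OF assms(2) inj] position_relabel[OF assms(2)] relabel_apply[OF assms(2)]
    using bij_is_inj[OF assms(2)] by (simp add: inj_eq)
qed

lemma expected_weighted_sum:
  assumes t: "0 \<le> t"
  shows "(\<integral>\<^sup>+\<omega>. (\<Sum>i. of_nat (Suc i) * of_nat (xi rate cap (env \<omega>) (Suc i) t x)) \<partial>P) = (\<integral>\<^sup>+\<omega>. of_bool (alive x t \<omega>) \<partial>P)"
proof -
  define f where "f u x = (\<integral>\<^sup>+\<omega>. of_bool (sits t u x (env \<omega>)) \<partial>P)" for u x
  have inv: "f (\<phi> u) (\<phi> x) = f u x" if \<phi>: "\<phi> \<in> \<Gamma>" for \<phi> u x
  proof -
    have "f (\<phi> u) (\<phi> x) = (\<integral>\<^sup>+\<omega>. of_bool (sits t (\<phi> u) (\<phi> x) (relabel \<phi> (env \<omega>))) \<partial>P)"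
      unfolding f_def
      by (rule env_invariant[OF \<phi>, where f = "\<lambda>e. of_bool (sits t (\<phi> u) (\<phi> x) e)", symmetric])
        (rule measurable_compose[OF pred_sits, of of_bool], simp)
    also have "\<dots> = f u x"
      unfolding f_def
    proof (rule nn_integral_cong_AE)
      show "AE \<omega> in P. of_bool (sits t (\<phi> u) (\<phi> x) (relabel \<phi> (env \<omega>))) = (of_bool (sits t u x (env \<omega>)) :: ennreal)"
        using AE_regular by eventually_elim (simp only: sits_relabel[OF _ bij_sym[OF \<phi>]])
    qed
    finally show ?thesis .
  qed
  have out: "(\<integral>\<^sup>+y. f x y \<partial>count_space UNIV) = (\<integral>\<^sup>+\<omega>. of_bool (alive x t \<omega>) \<partial>P)"
  proof -
    have "(\<integral>\<^sup>+y. f x y \<partial>count_space UNIV) = (\<integral>\<^sup>+\<omega>. \<integral>\<^sup>+y. of_bool (sits t x y (env \<omega>)) \<partial>count_space UNIV \<partial>P)"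
      unfolding f_def by (rule nn_integral_count_space_nn_integral[OF cnt sits_measurable, symmetric])
    also have "\<dots> = (\<integral>\<^sup>+\<omega>. of_bool (alive x t \<omega>) \<partial>P)"
    proof (rule nn_integral_cong_AE)
      show "AE \<omega> in P. (\<integral>\<^sup>+y. of_bool (sits t x y (env \<omega>)) \<partial>count_space UNIV) = (of_bool (alive x t \<omega>) :: ennreal)"
        using AE_regular AE_stable[OF t]
      proof eventually_elim
        case (elim \<omega>)
        interpret regular_env rate cap "env \<omega>" using elim(1) by (rule regular_envI)
        show ?case
        proof (cases "alive x t \<omega>")
          case True
          then obtain l where l: "follows rate cap (env \<omega>) t x l" using stable_follows[OF elim(2)] by blast
          have "sits t x y (env \<omega>) \<longleftrightarrow> y = position rate (env \<omega>) l t" for y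
          proof
            assume "sits t x y (env \<omega>)"
            then obtain m where m: "follows rate cap (env \<omega>) t x m" "position rate (env \<omega>) m t = y"
              unfolding sits_def by blast
            show "y = position rate (env \<omega>) l t" using follows_unique[OF l m(1)] m(2) by simp
          next
            assume "y = position rate (env \<omega>) l t"
            thus "sits t x y (env \<omega>)" using True l unfolding sits_def by blast
          qed
          hence "(\<integral>\<^sup>+y. of_bool (sits t x y (env \<omega>)) \<partial>count_space UNIV) = 
            (\<integral>\<^sup>+y. (indicator {position rate (env \<omega>) l t} y :: ennreal) \<partial>count_space UNIV)"
            by (intro nn_integral_cong) (simp only: indicator_def singleton_iff)
          also have "\<dots> = of_bool (alive x t \<omega>)" using True by simp
          finally show ?thesis .
        next
          case False
          hence "\<not> sits t x y (env \<omega>)" for y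
            using follows_not_destroyed by (auto simp: sits_def)
          hence "(\<integral>\<^sup>+y. of_bool (sits t x y (env \<omega>)) \<partial>count_space UNIV) = 0" by simp
          thus ?thesis using False by (simp only: of_bool_def if_False)
        qed
      qed
    qed
    finally show ?thesis .
  qed
  have "(\<integral>\<^sup>+u. f u x \<partial>count_space UNIV) = (\<integral>\<^sup>+\<omega>. \<integral>\<^sup>+u. of_bool (sits t u x (env \<omega>)) \<partial>count_space UNIV \<partial>P)"
    unfolding f_def by (rule nn_integral_count_space_nn_integral[OF cnt sits_measurable, symmetric])
  hence in_eq: "(\<integral>\<^sup>+\<omega>. \<integral>\<^sup>+u. of_bool (sits t u x (env \<omega>)) \<partial>count_space UNIV \<partial>P) = (\<integral>\<^sup>+\<omega>. of_bool (alive x t \<omega>) \<partial>P)"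
    using transport[of f x] inv out by simp
  \<comment> \<open>The expected mass received is at most 1, so almost surely only finitely many
    original particles sit at \<open>x\<close>, as \<open>weighted_sum_xi\<close> requires.\<close>
  have "(\<integral>\<^sup>+\<omega>. of_bool (alive x t \<omega>) \<partial>P) \<le> (\<integral>\<^sup>+\<omega>. 1 \<partial>P)" by (intro nn_integral_mono) simp
  also have "\<dots> < \<infinity>" by (simp add: emeasure_space_1)
  finally have "(\<integral>\<^sup>+\<omega>. \<integral>\<^sup>+u. of_bool (sits t u x (env \<omega>)) \<partial>count_space UNIV \<partial>P) \<noteq> \<infinity>"
    unfolding in_eq by simp
  hence fin: "AE \<omega> in P. (\<integral>\<^sup>+u. of_bool (sits t u x (env \<omega>)) \<partial>count_space UNIV) \<noteq> (\<infinity> :: ennreal)"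
    by (intro nn_integral_PInf_AE borel_measurable_sum_countable[OF cnt] sits_measurable)
  have "(\<integral>\<^sup>+\<omega>. (\<Sum>i. of_nat (Suc i) * of_nat (xi rate cap (env \<omega>) (Suc i) t x)) \<partial>P) =
     (\<integral>\<^sup>+\<omega>. \<integral>\<^sup>+u. of_bool (sits t u x (env \<omega>)) \<partial>count_space UNIV \<partial>P)"
  proof (rule nn_integral_cong_AE)
    show "AE \<omega> in P. (\<Sum>i. of_nat (Suc i) * of_nat (xi rate cap (env \<omega>) (Suc i) t x)) =
       (\<integral>\<^sup>+u. of_bool (sits t u x (env \<omega>)) \<partial>count_space UNIV)"
      using AE_regular fin
    proof eventually_elim
      case (elim \<omega>)
      interpret regular_env rate cap "env \<omega>" using elim(1) by (rule regular_envI)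
      let ?U = "{u. sits t u x (env \<omega>)}"
      have eq: "(\<integral>\<^sup>+u. of_bool (sits t u x (env \<omega>)) \<partial>count_space UNIV) = (emeasure (count_space UNIV) ?U :: ennreal)"
      proof -
        have "(\<integral>\<^sup>+u. of_bool (sits t u x (env \<omega>)) \<partial>count_space UNIV) = (\<integral>\<^sup>+u. indicator ?U u \<partial>count_space UNIV)"
          by (intro nn_integral_cong) (simp add: indicator_def)
        thus ?thesis by simp
      qed
      have finU: "finite ?U"
      proof (rule ccontr)
        assume "infinite ?U"
        from emeasure_count_space_infinite[OF subset_UNIV this] elim(2) eq show False by simp
      qed
      have "(\<Sum>i. of_nat (Suc i) * of_nat (xi rate cap (env \<omega>) (Suc i) t x)) = (of_nat (card ?U) :: ennreal)"
        using weighted_sum_xi[of t x] finU by (simp only: sits_def)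
      thus ?case unfolding eq using finU by simp
    qed
  qed
  thus ?thesis using in_eq by simp
qed

lemma prob_of_bool:
  assumes "Measurable.pred P Q"
  shows "(\<integral>\<^sup>+\<omega>. of_bool (Q \<omega>) \<partial>P) = ennreal (measure P {\<omega> \<in> space P. Q \<omega>})"
proof -
  have "(\<integral>\<^sup>+\<omega>. of_bool (Q \<omega>) \<partial>P) = (\<integral>\<^sup>+\<omega>. indicator {\<omega> \<in> space P. Q \<omega>} \<omega> \<partial>P)"
    by (intro nn_integral_cong) (simp add: indicator_def)
  also have "\<dots> = emeasure P {\<omega> \<in> space P. Q \<omega>}"
    using assms by (intro nn_integral_indicator) (simp add: pred_def)
  finally show ?thesis by (simp add: emeasure_eq_measure)
qed

section \<open>Integration over time and the final bounds\<close>

lemma env_P: "measurable_env P env (\<lambda>_. t) rate" for t :: real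
  by unfold_locales (auto simp: cnt rate_nonneg)

lemma env_pair:
  assumes "h \<in> borel_measurable borel"
  shows "measurable_env (P \<Otimes>\<^sub>M lborel) (\<lambda>z. env (fst z)) (\<lambda>z. h (snd z)) rate"
proof unfold_locales
  show "(\<lambda>z. env (fst z) v) \<in> measurable (P \<Otimes>\<^sub>M lborel) particle_space" for v
    by (rule measurable_compose[OF measurable_fst eta_meas])
  show "(\<lambda>z. h (snd z)) \<in> borel_measurable (P \<Otimes>\<^sub>M lborel)"
    by (rule measurable_compose[OF measurable_snd]) (use assms in simp)
qed (auto simp: cnt rate_nonneg)

lemma pred_alive_P: "Measurable.pred P (alive u t)"
  using measurable_env.pred_destroyed[OF env_P, of cap t u] measurable_compose[OF eta_meas[of u], of "\<lambda>q. spec q = TypeA"]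
  by (intro pred_intros_logic) auto

text \<open>The two events can differ only at the instant of destruction. For an infinite lifespan
  \<open>enn2real\<close> gives 0 and the excluded time is 0; in either case a single time is lost,
  which does not affect an integral.\<close>

lemma alive_lifespan:
  assumes "0 \<le> t" "t \<noteq> enn2real (lifespan rate cap (env \<omega>) u)"
  shows "alive u t \<omega> \<longleftrightarrow> ennreal t < lifespan rate cap (env \<omega>) u"
proof
  assume "ennreal t < lifespan rate cap (env \<omega>) u"
  then obtain n where n: "spec (\<eta> u \<omega>) = TypeA" "\<not> destroyed rate cap (env \<omega>) (t + 1 / real (Suc n)) u"
    unfolding lifespan_gt_iff[OF assms(1)] by blast
  have "\<not> destroyed rate cap (env \<omega>) t u"
  proof
    assume "destroyed rate cap (env \<omega>) t u"
    from destroyed_mono[OF this, of "t + 1 / real (Suc n)"] n(2) show False by simp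
  qed
  thus "alive u t \<omega>" using n(1) by simp
next
  assume a: "alive u t \<omega>"
  have "ennreal t \<le> lifespan rate cap (env \<omega>) u"
  proof -
    have "ennreal t \<le> (INF s\<in>{s. 0 \<le> s \<and> destroyed rate cap (env \<omega>) s u}. ennreal s)"
    proof (rule INF_greatest)
      fix s assume s: "s \<in> {s. 0 \<le> s \<and> destroyed rate cap (env \<omega>) s u}"
      hence "\<not> s \<le> t" using a destroyed_mono[of rate cap "env \<omega>" s u t] by (simp only: mem_Collect_eq) blast
      thus "ennreal t \<le> ennreal s" by (simp add: ennreal_leI)
    qed
    thus ?thesis using a by (simp add: lifespan_def)
  qed
  moreover have "ennreal t \<noteq> lifespan rate cap (env \<omega>) u" using assms by (metis enn2real_ennreal)
  ultimately show "ennreal t < lifespan rate cap (env \<omega>) u" by (simp add: order_less_le)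
qed

text \<open>For fixed \<open>\<omega>\<close> the two conditions agree at all but at most one time
  in \<open>{0..T}\<close>, so the integrals are compared after the order of integration has been
  exchanged.\<close>

lemma lifespan_integral:
  "(\<integral>\<^sup>+t\<in>{0..T}. ennreal (measure P {\<omega> \<in> space P. lifespan rate cap (env \<omega>) u > ennreal t}) \<partial>lborel) =
   (\<integral>\<^sup>+t\<in>{0..T}. ennreal (measure P {\<omega> \<in> space P. alive u t \<omega>}) \<partial>lborel)"
proof -
  interpret PL: pair_sigma_finite P lborel ..
  \<comment> \<open>\<open>pred_lifespan\<close> asks for a time that is nonnegative everywhere; on
    \<open>{0..T}\<close> the truncation changes nothing.\<close>
  interpret M: measurable_env "P \<Otimes>\<^sub>M lborel" "\<lambda>z. env (fst z)" "\<lambda>z. max 0 (snd z)" rate cap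
    by (rule env_pair) simp
  interpret M': measurable_env "P \<Otimes>\<^sub>M lborel" "\<lambda>z. env (fst z)" "\<lambda>z. snd z" rate cap
    by (rule env_pair[of "\<lambda>x. x"]) simp
  let ?lt = "\<lambda>\<omega> t. ennreal (max 0 t) < lifespan rate cap (env \<omega>) u"
  have ind: "(\<lambda>z. indicator {0..T} (snd z) :: ennreal) \<in> borel_measurable (P \<Otimes>\<^sub>M lborel)"
    by (rule measurable_compose[OF measurable_snd]) simp
  have m1: "(\<lambda>z. of_bool (?lt (fst z) (snd z)) * indicator {0..T} (snd z) :: ennreal) \<in> borel_measurable (P \<Otimes>\<^sub>M lborel)"
    by (intro borel_measurable_times_ennreal ind measurable_compose[OF M.pred_lifespan, of of_bool]) auto
  have spec: "Measurable.pred (P \<Otimes>\<^sub>M lborel) (\<lambda>z. spec (\<eta> u (fst z)) = TypeA)"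
    by (rule measurable_compose[OF measurable_compose[OF measurable_fst eta_meas[of u]], of "\<lambda>q. spec q = TypeA"]) measurable
  have al: "Measurable.pred (P \<Otimes>\<^sub>M lborel) (\<lambda>z. alive u (snd z) (fst z))"
    by (intro pred_intros_logic spec M'.pred_destroyed)
  have m2: "(\<lambda>z. of_bool (alive u (snd z) (fst z)) * indicator {0..T} (snd z) :: ennreal) \<in> borel_measurable (P \<Otimes>\<^sub>M lborel)"
    by (intro borel_measurable_times_ennreal ind measurable_compose[OF al, of of_bool]) auto
  have lt_P: "Measurable.pred P (\<lambda>\<omega>. ?lt \<omega> t)" for t
    by (rule measurable_env.pred_lifespan[OF env_P[of "max 0 t"]]) simp
  have "(\<integral>\<^sup>+t\<in>{0..T}. ennreal (measure P {\<omega> \<in> space P. lifespan rate cap (env \<omega>) u > ennreal t}) \<partial>lborel) =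
    (\<integral>\<^sup>+t. (\<integral>\<^sup>+\<omega>. of_bool (?lt \<omega> t) * indicator {0..T} t \<partial>P) \<partial>lborel)"
  proof (rule nn_integral_cong)
    fix t
    show "ennreal (measure P {\<omega> \<in> space P. lifespan rate cap (env \<omega>) u > ennreal t}) * indicator {0..T} t =
      (\<integral>\<^sup>+\<omega>. of_bool (?lt \<omega> t) * indicator {0..T} t \<partial>P)"
    proof (cases "t \<in> {0..T}")
      case True
      hence "max 0 t = t" by simp
      from prob_of_bool[OF lt_P[of t], unfolded this] show ?thesis using True by simp
    qed simp
  qed
  also have "\<dots> = (\<integral>\<^sup>+\<omega>. (\<integral>\<^sup>+t. of_bool (?lt \<omega> t) * indicator {0..T} t \<partial>lborel) \<partial>P)"
    by (rule PL.Fubini') (use m1 in \<open>simp add: case_prod_beta'\<close>)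
  also have "\<dots> = (\<integral>\<^sup>+\<omega>. (\<integral>\<^sup>+t. of_bool (alive u t \<omega>) * indicator {0..T} t \<partial>lborel) \<partial>P)"
  proof (rule nn_integral_cong, rule nn_integral_cong_AE)
    fix \<omega>
    show "AE t in lborel. of_bool (?lt \<omega> t) * indicator {0..T} t = (of_bool (alive u t \<omega>) * indicator {0..T} t :: ennreal)"
      using AE_lborel_singleton[of "enn2real (lifespan rate cap (env \<omega>) u)"]
    proof eventually_elim
      case (elim t)
      show ?case
      proof (cases "t \<in> {0..T}")
        case True
        hence "0 \<le> t" by simp
        from alive_lifespan[OF this elim] show ?thesis using \<open>0 \<le> t\<close> by (simp add: max_def)
      qed simp
    qed
  qed
  also have "\<dots> = (\<integral>\<^sup>+t. (\<integral>\<^sup>+\<omega>. of_bool (alive u t \<omega>) * indicator {0..T} t \<partial>P) \<partial>lborel)"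
    by (rule PL.Fubini'[symmetric]) (use m2 in \<open>simp add: case_prod_beta'\<close>)
  also have "\<dots> = (\<integral>\<^sup>+t\<in>{0..T}. ennreal (measure P {\<omega> \<in> space P. alive u t \<omega>}) \<partial>lborel)"
  proof (rule nn_integral_cong)
    fix t
    show "(\<integral>\<^sup>+\<omega>. of_bool (alive u t \<omega>) * indicator {0..T} t \<partial>P) = ennreal (measure P {\<omega> \<in> space P. alive u t \<omega>}) * indicator {0..T} t"
      unfolding prob_of_bool[OF pred_alive_P, symmetric] by (cases "t \<in> {0..T}") simp_all
  qed
  finally show ?thesis .
qed

lemma xi_sum_measurable:
  "(\<lambda>z. \<Sum>i. c i * of_nat (xi rate cap (env (fst z)) (Suc i) (snd z) x) :: ennreal) \<in> borel_measurable (P \<Otimes>\<^sub>M lborel)"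
proof -
  interpret M': measurable_env "P \<Otimes>\<^sub>M lborel" "\<lambda>z. env (fst z)" "\<lambda>z. snd z" rate cap
    by (rule env_pair[of "\<lambda>x. x"]) simp
  show ?thesis
    by (intro borel_measurable_suminf_order measurable_compose[OF M'.measurable_xi, of "\<lambda>n. c _ * of_nat n"]) simp
qed

theorem expected_weighted_occupation:
  "(\<integral>\<^sup>+\<omega>. weighted_occupation rate cap (env \<omega>) T x \<partial>P) =
   (\<integral>\<^sup>+t\<in>{0..T}. ennreal (measure P {\<omega> \<in> space P. alive x t \<omega>}) \<partial>lborel)"
proof -
  interpret PL: pair_sigma_finite P lborel ..
  let ?g = "\<lambda>\<omega> t. (\<Sum>i. of_nat (Suc i) * of_nat (xi rate cap (env \<omega>) (Suc i) t x)) :: ennreal"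
  have ind: "(\<lambda>z. indicator {0..T} (snd z) :: ennreal) \<in> borel_measurable (P \<Otimes>\<^sub>M lborel)"
    by (rule measurable_compose[OF measurable_snd]) simp
  have m: "(\<lambda>z. ?g (fst z) (snd z) * indicator {0..T} (snd z)) \<in> borel_measurable (P \<Otimes>\<^sub>M lborel)"
    by (intro borel_measurable_times_ennreal ind xi_sum_measurable)
  have "(\<integral>\<^sup>+\<omega>. weighted_occupation rate cap (env \<omega>) T x \<partial>P) = (\<integral>\<^sup>+\<omega>. \<integral>\<^sup>+t. ?g \<omega> t * indicator {0..T} t \<partial>lborel \<partial>P)"
    by (simp only: weighted_occupation_def)
  also have "\<dots> = (\<integral>\<^sup>+t. \<integral>\<^sup>+\<omega>. ?g \<omega> t * indicator {0..T} t \<partial>P \<partial>lborel)"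
    by (rule PL.Fubini'[symmetric]) (use m in \<open>simp only: case_prod_beta'\<close>)
  also have "\<dots> = (\<integral>\<^sup>+t\<in>{0..T}. ennreal (measure P {\<omega> \<in> space P. alive x t \<omega>}) \<partial>lborel)"
  proof (rule nn_integral_cong)
    fix t
    show "(\<integral>\<^sup>+\<omega>. ?g \<omega> t * indicator {0..T} t \<partial>P) = ennreal (measure P {\<omega> \<in> space P. alive x t \<omega>}) * indicator {0..T} t"
    proof (cases "t \<in> {0..T}")
      case True
      hence "0 \<le> t" by simp
      from expected_weighted_sum[OF this, of x] show ?thesis
        unfolding prob_of_bool[OF pred_alive_P, symmetric] using True by simp
    qed simp
  qed
  finally show ?thesis .
qed

text \<open>Destruction by time \<open>t\<close> produces a partner of the other species, so an
  \<open>A\<close>-particle that is never annihilated is almost surely alive at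
  \<open>t\<close>.\<close>

lemma not_annihilated_le_alive:
  assumes "0 \<le> t"
  shows "measure P {\<omega> \<in> space P. not_annihilated_by_b rate cap (env \<omega>) u} \<le> measure P {\<omega> \<in> space P. alive u t \<omega>}"
proof (rule finite_measure_mono_AE)
  show "AE \<omega> in P. \<omega> \<in> {\<omega> \<in> space P. not_annihilated_by_b rate cap (env \<omega>) u} \<longrightarrow> \<omega> \<in> {\<omega> \<in> space P. alive u t \<omega>}"
    using AE_regular AE_stable[OF assms]
  proof eventually_elim
    case (elim \<omega>)
    interpret regular_env rate cap "env \<omega>" using elim(1) by (rule regular_envI)
    show ?case
    proof (intro impI)
      assume "\<omega> \<in> {\<omega> \<in> space P. not_annihilated_by_b rate cap (env \<omega>) u}"
      hence *: "\<omega> \<in> space P" "spec (env \<omega> u) = TypeA" "\<not> (\<exists>v. spec (env \<omega> v) = TypeB \<and> annihilates rate cap (env \<omega>) u v)"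
        by (auto simp: not_annihilated_by_b_def annihilated_by_b_def)
      have "\<not> destroyed rate cap (env \<omega>) t u"
      proof
        assume "destroyed rate cap (env \<omega>) t u"
        then obtain w where w: "spec (env \<omega> w) \<noteq> spec (env \<omega> u)" "annihilates rate cap (env \<omega>) u w"
          using stable_annihilated[OF elim(2) assms] by blast
        have "spec (env \<omega> w) = TypeB" using w(1) *(2) by (cases "spec (env \<omega> w)") simp_all
        thus False using *(3) w(2) by blast
      qed
      thus "\<omega> \<in> {\<omega> \<in> space P. alive u t \<omega>}" using * by simp
    qed
  qed
  show "{\<omega> \<in> space P. alive u t \<omega>} \<in> events" using pred_alive_P by (simp add: pred_def)
qed

lemma not_annihilated_le_integral:
  assumes "0 \<le> T"
  shows "ennreal (measure P {\<omega> \<in> space P. not_annihilated_by_b rate cap (env \<omega>) u} * T) \<le>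
    (\<integral>\<^sup>+t\<in>{0..T}. ennreal (measure P {\<omega> \<in> space P. alive u t \<omega>}) \<partial>lborel)"
proof -
  let ?m = "measure P {\<omega> \<in> space P. not_annihilated_by_b rate cap (env \<omega>) u}"
  have "ennreal (?m * T) = (\<integral>\<^sup>+t. ennreal ?m * indicator {0..T} t \<partial>lborel)"
    using assms by (simp add: nn_integral_cmult_indicator ennreal_mult)
  also have "\<dots> \<le> (\<integral>\<^sup>+t\<in>{0..T}. ennreal (measure P {\<omega> \<in> space P. alive u t \<omega>}) \<partial>lborel)"
  proof (rule nn_integral_mono)
    fix t
    show "ennreal ?m * indicator {0..T} t \<le> ennreal (measure P {\<omega> \<in> space P. alive u t \<omega>}) * indicator {0..T} t"
      by (cases "t \<in> {0..T}") (simp_all add: not_annihilated_le_alive ennreal_leI)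
  qed
  finally show ?thesis .
qed

text \<open>Clusters of type \<open>A\<close> have size at most \<open>2 * M\<close>: larger sizes
  contribute 0, and for the others the weight \<open>Suc i\<close> is at most
  \<open>2 * M\<close>.\<close>

lemma weighted_le_occupation:
  assumes M: "cap TypeA = enat M" "1 \<le> M"
  shows "(\<integral>\<^sup>+\<omega>. weighted_occupation rate cap (env \<omega>) T x \<partial>P) \<le>
     of_nat (2 * M) * (\<integral>\<^sup>+\<omega>. occupation rate cap (env \<omega>) T x \<partial>P)"
proof -
  let ?h = "\<lambda>\<omega> t. (\<Sum>i. of_nat (xi rate cap (env \<omega>) (Suc i) t x)) :: ennreal"
  have ind: "(\<lambda>z. indicator {0..T} (snd z) :: ennreal) \<in> borel_measurable (P \<Otimes>\<^sub>M lborel)"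
    by (rule measurable_compose[OF measurable_snd]) simp
  have m: "(\<lambda>z. ?h (fst z) (snd z) * indicator {0..T} (snd z)) \<in> borel_measurable (P \<Otimes>\<^sub>M lborel)"
    using xi_sum_measurable[of "\<lambda>_. 1" x] by (intro borel_measurable_times_ennreal ind) simp
  have m1: "(\<lambda>t. ?h \<omega> t * indicator {0..T} t) \<in> borel_measurable lborel" if "\<omega> \<in> space P" for \<omega>
    using measurable_compose[OF measurable_Pair1'[OF that] m] by simp
  have m2: "(\<lambda>\<omega>. \<integral>\<^sup>+t. ?h \<omega> t * indicator {0..T} t \<partial>lborel) \<in> borel_measurable P"
    by (rule lborel.borel_measurable_nn_integral) (use m in \<open>simp only: case_prod_beta'\<close>)
  have "(\<integral>\<^sup>+\<omega>. weighted_occupation rate cap (env \<omega>) T x \<partial>P) \<le> (\<integral>\<^sup>+\<omega>. of_nat (2 * M) * (\<integral>\<^sup>+t. ?h \<omega> t * indicator {0..T} t \<partial>lborel) \<partial>P)"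
  proof (rule nn_integral_mono_AE)
    have "AE \<omega> in P. \<omega> \<in> space P" by (rule AE_space)
    with AE_regular show "AE \<omega> in P. weighted_occupation rate cap (env \<omega>) T x \<le> of_nat (2 * M) * (\<integral>\<^sup>+t. ?h \<omega> t * indicator {0..T} t \<partial>lborel)"
    proof eventually_elim
      case (elim \<omega>)
      interpret regular_env rate cap "env \<omega>" using elim(1) by (rule regular_envI)
      have bound: "of_nat (Suc i) * of_nat (xi rate cap (env \<omega>) (Suc i) t x) \<le> (of_nat (2 * M) * of_nat (xi rate cap (env \<omega>) (Suc i) t x) :: ennreal)" for i t
      proof (cases "Suc i \<le> 2 * M")
        case True
        thus ?thesis by (intro mult_right_mono) (simp_all only: of_nat_le_iff zero_le)
      next
        case False
        have "{l. spec (env \<omega> l) = TypeA \<and> position rate (env \<omega>) l t = x \<and> card {v. follows rate cap (env \<omega>) t v l} = Suc i} = {}"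
          using card_followers_le[OF M, of _ t] False by force
        hence "xi rate cap (env \<omega>) (Suc i) t x = 0" unfolding xi_def by (simp only: card.empty)
        thus ?thesis by simp
      qed
      have "weighted_occupation rate cap (env \<omega>) T x \<le> (\<integral>\<^sup>+t. of_nat (2 * M) * (?h \<omega> t * indicator {0..T} t) \<partial>lborel)"
        unfolding weighted_occupation_def
      proof (rule nn_integral_mono)
        fix t
        have "(\<Sum>i. of_nat (Suc i) * of_nat (xi rate cap (env \<omega>) (Suc i) t x)) \<le> (\<Sum>i. of_nat (2 * M) * of_nat (xi rate cap (env \<omega>) (Suc i) t x) :: ennreal)"
          by (rule suminf_le[OF bound summableI summableI])
        also have "\<dots> = of_nat (2 * M) * ?h \<omega> t" by (rule ennreal_suminf_cmult)
        finally show "(\<Sum>i. of_nat (Suc i) * of_nat (xi rate cap (env \<omega>) (Suc i) t x)) * indicator {0..T} t \<le> of_nat (2 * M) * (?h \<omega> t * indicator {0..T} t)"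
          unfolding mult.assoc[symmetric] by (intro mult_right_mono) simp_all
      qed
      also have "\<dots> = of_nat (2 * M) * (\<integral>\<^sup>+t. ?h \<omega> t * indicator {0..T} t \<partial>lborel)"
        by (rule nn_integral_cmult[OF m1[OF elim(2)]])
      finally show ?case .
    qed
  qed
  also have "\<dots> = of_nat (2 * M) * (\<integral>\<^sup>+\<omega>. \<integral>\<^sup>+t. ?h \<omega> t * indicator {0..T} t \<partial>lborel \<partial>P)"
    by (rule nn_integral_cmult[OF m2])
  finally show ?thesis by (simp only: occupation_def)
qed

end

theorem theorem2:
  fixes adj :: "'v \<Rightarrow> 'v \<Rightarrow> bool" and K :: "'v \<Rightarrow> 'v \<Rightarrow> real" and \<Gamma> :: "('v \<Rightarrow> 'v) set"
    and root :: 'v and rate :: "species \<Rightarrow> real" and cap :: "species \<Rightarrow> enat" and p T :: real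
    and P :: "'w measure" and \<eta> :: "'v \<Rightarrow> 'w \<Rightarrow> 'v particle"
  defines "env \<equiv> \<lambda>\<omega> x. \<eta> x \<omega>"
  assumes graph: "simple_lf_connected_graph adj"
    and kernel: "transition_kernel adj K"
    and subgroup: "subgroup \<Gamma> (Aut_K adj K)"
    and transitive: "transitive_on \<Gamma>"
    and unimodular: "unimodular_on \<Gamma>"
    and accessible: "infinitely_accessible adj K \<Gamma>"
    and rates: "0 < rate TypeA" "0 \<le> rate TypeB"
    and density: "0 \<le> p" "p \<le> 1"
    and random: "dlacs_randomness K p P \<eta>"
    and time: "0 \<le> T"
  shows "(\<integral>\<^sup>+\<omega>. weighted_occupation rate cap (env \<omega>) T root \<partial>P) =
           (\<integral>\<^sup>+t\<in>{0..T}. ennreal (measure P {\<omega> \<in> space P. lifespan rate cap (env \<omega>) root > ennreal t}) \<partial>lborel)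
       \<and> (\<integral>\<^sup>+t\<in>{0..T}. ennreal (measure P {\<omega> \<in> space P. lifespan rate cap (env \<omega>) root > ennreal t}) \<partial>lborel) \<ge>
           ennreal (measure P {\<omega> \<in> space P. not_annihilated_by_b rate cap (env \<omega>) root} * T)
       \<and> (\<forall>M. cap TypeA = enat M \<longrightarrow>
            (\<integral>\<^sup>+\<omega>. occupation rate cap (env \<omega>) T root \<partial>P) \<ge>
              ennreal (measure P {\<omega> \<in> space P. not_annihilated_by_b rate cap (env \<omega>) root} / (2 * real M) * T))"
proof -
  interpret D: dlacs adj K \<Gamma> rate cap p P \<eta>
    by (rule dlacs.intro) fact+
  let ?m = "measure P {\<omega> \<in> space P. not_annihilated_by_b rate cap (env \<omega>) root}"
  let ?W = "\<integral>\<^sup>+\<omega>. weighted_occupation rate cap (env \<omega>) T root \<partial>P"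
  let ?V = "\<integral>\<^sup>+\<omega>. occupation rate cap (env \<omega>) T root \<partial>P"
  let ?S = "\<integral>\<^sup>+t\<in>{0..T}. ennreal (measure P {\<omega> \<in> space P. lifespan rate cap (env \<omega>) root > ennreal t}) \<partial>lborel"
  have W: "?W = ?S"
    unfolding env_def D.lifespan_integral by (rule D.expected_weighted_occupation)
  have ge: "ennreal (?m * T) \<le> ?S"
    unfolding env_def D.lifespan_integral by (rule D.not_annihilated_le_integral[OF time])
  have "ennreal (?m / (2 * real M) * T) \<le> ?V" if M: "cap TypeA = enat M" for M
  \<comment> \<open>For \<open>M = 0\<close> division by zero makes the lower bound 0, so the claim
    is trivial; otherwise \<open>1 \<le> M\<close>, as the cluster bound requires.\<close>
  proof (cases "M = 0")
    case False
    hence pos: "1 \<le> M" by simp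
    have "ennreal (?m * T) \<le> ?W" using ge by (simp only: W)
    also have "?W \<le> of_nat (2 * M) * ?V" unfolding env_def by (rule D.weighted_le_occupation[OF M pos])
    finally have "ennreal (1 / (2 * real M)) * ennreal (?m * T) \<le> ennreal (1 / (2 * real M)) * (of_nat (2 * M) * ?V)"
      by (rule mult_left_mono) simp
    moreover have "ennreal (1 / (2 * real M)) * ennreal (?m * T) = ennreal (?m / (2 * real M) * T)"
      using time by (subst ennreal_mult[symmetric]) simp_all
    moreover have "ennreal (1 / (2 * real M)) * (of_nat (2 * M) * ?V) = ?V"
    proof -
      have "ennreal (1 / (2 * real M)) * of_nat (2 * M) = ennreal (1 / (2 * real M)) * ennreal (real (2 * M))"
        by (simp only: ennreal_of_nat_eq_real_of_nat)
      also have "\<dots> = ennreal (1 / (2 * real M) * real (2 * M))"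
        by (rule ennreal_mult[symmetric]) simp_all
      also have "1 / (2 * real M) * real (2 * M) = 1" using False by simp
      finally show ?thesis by (simp only: mult.assoc[symmetric] ennreal_1 mult_1_left)
    qed
    ultimately show ?thesis by simp
  qed simp
  thus ?thesis using W ge by blast
qed

end
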